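(* Let $H$ be a Hénon map in $\mathbb{C}^2$. If $F$ is a polynomial automorphism of $\mathbb{C}^2$ such that $$F\left(K_{H,c}^+\right)=K_{H,c}^+$$ for some $c>0$, then $F$ is an affine automorphism of the form $$(x,y)\mapsto (ax+by+f,\ dy+g)$$ for some $a,b,d,f,g\in\mathbb{C}$.
   Context: A Hénon map is a polynomial automorphism of $\mathbb{C}^2$ of the form $H=H_k\circ H_{k-1}\circ\cdots\circ H_1$ ($k\ge 1$), where $H_j(x,y)=(y,\ p_j(y)-\delta_j x)$ with $p_j$ a complex polynomial of degree $d_j\geq 2$ and $0\neq\delta_j\in\mathbb{C}$. The degree of $H$ is $d_H=d_1d_2\cdots d_k$. The Green function of $H$ is $G_H^{+}(x,y)=\lim_{n\to\infty}\frac{1}{d_H^{\,n}}\log^+\|H^{n}(x,y)\|$ for $(x,y)\in\mathbb{C}^2$, where $\log^+ t=\max\{\log t,0\}$ and $H^n$ is the $n$-fold iterate (the limit exists and is continuous on $\mathbb{C}^2$). For $c>0$, $K_{H,c}^+=\{(x,y)\in\mathbb{C}^2: G_H^+(x,y)=c\}$. A polynomial automorphism of $\mathbb{C}^2$ is a bijective polynomial map with polynomial inverse. *)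

theory Defs
  imports "HOL-Analysis.Analysis" "HOL-Computational_Algebra.Polynomial"
begin

(* P :: complex poly poly encodes a polynomial in two variables: a polynomial in y whose
   coefficients are polynomials in x. *)
definition poly2 :: "complex poly poly \<Rightarrow> complex \<times> complex \<Rightarrow> complex" where
  "poly2 P = (\<lambda>(x, y). poly (poly P [:y:]) x)"

definition polynomial_map :: "(complex \<times> complex \<Rightarrow> complex \<times> complex) \<Rightarrow> bool" where
  "polynomial_map F \<longleftrightarrow> (\<exists>P Q. \<forall>z. F z = (poly2 P z, poly2 Q z))"

definition polynomial_automorphism :: "(complex \<times> complex \<Rightarrow> complex \<times> complex) \<Rightarrow> bool" where
  "polynomial_automorphism F \<longleftrightarrow> polynomial_map F \<and> bij F \<and> polynomial_map (inv F)"

definition elementary_henon :: "complex poly \<times> complex \<Rightarrow> complex \<times> complex \<Rightarrow> complex \<times> complex" where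
  "elementary_henon = (\<lambda>(p, \<delta>) (x, y). (y, poly p y - \<delta> * x))"

(* A Henon map is given by the list [(p_1, delta_1), ..., (p_k, delta_k)] of its factors. *)
definition henon_data :: "(complex poly \<times> complex) list \<Rightarrow> bool" where
  "henon_data hs \<longleftrightarrow> hs \<noteq> [] \<and> (\<forall>(p, \<delta>) \<in> set hs. degree p \<ge> 2 \<and> \<delta> \<noteq> 0)"

(* fold applies the head of the list first, so this is H_k o ... o H_1. *)
definition henon_map :: "(complex poly \<times> complex) list \<Rightarrow> complex \<times> complex \<Rightarrow> complex \<times> complex" where
  "henon_map hs = fold elementary_henon hs"

definition henon_degree :: "(complex poly \<times> complex) list \<Rightarrow> nat" where
  "henon_degree hs = (\<Prod>(p, \<delta>)\<leftarrow>hs. degree p)"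

(* ln 0 = 0 in HOL, so log_plus 0 = 0, in agreement with the convention log 0 = -infinity. *)
definition log_plus :: "real \<Rightarrow> real" where
  "log_plus t = max (ln t) 0"

(* norm on complex \<times> complex is the Euclidean norm. *)
definition green_plus :: "(complex poly \<times> complex) list \<Rightarrow> complex \<times> complex \<Rightarrow> real" where
  "green_plus hs z =
     lim (\<lambda>n. 1 / real (henon_degree hs) ^ n * log_plus (norm ((henon_map hs ^^ n) z)))"

definition green_level :: "(complex poly \<times> complex) list \<Rightarrow> real \<Rightarrow> (complex \<times> complex) set" where
  "green_level hs c = {z. green_plus hs z = c}"

end

theory Submission
  imports Defs "HOL-Complex_Analysis.Complex_Analysis"
    "HOL-Computational_Algebra.Fundamental_Theorem_Algebra"
begin

text \<open>
Repeat the elementary factors periodically and let \<open>\<Phi> n\<close> be the composition of the first \<open>n\<close> of them,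
\<open>D n\<close> its degree and \<open>T n = exp (c * D n)\<close>. A polynomial restricted to the level set \<open>L\<close> grows like a
power of \<open>\<bar>x\<bar>\<close>, by a Newton polygon argument, so \<open>\<bar>x \<circ> F\<bar>\<close> is comparable to \<open>\<bar>x\<bar>\<close> raised to some \<open>\<lambda>\<close>
on \<open>L\<close>, and the exponents of \<open>F\<close> and of its inverse are reciprocal. The orbit of a point of \<open>L\<close> with
\<open>\<bar>x\<bar>\<close> at most \<open>T n ^ D n\<close> has size at most about \<open>T n\<close> at time \<open>n\<close>. By the maximum principle on vertical
slices, growth exponents therefore bound the conjugates \<open>\<Phi> n \<circ> F \<circ> inv (\<Phi> n)\<close> on bidiscs of radius
comparable to \<open>T n\<close>. An exponent below 1 would make a conjugate of an iterate contract too much for its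
constant Jacobian, so \<open>\<lambda> = 1\<close> and the conjugates map the bidisc of radius \<open>T n / K\<close> into that of radius
\<open>K * T n\<close>. By the Cauchy estimates they are affine up to errors of order \<open>1 / T n\<close>. Consecutive conjugates
are intertwined by a Henon map, which forces their coefficients to be periodic in \<open>n\<close>, with twice the
number of factors as period, up to such errors. As \<open>T n\<close> grows doubly exponentially, two intertwining
sequences that are this close coincide. Hence \<open>F\<close> equals infinitely many of its own conjugates, and it is affine.
\<close>

section \<open>Polynomial functions of one and two variables\<close>

text \<open>\<open>F\<close> is controlled only on the unbounded set \<open>L\<close>, and nothing
  ties it to the dynamics beforehand. The growth of \<open>x\<close> on \<open>L\<close> becomes
  usable because passing to time \<open>n\<close> amounts to taking a root of order
  \<open>D n\<close>: \<open>fst_le_root\<close> gives this, \<open>norm_\<Psi>_le\<close> the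
  converse. A constant factor in a bound on \<open>L\<close> then costs at most the same factor at
  time \<open>n\<close>, whatever \<open>n\<close> is, so no constant degenerates. As
  \<open>T n ^ D n\<close> is the exponential of \<open>c\<close> times the square of
  \<open>D n\<close>, growth exponents are weighed against ratios of squared degrees.

  The elementary factors are kept apart because each has an explicit derivative, so that the
  intertwining relation between consecutive conjugates becomes a few scalar equations. Each factor
  exchanges the roles of the coordinates; the diagonal entries of the derivatives at 0 therefore
  alternate, and only an even number of steps returns them to themselves. This is why twice the
  number of factors is the period. The equations separate into their unknowns because the derivative
  of a polynomial of degree at least 2 is not constant.\<close>

definition poly_fun :: "(complex \<times> complex \<Rightarrow> complex) \<Rightarrow> bool" where
  "poly_fun f \<longleftrightarrow> (\<exists>R. f = poly2 R)"

lemma poly2_pCons: "poly2 (pCons a R) z = poly a (fst z) + snd z * poly2 R z"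
  by (cases z) (simp add: poly2_def)

lemma poly2_0 [simp]: "poly2 0 z = 0"
  by (cases z) (simp add: poly2_def)

lemma poly_fun_poly2 [intro]: "poly_fun (poly2 R)"
  by (auto simp: poly_fun_def)

lemma poly_fun_const [intro]: "poly_fun (\<lambda>z. a)"
  unfolding poly_fun_def by (rule exI[of _ "[:[:a:]:]"]) (auto simp: poly2_pCons fun_eq_iff)

lemma poly_fun_fst [intro]: "poly_fun (\<lambda>z. fst z)"
  unfolding poly_fun_def by (rule exI[of _ "[:[:0,1:]:]"]) (auto simp: poly2_pCons fun_eq_iff)

lemma poly_fun_snd [intro]: "poly_fun (\<lambda>z. snd z)"
  unfolding poly_fun_def by (rule exI[of _ "[:0,1:]"]) (auto simp: poly2_pCons fun_eq_iff)

lemma poly_fun_add [intro]: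
  assumes "poly_fun f" "poly_fun g" shows "poly_fun (\<lambda>z. f z + g z)"
proof -
  from assms obtain R S where "f = poly2 R" "g = poly2 S" by (auto simp: poly_fun_def)
  then show ?thesis unfolding poly_fun_def
    by (intro exI[of _ "R + S"]) (auto simp: poly2_def fun_eq_iff)
qed

lemma poly_fun_mult [intro]:
  assumes "poly_fun f" "poly_fun g" shows "poly_fun (\<lambda>z. f z * g z)"
proof -
  from assms obtain R S where "f = poly2 R" "g = poly2 S" by (auto simp: poly_fun_def)
  then show ?thesis unfolding poly_fun_def
    by (intro exI[of _ "R * S"]) (auto simp: poly2_def fun_eq_iff)
qed

lemma poly_fun_diff [intro]:
  assumes "poly_fun f" "poly_fun g" shows "poly_fun (\<lambda>z. f z - g z)"
  using poly_fun_add[OF assms(1) poly_fun_mult[OF poly_fun_const[of "-1"] assms(2)]] by simp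

lemma poly_fun_poly [intro]:
  assumes "poly_fun f" shows "poly_fun (\<lambda>z. poly p (f z))"
  by (induction p) (auto intro!: assms)

lemma poly_fun_comp2:
  assumes "poly_fun f" "poly_fun g" "poly_fun h" shows "poly_fun (\<lambda>z. f (g z, h z))"
proof -
  have "poly_fun (\<lambda>z. poly2 R (g z, h z))" for R
    by (induction R) (auto simp: poly2_pCons intro!: assms)
  then show ?thesis using assms(1) by (auto simp: poly_fun_def)
qed

section \<open>Partial derivatives of polynomial functions and restriction to lines\<close>

definition Dx :: "(complex \<times> complex \<Rightarrow> complex) \<Rightarrow> complex \<times> complex \<Rightarrow> complex" where
  "Dx f z = deriv (\<lambda>t. f (t, snd z)) (fst z)"

definition Dy :: "(complex \<times> complex \<Rightarrow> complex) \<Rightarrow> complex \<times> complex \<Rightarrow> complex" where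
  "Dy f z = deriv (\<lambda>t. f (fst z, t)) (snd z)"

lemma poly2_partial_derivs:
  "((\<lambda>t. poly2 R (t, y)) has_field_derivative poly2 (map_poly pderiv R) (x, y)) (at x)"
  "((\<lambda>t. poly2 R (x, t)) has_field_derivative poly2 (pderiv R) (x, y)) (at y)"
  "(poly2 R has_derivative (\<lambda>h. poly2 (map_poly pderiv R) z * fst h + poly2 (pderiv R) z * snd h)) (at z)"
proof -
  have mp: "map_poly pderiv (pCons a R) = pCons (pderiv a) (map_poly pderiv R)" for a :: "complex poly" and R
    by (simp add: map_poly_pCons)
  have pd: "poly2 (pderiv (pCons a R)) z = poly2 R z + snd z * poly2 (pderiv R) z" for a R z
    by (cases z) (simp add: pderiv_pCons poly2_def)
  show "((\<lambda>t. poly2 R (t, y)) has_field_derivative poly2 (map_poly pderiv R) (x, y)) (at x)"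
  proof (induction R)
    case (pCons a R)
    show ?case unfolding poly2_pCons mp fst_conv snd_conv
      by (rule derivative_eq_intros poly_DERIV pCons.IH refl | simp)+
  qed simp
  show "((\<lambda>t. poly2 R (x, t)) has_field_derivative poly2 (pderiv R) (x, y)) (at y)"
  proof (induction R)
    case (pCons a R)
    show ?case unfolding poly2_pCons pd fst_conv snd_conv
      by (rule derivative_eq_intros poly_DERIV pCons.IH refl | simp)+
  qed simp
  show "(poly2 R has_derivative (\<lambda>h. poly2 (map_poly pderiv R) z * fst h + poly2 (pderiv R) z * snd h)) (at z)"
  proof (induction R)
    case (pCons a R)
    have d: "((\<lambda>z. poly a (fst z)) has_derivative (\<lambda>h. poly (pderiv a) (fst z) * fst h)) (at z)"
    proof -
      have "(poly a has_derivative (\<lambda>h. poly (pderiv a) (fst z) * h)) (at (fst z))"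
        using poly_DERIV[of a "fst z"] by (simp add: has_field_derivative_def)
      from has_derivative_compose[OF has_derivative_fst[OF has_derivative_ident] this] show ?thesis by simp
    qed
    have "((\<lambda>z. poly a (fst z) + snd z * poly2 R z) has_derivative
       (\<lambda>h. poly2 (map_poly pderiv (pCons a R)) z * fst h + poly2 (pderiv (pCons a R)) z * snd h)) (at z)"
      by (rule derivative_eq_intros d pCons.IH refl)+ (auto simp: mp pd poly2_pCons algebra_simps)
    then show ?case by (simp add: poly2_pCons[abs_def])
  qed (simp add: poly2_def[abs_def] case_prod_unfold)
qed

lemma
  assumes "poly_fun f"
  shows DERIV_fst: "((\<lambda>t. f (t, y)) has_field_derivative Dx f (x, y)) (at x)"
    and DERIV_snd: "((\<lambda>t. f (x, t)) has_field_derivative Dy f (x, y)) (at y)"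
    and poly_fun_has_derivative: "(f has_derivative (\<lambda>h. Dx f z * fst h + Dy f z * snd h)) (at z)"
    and poly_fun_Dx: "poly_fun (Dx f)"
    and poly_fun_Dy: "poly_fun (Dy f)"
proof -
  obtain R where R: "f = poly2 R" using assms by (auto simp: poly_fun_def)
  have x: "Dx f = poly2 (map_poly pderiv R)"
    unfolding Dx_def R using DERIV_imp_deriv[OF poly2_partial_derivs(1)] by fastforce
  have y: "Dy f = poly2 (pderiv R)"
    unfolding Dy_def R using DERIV_imp_deriv[OF poly2_partial_derivs(2)] by fastforce
  show "((\<lambda>t. f (t, y)) has_field_derivative Dx f (x, y)) (at x)"
    "((\<lambda>t. f (x, t)) has_field_derivative Dy f (x, y)) (at y)"
    "(f has_derivative (\<lambda>h. Dx f z * fst h + Dy f z * snd h)) (at z)"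
    "poly_fun (Dx f)" "poly_fun (Dy f)"
    unfolding x y unfolding R using poly2_partial_derivs by auto
qed

lemma poly_fun_univariate:
  assumes "poly_fun f"
  shows "\<exists>q. \<forall>t. f (t, y) = poly q t" "\<exists>q. \<forall>t. f (x, t) = poly q t"
proof -
  obtain R where R: "f = poly2 R" using assms by (auto simp: poly_fun_def)
  show "\<exists>q. \<forall>t. f (t, y) = poly q t" unfolding R by (rule exI[of _ "poly R [:y:]"]) (simp add: poly2_def)
  have "\<exists>q. \<forall>t. poly2 R (x, t) = poly q t"
  proof (induction R)
    case 0 show ?case by (rule exI[of _ 0]) simp
  next
    case (pCons a R)
    then obtain q where "\<forall>t. poly2 R (x, t) = poly q t" by blast
    then show ?case by (intro exI[of _ "[:poly a x:] + [:0,1:] * q"]) (simp add: poly2_pCons)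
  qed
  then show "\<exists>q. \<forall>t. f (x, t) = poly q t" unfolding R .
qed

text \<open>On each line parallel to an axis the function is a polynomial without zeros, hence
  constant by the fundamental theorem of algebra; two such lines join any two points. It is meant
  for Jacobians of automorphisms.\<close>

lemma poly_fun_nonvanishing_const:
  assumes "poly_fun f" "\<And>z. f z \<noteq> 0"
  shows "f z = f w"
proof -
  have c: "poly q s = poly q t" if "\<And>t. poly q t \<noteq> 0" for q :: "complex poly" and s t
  proof -
    have "\<exists>a l. a \<noteq> 0 \<and> l = 0 \<and> q = pCons a l"
      using that fundamental_theorem_of_algebra_alt by blast
    then show ?thesis by auto
  qed
  have "f (fst z, snd z) = f (fst w, snd z)"
    using poly_fun_univariate(1)[OF assms(1), of "snd z"] c assms(2) by metis
  also have "\<dots> = f (fst w, snd w)"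
    using poly_fun_univariate(2)[OF assms(1), of "fst w"] c assms(2) by metis
  finally show ?thesis by simp
qed

lemma poly_fun_zero_on_bidisc:
  assumes "poly_fun f" "\<And>u v. norm u \<le> 1 \<Longrightarrow> norm v \<le> 1 \<Longrightarrow> f (u, v) = 0"
  shows "f z = 0"
proof -
  have z: "poly q t = 0" if "\<And>t. norm t \<le> 1 \<Longrightarrow> poly q t = 0" for q :: "complex poly" and t
  proof -
    have "infinite (cball (0::complex) 1)" by (rule uncountable_infinite) (simp add: uncountable_cball)
    moreover have "cball 0 1 \<subseteq> {t. poly q t = 0}" using that by auto
    ultimately have "infinite {t. poly q t = 0}" using finite_subset by blast
    then have "q = 0" using poly_roots_finite by blast
    then show ?thesis by simp
  qed
  have "f (u, v) = 0" if "norm v \<le> 1" for u v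
    using poly_fun_univariate(1)[OF assms(1), of v] z assms(2) that by metis
  then have "f (u, v) = 0" for u v
    using poly_fun_univariate(2)[OF assms(1), of u] z by metis
  then show ?thesis by (cases z) simp
qed

section \<open>Root multiplicities and monomials of largest weight\<close>

lemma order_le_order_0:
  fixes q :: "complex poly"
  assumes "q \<noteq> 0" "a \<noteq> 0"
  shows "order a q + order 0 q \<le> degree q"
proof -
  define l where "l = order a q"
  obtain r where q: "q = [:-a, 1:] ^ l * r" using order_1[of a q] by (auto elim: dvdE simp: l_def)
  then have r: "r \<noteq> 0" using assms(1) by auto
  have "order 0 q = order 0 ([:-a, 1:] ^ l) + order 0 r"
    using q assms(1) order_mult by metis
  also have "order 0 ([:-a, 1:] ^ l) = 0"
    by (rule order_0I) (use assms(2) in simp)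
  finally have "order 0 q \<le> degree r" using order_degree[OF r, of 0] by simp
  moreover have "degree q = l + degree r"
    unfolding q using r by (simp add: degree_mult_eq degree_power_eq)
  ultimately show ?thesis by (simp add: l_def)
qed

text \<open>The sum is the coefficient of degree \<open>order a q\<close> in the expansion of
  \<open>q\<close> around \<open>a\<close>. It equals the value at \<open>a\<close> of the cofactor
  of the full power of the linear factor, which cannot vanish. In this expanded form it appears as a
  coefficient in \<open>top_mono_step\<close>.\<close>

lemma taylor_coeff_order:
  fixes q :: "complex poly"
  assumes "q \<noteq> 0"
  shows "(\<Sum>i\<le>degree q. coeff q i * of_nat (i choose order a q) * a ^ (i - order a q)) \<noteq> 0"
proof -
  define l where "l = order a q"
  obtain r where q: "q = [:-a, 1:] ^ l * r" using order_1[of a q] by (auto elim: dvdE simp: l_def)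
  have ra: "poly r a \<noteq> 0"
  proof
    assume "poly r a = 0"
    then have "[:-a, 1:] dvd r" by (simp add: poly_eq_0_iff_dvd)
    then have "[:-a, 1:] ^ Suc l dvd q"
      unfolding q power_Suc2 by (intro mult_dvd_mono dvd_refl)
    then show False using order_2[OF assms] l_def by blast
  qed
  have "pcompose q [:a, 1:] = pcompose ([:-a, 1:] ^ l) [:a, 1:] * pcompose r [:a, 1:]"
    by (subst q) (simp add: pcompose_mult)
  also have "pcompose ([:-a, 1:] ^ l) [:a, 1:] = monom 1 l"
    by (simp add: poly_eq_poly_eq_iff[symmetric] fun_eq_iff poly_pcompose poly_monom)
  finally have 1: "coeff (pcompose q [:a, 1:]) l = poly r a"
    by (simp add: coeff_monom_mult)
  have "pcompose q [:a, 1:] = (\<Sum>i\<le>degree q. smult (coeff q i) ([:a, 1:] ^ i))"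
    by (simp add: poly_eq_poly_eq_iff[symmetric] fun_eq_iff poly_pcompose poly_sum poly_altdef[of q])
  then have "coeff (pcompose q [:a, 1:]) l = (\<Sum>i\<le>degree q. coeff q i * coeff ([:a, 1:] ^ i) l)"
    by (simp add: coeff_sum)
  also have "\<dots> = (\<Sum>i\<le>degree q. coeff q i * of_nat (i choose l) * a ^ (i - l))"
  proof (intro sum.cong refl)
    fix i
    show "coeff q i * coeff ([:a, 1:] ^ i) l = coeff q i * of_nat (i choose l) * a ^ (i - l)"
    proof (cases "l \<le> i")
      case False
      have "degree ([:a, 1:] ^ i) = i" by (simp add: degree_power_eq)
      then have "coeff ([:a, 1:] ^ i) l = 0" using False by (intro coeff_eq_0) simp
      then show ?thesis using False by (simp add: binomial_eq_0)
    qed (simp add: coeff_linear_poly_power)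
  qed
  finally show ?thesis using 1 ra by (simp add: l_def)
qed

text \<open>Here \<open>i\<close> is the exponent of \<open>x\<close> and \<open>j\<close> that of
  \<open>y\<close>. Other monomials may have the same total degree; the case \<open>j = 0\<close> is
  the one aimed at.\<close>

definition top_mono :: "complex poly poly \<Rightarrow> nat \<Rightarrow> nat \<Rightarrow> bool" where
  "top_mono R i j \<longleftrightarrow> coeff (coeff R j) i \<noteq> 0 \<and>
     (\<forall>i' j'. coeff (coeff R j') i' \<noteq> 0 \<longrightarrow> i' + j' \<le> i + j)"

lemma finite_support2: "finite {(i, j). coeff (coeff R j) i \<noteq> (0 :: complex)}"
proof -
  define m where "m = (\<Sum>j\<le>degree R. degree (coeff R j))"
  have nz: "j \<le> degree R" if "coeff (coeff R j) i \<noteq> 0" for i j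
    using that by (intro le_degree) auto
  have "degree (coeff R j) \<le> m" for j
  proof (cases "j \<le> degree R")
    case True then show ?thesis unfolding m_def by (intro member_le_sum) auto
  qed (simp add: coeff_eq_0)
  then have "{(i, j). coeff (coeff R j) i \<noteq> 0} \<subseteq> {..m} \<times> {..degree R}"
    using nz by (auto intro: order_trans[OF le_degree])
  then show ?thesis by (rule finite_subset) auto
qed

lemma max_mono_exists:
  assumes "R \<noteq> (0 :: complex poly poly)"
  shows "\<exists>i j. coeff (coeff R j) i \<noteq> 0 \<and>
     (\<forall>i' j'. coeff (coeff R j') i' \<noteq> 0 \<longrightarrow> w * i' + j' \<le> w * i + j)"
proof -
  let ?S = "{(i, j). coeff (coeff R j) i \<noteq> 0}"
  have fin: "finite ?S" by (rule finite_support2)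
  have ne: "?S \<noteq> {}"
  proof -
    have "lead_coeff (lead_coeff R) \<noteq> 0" using assms by simp
    then show ?thesis by fastforce
  qed
  define W where "W = (\<lambda>(i, j). w * i + j)"
  have "Max (W ` ?S) \<in> W ` ?S" using fin ne by (intro Max_in) auto
  then obtain z where z: "z \<in> ?S" "Max (W ` ?S) = W z" by blast
  have "W y \<le> W z" if "y \<in> ?S" for y
    unfolding z(2)[symmetric] using fin that by (intro Max_ge) auto
  then show ?thesis using z(1) by (fastforce simp: W_def)
qed

lemma top_mono_exists: "R \<noteq> 0 \<Longrightarrow> \<exists>i j. top_mono R i j"
  using max_mono_exists[of R 1] by (auto simp: top_mono_def)

lemma poly2_sum_monoms:
  assumes "finite S" "{(i, j). coeff (coeff R j) i \<noteq> 0} \<subseteq> S"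
  shows "poly2 R (x, y) = (\<Sum>(i, j)\<in>S. coeff (coeff R j) i * x ^ i * y ^ j)"
proof -
  have nz: "j \<le> degree R" if "coeff (coeff R j) i \<noteq> 0" for i j
    using that by (intro le_degree) auto
  have "poly2 R (x, y) = (\<Sum>j\<le>degree R. poly (coeff R j) x * y ^ j)"
    by (simp add: poly2_def poly_altdef[of R] poly_sum)
  also have "\<dots> = (\<Sum>j\<le>degree R. \<Sum>i\<le>degree (coeff R j). coeff (coeff R j) i * x ^ i * y ^ j)"
    by (simp only: poly_altdef[of _ x] sum_distrib_right)
  also have "\<dots> = (\<Sum>(j, i)\<in>Sigma {..degree R} (\<lambda>j. {..degree (coeff R j)}). coeff (coeff R j) i * x ^ i * y ^ j)"
    by (subst sum.Sigma) auto
  also have "\<dots> = (\<Sum>(j, i)\<in>{(j, i). coeff (coeff R j) i \<noteq> 0}. coeff (coeff R j) i * x ^ i * y ^ j)"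
    by (intro sum.mono_neutral_right) (auto intro: le_degree simp: nz)
  also have "\<dots> = (\<Sum>(i, j)\<in>{(i, j). coeff (coeff R j) i \<noteq> 0}. coeff (coeff R j) i * x ^ i * y ^ j)"
    by (rule sum.reindex_bij_witness[of _ prod.swap prod.swap]) auto
  also have "\<dots> = (\<Sum>(i, j)\<in>S. coeff (coeff R j) i * x ^ i * y ^ j)"
    using assms by (intro sum.mono_neutral_left) auto
  finally show ?thesis .
qed

text \<open>Newton polygon step. Give \<open>x\<close> the weight \<open>degree p\<close> and \<open>y\<close> the weight 1, and let \<open>q\<close> record the part of \<open>R\<close> of
largest weight. The inverse Henon map turns the multiplicity of the root \<open>lead_coeff p / \<delta>\<close> of \<open>q\<close> into a
bound for the exponent of \<open>y\<close> in the top degree monomials, and this multiplicity is at most \<open>degree q - order 0 q\<close>.\<close>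

lemma top_mono_step:
  assumes top: "top_mono R i0 j0" and deg: "degree p \<ge> 2" and \<delta>: "\<delta> \<noteq> 0"
  shows "\<exists>R' i' j'. (\<forall>u v. poly2 R' (u, v) = poly2 R ((poly p u - v) / \<delta>, u)) \<and>
           top_mono R' i' j' \<and> degree p * j' \<le> j0"
proof -
  define D where "D = degree p"
  define c where "c = (\<lambda>i j. coeff (coeff R j) i)"
  define S where "S = {(i, j). c i j \<noteq> 0}"
  have finS: "finite S" unfolding S_def c_def by (rule finite_support2)
  have "R \<noteq> 0" using top by (auto simp: top_mono_def)
  then obtain iW jW where W: "c iW jW \<noteq> 0" "\<And>i j. c i j \<noteq> 0 \<Longrightarrow> D * i + j \<le> D * iW + jW"
    using max_mono_exists[of R D] unfolding c_def by blast
  define W where "W = D * iW + jW"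
  define P where "P = smult (1 / \<delta>) p"
  have degP: "degree P = D" using \<delta> by (simp add: P_def D_def)
  define \<gamma> where "\<gamma> = lead_coeff P"
  have "P \<noteq> 0" using degP deg D_def by auto
  then have \<gamma>: "\<gamma> \<noteq> 0" by (simp add: \<gamma>_def)
  \<comment> \<open>\<open>A\<close> is the first coordinate \<open>(p(u) - v) / \<delta>\<close> of
    the inverse map, a polynomial in \<open>v\<close> over the polynomials in \<open>u\<close>. The
    old \<open>y\<close> becomes \<open>u\<close>, whence the constant term
    \<open>monom (c i j) j\<close> below.\<close>
  define A where "A = [:P, [:-1 / \<delta>:]:]"
  define R' where "R' = (\<Sum>(i, j)\<in>S. [:monom (c i j) j:] * A ^ i)"
  have poly_R': "poly2 R' (u, v) = poly2 R ((poly p u - v) / \<delta>, u)" for u v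
  proof -
    have "poly2 R' (u, v) = (\<Sum>(i, j)\<in>S. c i j * u ^ j * (poly P u - v / \<delta>) ^ i)"
      by (simp add: R'_def poly2_def poly_sum case_prod_unfold A_def poly_monom)
    also have "\<dots> = poly2 R ((poly p u - v) / \<delta>, u)"
      using finS by (subst poly2_sum_monoms[of S])
        (auto simp: S_def c_def P_def diff_divide_distrib case_prod_unfold intro!: sum.cong)
    finally show ?thesis .
  qed
  have coeff_A: "coeff (A ^ i) l = smult (of_nat (i choose l) * (-1 / \<delta>) ^ l) (P ^ (i - l))" for i l
  proof (cases "l \<le> i")
    case True
    then show ?thesis
      by (simp add: A_def coeff_linear_poly_power of_nat_poly poly_const_pow mult.commute)
  next
    case False
    have "degree (A ^ i) \<le> i" using degree_power_le[of A i] \<delta> by (simp add: A_def)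
    then show ?thesis using False by (simp add: binomial_eq_0 coeff_eq_0)
  qed
  have coeff_R': "coeff (coeff R' l) m = (\<Sum>(i, j)\<in>S. c i j * (of_nat (i choose l) * (-1 / \<delta>) ^ l) *
      (if j \<le> m then coeff (P ^ (i - l)) (m - j) else 0))" for l m
    by (auto simp: R'_def coeff_sum case_prod_unfold coeff_A coeff_monom_mult intro!: sum.cong)
  \<comment> \<open>With weight 1 for \<open>u\<close> and \<open>D\<close> for \<open>v\<close> the
    substituted \<open>x\<close> has weight at most \<open>D\<close>, so the largest weight
    \<open>W\<close> is not exceeded.\<close>
  have supp_R': "m + D * l \<le> W" if "coeff (coeff R' l) m \<noteq> 0" for l m
  proof -
    note nz = that[unfolded coeff_R']
    obtain z where z: "z \<in> S" and z0: "(case z of (i, j) \<Rightarrow> c i j * (of_nat (i choose l) * (-1 / \<delta>) ^ l) *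
      (if j \<le> m then coeff (P ^ (i - l)) (m - j) else 0)) \<noteq> 0"
      using nz by (rule sum.not_neutral_contains_not_neutral)
    obtain i j where "z = (i, j)" by (cases z)
    then have ij: "(i, j) \<in> S" "j \<le> m" "coeff (P ^ (i - l)) (m - j) \<noteq> 0" "i choose l \<noteq> 0"
      using z z0 by (auto split: if_splits)
    have "m - j \<le> degree (P ^ (i - l))" using ij(3) by (rule le_degree)
    also have "\<dots> = D * (i - l)" using degP \<gamma> by (subst degree_power_eq) (auto simp: \<gamma>_def)
    finally have 1: "m - j \<le> D * (i - l)" .
    have "l \<le> i" using ij(4) by (meson binomial_eq_0 not_less)
    then have "D * l \<le> D * i" by simp
    then have "m + D * l \<le> D * i + j" using 1 ij(2) unfolding diff_mult_distrib2 by linarith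
    also have "\<dots> \<le> W" using W ij(1) by (auto simp: W_def S_def)
    finally show ?thesis .
  qed
  define q where "q = (\<Sum>i\<le>W. monom (if D * i \<le> W then c i (W - D * i) else 0) i)"
  have coeff_q: "coeff q i = (if D * i \<le> W then c i (W - D * i) else 0)" for i
  proof -
    have "i \<le> W" if "D * i \<le> W" using that deg by (cases D) (auto simp: D_def)
    then show ?thesis unfolding q_def by (auto simp: coeff_sum)
  qed
  have "coeff q iW \<noteq> 0" using W(1) by (simp add: coeff_q W_def)
  then have q: "q \<noteq> 0" by auto
  \<comment> \<open>Up to smaller weight, substitution turns the heaviest part into
    \<open>u ^ W\<close> times \<open>q\<close> evaluated at
    \<open>\<gamma> - v / (\<delta> * u ^ D)\<close>. The order of \<open>q\<close> at
    \<open>\<gamma>\<close> is thus the least power of \<open>v\<close> there.\<close>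
  define l where "l = order \<gamma> q"
  define a where "a = order 0 q"
  have al: "l + a \<le> degree q" unfolding l_def a_def by (rule order_le_order_0[OF q \<gamma>])
  have ca: "coeff q a \<noteq> 0"
  proof -
    have "(\<Sum>i\<le>degree q. coeff q i * of_nat (i choose a) * 0 ^ (i - a)) =
        (\<Sum>i\<le>degree q. if i = a then coeff q a else 0)"
      by (intro sum.cong) (auto simp: power_0_left binomial_eq_0)
    then show ?thesis using taylor_coeff_order[OF q, of 0] by (auto simp: a_def split: if_splits)
  qed
  have "lead_coeff q \<noteq> 0" using q by simp
  then have i1: "D * degree q \<le> W" by (auto simp: coeff_q split: if_splits)
  have i0: "D * a \<le> W" "c a (W - D * a) \<noteq> 0" using ca by (auto simp: coeff_q split: if_splits)
  have Dl: "D * l \<le> W - D * a"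
    using mult_le_mono2[OF al, of D] i1 by (simp add: distrib_left)
  \<comment> \<open>The monomial of the heaviest part with least exponent \<open>a\<close> of
    \<open>x\<close> has total degree at most \<open>i0 + j0\<close>, while \<open>(i0, j0)\<close>
    has weight at most \<open>W\<close>. This forces \<open>i0 \<le> a\<close>, and then
    \<open>j0\<close> is at least the exponent \<open>W - D * a\<close> of \<open>y\<close>, which
    exceeds or equals \<open>D * l\<close>.\<close>
  have "D * l \<le> j0"
  proof -
    have t: "a + (W - D * a) \<le> i0 + j0" using top i0(2) by (simp add: top_mono_def c_def)
    have "D * i0 + j0 \<le> W" using top W(2) by (simp add: top_mono_def c_def W_def)
    then have "(D - 1) * i0 \<le> (D - 1) * a"
      using t i0(1) by (simp add: diff_mult_distrib)
    then have "i0 \<le> a" using deg by (simp add: D_def)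
    then show ?thesis using t Dl by linarith
  qed
  \<comment> \<open>Only monomials of weight exactly \<open>W\<close> contribute, each through the
    leading coefficient of a power of \<open>P\<close>; their sum is the Taylor coefficient of
    \<open>q\<close> at its order.\<close>
  have nz: "coeff (coeff R' l) (W - D * l) \<noteq> 0"
  proof -
    have "coeff (coeff R' l) (W - D * l) =
      (\<Sum>(i, j)\<in>S. if D * i + j = W then c i j * (of_nat (i choose l) * (-1 / \<delta>) ^ l) * \<gamma> ^ (i - l) else 0)"
      unfolding coeff_R'
    proof (intro sum.cong refl, safe)
      fix i j assume "(i, j) \<in> S"
      then have le: "D * i + j \<le> W" using W by (auto simp: W_def S_def)
      show "c i j * (of_nat (i choose l) * (-1 / \<delta>) ^ l) *
          (if j \<le> W - D * l then coeff (P ^ (i - l)) (W - D * l - j) else 0) =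
          (if D * i + j = W then c i j * (of_nat (i choose l) * (-1 / \<delta>) ^ l) * \<gamma> ^ (i - l) else 0)"
      proof (cases "l \<le> i")
        case True
        have dP: "degree (P ^ (i - l)) = D * (i - l)"
          using degP \<gamma> by (subst degree_power_eq) (auto simp: \<gamma>_def)
        have ll: "D * l \<le> D * i" using True by simp
        show ?thesis
        proof (cases "D * i + j = W")
          case eq: True
          then have e: "W - D * l - j = degree (P ^ (i - l))"
            using ll unfolding dP diff_mult_distrib2 by linarith
          have "j \<le> W - D * l" using eq ll by linarith
          moreover have "coeff (P ^ (i - l)) (W - D * l - j) = \<gamma> ^ (i - l)"
            unfolding e \<gamma>_def by (simp add: lead_coeff_power)
          ultimately show ?thesis using eq by simp
        next
          case False
          then have "degree (P ^ (i - l)) < W - D * l - j"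
            using le ll unfolding dP diff_mult_distrib2 by linarith
          then show ?thesis using False by (simp add: coeff_eq_0)
        qed
      qed (simp add: binomial_eq_0)
    qed
    also have "\<dots> = (\<Sum>(i, j)\<in>{(i, j)\<in>S. D * i + j = W}. c i j * (of_nat (i choose l) * (-1 / \<delta>) ^ l) * \<gamma> ^ (i - l))"
      using finS by (intro sum.mono_neutral_cong_right) (auto split: if_splits)
    also have "\<dots> = (\<Sum>i\<in>{i. coeff q i \<noteq> 0}. coeff q i * (of_nat (i choose l) * (-1 / \<delta>) ^ l) * \<gamma> ^ (i - l))"
      by (rule sum.reindex_bij_witness[of _ "\<lambda>i. (i, W - D * i)" fst])
        (auto simp: coeff_q S_def split: if_splits)
    also have "\<dots> = (\<Sum>i\<le>degree q. coeff q i * (of_nat (i choose l) * (-1 / \<delta>) ^ l) * \<gamma> ^ (i - l))"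
      by (intro sum.mono_neutral_left) (auto intro: le_degree)
    also have "\<dots> = (-1 / \<delta>) ^ l * (\<Sum>i\<le>degree q. coeff q i * of_nat (i choose l) * \<gamma> ^ (i - l))"
      by (simp add: sum_distrib_left mult_ac)
    also have "\<dots> \<noteq> 0" using taylor_coeff_order[OF q, of \<gamma>] \<delta> by (simp add: l_def)
    finally show ?thesis .
  qed
  then have "R' \<noteq> 0" by auto
  then obtain i' j' where t': "top_mono R' i' j'" using top_mono_exists by blast
  \<comment> \<open>The monomial just found has total degree \<open>W - D * l + l\<close>. A
    monomial of weight at most \<open>W\<close> and total degree at least this cannot have a larger
    power of \<open>v\<close>, since \<open>D\<close> exceeds 1.\<close>
  have "j' \<le> l"
  proof -
    have "W - D * l + l \<le> i' + j'" using t' nz by (simp add: top_mono_def)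
    moreover have "i' + D * j' \<le> W" using t' supp_R' by (simp add: top_mono_def)
    moreover have "D * l \<le> W" using Dl by simp
    ultimately have "(D - 1) * j' \<le> (D - 1) * l" by (simp add: diff_mult_distrib)
    then show ?thesis using deg by (simp add: D_def)
  qed
  then have "D * j' \<le> D * l" by simp
  then have "D * j' \<le> j0" using \<open>D * l \<le> j0\<close> by linarith
  then show ?thesis using poly_R' t' unfolding D_def by blast
qed

section \<open>Chain rule and Jacobian determinants\<close>

lemma Dx_Dy_unique:
  assumes "poly_fun f" "(f has_derivative (\<lambda>h. a * fst h + b * snd h)) (at z)"
  shows "Dx f z = a" "Dy f z = b"
proof -
  have eq: "(\<lambda>h. Dx f z * fst h + Dy f z * snd h) = (\<lambda>h. a * fst h + b * snd h)"
    using has_derivative_unique[OF poly_fun_has_derivative[OF assms(1)] assms(2)] .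
  from fun_cong[OF eq, of "(1, 0)"] fun_cong[OF eq, of "(0, 1)"]
  show "Dx f z = a" "Dy f z = b" by auto
qed

definition poly_map :: "(complex \<times> complex \<Rightarrow> complex \<times> complex) \<Rightarrow> bool" where
  "poly_map F \<longleftrightarrow> poly_fun (\<lambda>z. fst (F z)) \<and> poly_fun (\<lambda>z. snd (F z))"

lemma poly_fun_compose: "poly_fun f \<Longrightarrow> poly_map F \<Longrightarrow> poly_fun (\<lambda>z. f (F z))"
  using poly_fun_comp2[of f "\<lambda>z. fst (F z)" "\<lambda>z. snd (F z)"] by (simp add: poly_map_def)

lemma poly_map_compose: "poly_map G \<Longrightarrow> poly_map F \<Longrightarrow> poly_map (\<lambda>z. G (F z))"
  using poly_fun_compose[of "\<lambda>z. fst (G z)" F] poly_fun_compose[of "\<lambda>z. snd (G z)" F]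
  by (simp add: poly_map_def)

lemma poly_map_id: "poly_map (\<lambda>z. z)"
  by (auto simp: poly_map_def)

lemma chain_Dx_Dy:
  assumes "poly_fun f" "poly_map F"
  shows "Dx (\<lambda>z. f (F z)) z = Dx f (F z) * Dx (\<lambda>z. fst (F z)) z + Dy f (F z) * Dx (\<lambda>z. snd (F z)) z"
    "Dy (\<lambda>z. f (F z)) z = Dx f (F z) * Dy (\<lambda>z. fst (F z)) z + Dy f (F z) * Dy (\<lambda>z. snd (F z)) z"
proof -
  have F: "(F has_derivative (\<lambda>h. (Dx (\<lambda>z. fst (F z)) z * fst h + Dy (\<lambda>z. fst (F z)) z * snd h,
      Dx (\<lambda>z. snd (F z)) z * fst h + Dy (\<lambda>z. snd (F z)) z * snd h))) (at z)"
    using has_derivative_Pair[OF poly_fun_has_derivative poly_fun_has_derivative,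
        of "\<lambda>z. fst (F z)" "\<lambda>z. snd (F z)" z] assms(2)
    by (simp add: poly_map_def)
  have "((\<lambda>z. f (F z)) has_derivative (\<lambda>h.
     (Dx f (F z) * Dx (\<lambda>z. fst (F z)) z + Dy f (F z) * Dx (\<lambda>z. snd (F z)) z) * fst h +
     (Dx f (F z) * Dy (\<lambda>z. fst (F z)) z + Dy f (F z) * Dy (\<lambda>z. snd (F z)) z) * snd h)) (at z)"
    using has_derivative_compose[OF F poly_fun_has_derivative[OF assms(1)]]
    by (simp add: algebra_simps)
  from Dx_Dy_unique[OF poly_fun_compose[OF assms] this]
  show "Dx (\<lambda>z. f (F z)) z = Dx f (F z) * Dx (\<lambda>z. fst (F z)) z + Dy f (F z) * Dx (\<lambda>z. snd (F z)) z"
    "Dy (\<lambda>z. f (F z)) z = Dx f (F z) * Dy (\<lambda>z. fst (F z)) z + Dy f (F z) * Dy (\<lambda>z. snd (F z)) z"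
    by auto
qed

definition jac :: "(complex \<times> complex \<Rightarrow> complex \<times> complex) \<Rightarrow> complex \<times> complex \<Rightarrow> complex" where
  "jac F z = Dx (\<lambda>z. fst (F z)) z * Dy (\<lambda>z. snd (F z)) z - Dy (\<lambda>z. fst (F z)) z * Dx (\<lambda>z. snd (F z)) z"

lemma jac_compose:
  assumes "poly_map G" "poly_map F"
  shows "jac (\<lambda>z. G (F z)) z = jac G (F z) * jac F z"
  using assms chain_Dx_Dy[of "\<lambda>z. fst (G z)" F z] chain_Dx_Dy[of "\<lambda>z. snd (G z)" F z]
  unfolding jac_def poly_map_def by (simp add: algebra_simps)

lemma jac_id: "jac (\<lambda>z. z) z = 1"
proof -
  have 1: "poly_fun fst" "poly_fun snd" using poly_fun_fst poly_fun_snd by auto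
  have d: "(fst has_derivative (\<lambda>h. 1 * fst h + 0 * snd h)) (at z)"
    "(snd has_derivative (\<lambda>h. 0 * fst h + 1 * snd h)) (at z)"
    by (auto intro!: derivative_eq_intros)
  show ?thesis using Dx_Dy_unique[OF 1(1) d(1)] Dx_Dy_unique[OF 1(2) d(2)] by (simp add: jac_def)
qed

lemma poly_fun_jac: "poly_map F \<Longrightarrow> poly_fun (jac F)"
  unfolding poly_map_def jac_def[abs_def] by (auto intro!: poly_fun_Dx poly_fun_Dy)

text \<open>The Jacobians of the map and of its inverse multiply to 1, so the former is a polynomial
  without zeros.\<close>

lemma jac_automorphism:
  assumes "poly_map F" "poly_map G" "\<And>z. G (F z) = z"
  shows "jac F z \<noteq> 0" "jac F z = jac F w"
proof -
  have nz: "jac F z \<noteq> 0" for z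
    using jac_compose[OF assms(2,1), of z] assms(3) jac_id[of z] by auto
  then show "jac F z \<noteq> 0" .
  show "jac F z = jac F w" by (rule poly_fun_nonvanishing_const[OF poly_fun_jac[OF assms(1)] nz])
qed

section \<open>Cauchy estimates on bidiscs\<close>

lemma univariate_holomorphic:
  assumes "poly_fun f"
  shows "(\<lambda>t. f (t, y)) holomorphic_on S" "(\<lambda>t. f (x, t)) holomorphic_on S"
  unfolding holomorphic_on_def field_differentiable_def
  using DERIV_subset[OF DERIV_fst[OF assms] subset_UNIV] DERIV_subset[OF DERIV_snd[OF assms] subset_UNIV]
  by blast+

lemma Cauchy_partial:
  assumes f: "poly_fun f" and "\<rho> > 0"
    and M: "\<And>u v. norm u \<le> \<rho> \<Longrightarrow> norm v \<le> \<rho> \<Longrightarrow> norm (f (u, v)) \<le> M"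
    and "norm u \<le> \<rho> / 2" "norm v \<le> \<rho> / 2"
  shows "norm (Dx f (u, v)) \<le> 2 * M / \<rho>" "norm (Dy f (u, v)) \<le> 2 * M / \<rho>"
proof -
  have le: "norm x \<le> \<rho>" if "norm (y - x) = \<rho> / 2" "norm y \<le> \<rho> / 2" for x y :: complex
    using that norm_triangle_ineq2[of x y] by (simp add: norm_minus_commute)
  have "norm ((deriv ^^ 1) (\<lambda>t. f (t, v)) u) \<le> fact 1 * M / (\<rho> / 2) ^ 1"
    using assms(2,4,5) le
    by (intro Cauchy_inequality univariate_holomorphic f M
        holomorphic_on_imp_continuous_on) auto
  then show "norm (Dx f (u, v)) \<le> 2 * M / \<rho>" by (simp add: Dx_def mult.commute)
  have "norm ((deriv ^^ 1) (\<lambda>t. f (u, t)) v) \<le> fact 1 * M / (\<rho> / 2) ^ 1"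
    using assms(2,4,5) le
    by (intro Cauchy_inequality univariate_holomorphic f M
        holomorphic_on_imp_continuous_on) auto
  then show "norm (Dy f (u, v)) \<le> 2 * M / \<rho>" by (simp add: Dy_def mult.commute)
qed

lemma bidisc_lipschitz:
  assumes f: "poly_fun f"
    and x: "\<And>u v. norm u \<le> r \<Longrightarrow> norm v \<le> r \<Longrightarrow> norm (Dx f (u, v)) \<le> M"
    and y: "\<And>u v. norm u \<le> r \<Longrightarrow> norm v \<le> r \<Longrightarrow> norm (Dy f (u, v)) \<le> M"
    and uv: "norm u \<le> r" "norm v \<le> r" "norm u' \<le> r" "norm v' \<le> r"
  shows "norm (f (u, v) - f (u', v')) \<le> M * (norm (u - u') + norm (v - v'))"
proof -
  have "norm (f (u, v) - f (u', v)) \<le> M * norm (u - u')"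
    using uv x by (intro field_differentiable_bound[of "cball 0 r" "\<lambda>t. f (t, v)" "\<lambda>t. Dx f (t, v)"]
        DERIV_subset[OF DERIV_fst[OF f]]) auto
  moreover have "norm (f (u', v) - f (u', v')) \<le> M * norm (v - v')"
    using uv y by (intro field_differentiable_bound[of "cball 0 r" "\<lambda>t. f (u', t)" "\<lambda>t. Dy f (u', t)"]
        DERIV_subset[OF DERIV_snd[OF f]]) auto
  moreover have "norm (f (u, v) - f (u', v')) \<le> norm (f (u, v) - f (u', v)) + norm (f (u', v) - f (u', v'))"
    using norm_triangle_ineq[of "f (u, v) - f (u', v)" "f (u', v) - f (u', v')"] by simp
  ultimately show ?thesis by (simp add: distrib_left)
qed

text \<open>Two Cauchy estimates, on bidiscs of radius \<rho> and half of it, bound the second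
  derivatives by 8 M over the square of \<rho>; integrating once and twice gives the bounds. With
  \<open>M\<close> proportional to \<open>T n\<close> and \<rho> likewise, the errors become of
  order \<open>r / T n\<close> and \<open>r ^ 2 / T n\<close>.\<close>

lemma
  assumes f: "poly_fun f" and \<rho>: "\<rho> > 0" and M: "\<And>u v. norm u \<le> \<rho> \<Longrightarrow> norm v \<le> \<rho> \<Longrightarrow> norm (f (u, v)) \<le> M"
    and uv: "norm u \<le> r" "norm v \<le> r" and r: "r \<le> \<rho> / 4"
  shows Dx_almost_const: "norm (Dx f (u, v) - Dx f (0, 0)) \<le> 16 * M * r / \<rho>\<^sup>2"
    and Dy_almost_const: "norm (Dy f (u, v) - Dy f (0, 0)) \<le> 16 * M * r / \<rho>\<^sup>2"
    and almost_affine: "norm (f (u, v) - (f (0, 0) + Dx f (0, 0) * u + Dy f (0, 0) * v)) \<le> 32 * M * r\<^sup>2 / \<rho>\<^sup>2"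
proof -
  note P = Cauchy_partial[OF f \<rho> M]
  have M0: "M \<ge> 0" using order_trans[OF norm_ge_zero M[of 0 0]] \<rho> by simp
  have r0: "r \<ge> 0" using uv(1) norm_ge_zero order_trans by blast
  have xx: "norm (Dx (Dx f) (u, v)) \<le> 8 * M / \<rho>\<^sup>2" "norm (Dy (Dx f) (u, v)) \<le> 8 * M / \<rho>\<^sup>2"
    if "norm u \<le> r" "norm v \<le> r" for u v
    using Cauchy_partial[OF poly_fun_Dx[OF f] _ P(1), of "\<rho> / 2" u v] \<rho> r that
    by (auto simp: power2_eq_square field_simps)
  have yy: "norm (Dx (Dy f) (u, v)) \<le> 8 * M / \<rho>\<^sup>2" "norm (Dy (Dy f) (u, v)) \<le> 8 * M / \<rho>\<^sup>2"
    if "norm u \<le> r" "norm v \<le> r" for u v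
    using Cauchy_partial[OF poly_fun_Dy[OF f] _ P(2), of "\<rho> / 2" u v] \<rho> r that
    by (auto simp: power2_eq_square field_simps)
  have fin: "8 * M / \<rho>\<^sup>2 * (norm (u - 0) + norm (v - 0)) \<le> 16 * M * r / \<rho>\<^sup>2"
    if "norm u \<le> r" "norm v \<le> r" for u v :: complex
  proof -
    have "8 * M / \<rho>\<^sup>2 * (norm (u - 0) + norm (v - 0)) \<le> 8 * M / \<rho>\<^sup>2 * (r + r)"
      using that M0 by (intro mult_left_mono add_mono) auto
    then show ?thesis by simp
  qed
  have X: "norm (Dx f (u, v) - Dx f (0, 0)) \<le> 16 * M * r / \<rho>\<^sup>2" if "norm u \<le> r" "norm v \<le> r" for u v
    by (rule order_trans[OF bidisc_lipschitz[OF poly_fun_Dx[OF f] xx] fin]) (use that r0 in auto)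
  have Y: "norm (Dy f (u, v) - Dy f (0, 0)) \<le> 16 * M * r / \<rho>\<^sup>2" if "norm u \<le> r" "norm v \<le> r" for u v
    by (rule order_trans[OF bidisc_lipschitz[OF poly_fun_Dy[OF f] yy] fin]) (use that r0 in auto)
  show "norm (Dx f (u, v) - Dx f (0, 0)) \<le> 16 * M * r / \<rho>\<^sup>2"
    "norm (Dy f (u, v) - Dy f (0, 0)) \<le> 16 * M * r / \<rho>\<^sup>2"
    using X Y uv by auto
  have 1: "norm ((f (u, v) - Dx f (0, 0) * u) - (f (0, v) - Dx f (0, 0) * 0)) \<le> 16 * M * r / \<rho>\<^sup>2 * norm (u - 0)"
    by (rule field_differentiable_bound[of "cball 0 r" "\<lambda>t. f (t, v) - Dx f (0, 0) * t" "\<lambda>t. Dx f (t, v) - Dx f (0, 0)"])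
      (use uv r0 X in \<open>auto intro!: derivative_eq_intros DERIV_subset[OF DERIV_fst[OF f]]\<close>)
  have 2: "norm ((f (0, v) - Dy f (0, 0) * v) - (f (0, 0) - Dy f (0, 0) * 0)) \<le> 16 * M * r / \<rho>\<^sup>2 * norm (v - 0)"
    by (rule field_differentiable_bound[of "cball 0 r" "\<lambda>t. f (0, t) - Dy f (0, 0) * t" "\<lambda>t. Dy f (0, t) - Dy f (0, 0)"])
      (use uv r0 Y in \<open>auto intro!: derivative_eq_intros DERIV_subset[OF DERIV_snd[OF f]]\<close>)
  have "16 * M * r / \<rho>\<^sup>2 * norm w \<le> 16 * M * r / \<rho>\<^sup>2 * r" if "norm w \<le> r" for w :: complex
    using that M0 r0 by (intro mult_left_mono) auto
  then have 3: "16 * M * r / \<rho>\<^sup>2 * norm w \<le> 16 * M * r\<^sup>2 / \<rho>\<^sup>2" if "norm w \<le> r" for w :: complex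
    using that by (simp add: power2_eq_square mult_ac)
  have eq: "f (u, v) - (f (0, 0) + Dx f (0, 0) * u + Dy f (0, 0) * v) =
     ((f (u, v) - Dx f (0, 0) * u) - (f (0, v) - Dx f (0, 0) * 0)) +
     ((f (0, v) - Dy f (0, 0) * v) - (f (0, 0) - Dy f (0, 0) * 0))" by simp
  have "norm (f (u, v) - (f (0, 0) + Dx f (0, 0) * u + Dy f (0, 0) * v)) \<le>
     16 * M * r / \<rho>\<^sup>2 * norm (u - 0) + 16 * M * r / \<rho>\<^sup>2 * norm (v - 0)"
    unfolding eq by (rule norm_triangle_mono[OF 1 2])
  also have "\<dots> \<le> 16 * M * r\<^sup>2 / \<rho>\<^sup>2 + 16 * M * r\<^sup>2 / \<rho>\<^sup>2"
    using 3[OF uv(1)] 3[OF uv(2)] by simp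
  finally show "norm (f (u, v) - (f (0, 0) + Dx f (0, 0) * u + Dy f (0, 0) * v)) \<le> 32 * M * r\<^sup>2 / \<rho>\<^sup>2"
    by simp
qed

text \<open>The hypothesis on \<open>v\<close> holds on the forward images of the level set. There the monomial \<open>x ^ m\<close> dominates.\<close>

lemma top_mono_growth:
  assumes top: "top_mono R m 0" and \<kappa>: "\<kappa> \<ge> 1"
  shows "\<exists>C\<ge>1. \<forall>u v. norm v \<le> \<kappa> * sqrt (max 1 (norm u)) \<longrightarrow>
     max 1 (norm (poly2 R (u, v))) \<le> C * max 1 (norm u) ^ m \<and>
     max 1 (norm u) ^ m \<le> C * max 1 (norm (poly2 R (u, v)))"
proof -
  define co where "co = (\<lambda>i j. coeff (coeff R j) i)"
  define S where "S = {(i, j). co i j \<noteq> 0}"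
  have fin: "finite S" unfolding S_def co_def by (rule finite_support2)
  define a where "a = co m 0"
  have a: "a \<noteq> 0" using top by (simp add: a_def co_def top_mono_def)
  have mS: "(m, 0) \<in> S" using a by (simp add: S_def a_def)
  have Sle: "i + j \<le> m" if "(i, j) \<in> S" for i j
    using top that by (auto simp: S_def co_def top_mono_def)
  define C1 where "C1 = (\<Sum>(i, j)\<in>S. norm (co i j) * \<kappa> ^ j)"
  have C1: "C1 \<ge> 0" unfolding C1_def using \<kappa> by (intro sum_nonneg) auto
  \<comment> \<open>Beyond this value of \<open>t\<close>, the square root of the size of
    \<open>u\<close>, the remaining monomials take at most half of the leading one.\<close>
  define t0 where "t0 = max 1 (2 * C1 / norm a)"
  define C where "C = (1 + C1) + (2 / norm a + t0 ^ (2 * m))"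
  have "C \<ge> 1" using C1 by (simp add: C_def t0_def)
  moreover have "max 1 (norm (poly2 R (u, v))) \<le> C * max 1 (norm u) ^ m \<and>
     max 1 (norm u) ^ m \<le> C * max 1 (norm (poly2 R (u, v)))"
    if v: "norm v \<le> \<kappa> * sqrt (max 1 (norm u))" for u v
  proof -
    define M where "M = max 1 (norm u)"
    define t where "t = sqrt M"
    have M: "M \<ge> 1" "norm u \<le> M" by (auto simp: M_def)
    have t: "t \<ge> 1" "M = t ^ 2" using M by (auto simp: t_def)
    have Mm: "M ^ k = t ^ (2 * k)" for k by (simp add: t(2) power_mult)
    have f: "poly2 R (u, v) = (\<Sum>(i, j)\<in>S. co i j * u ^ i * v ^ j)"
      unfolding co_def by (rule poly2_sum_monoms[OF fin]) (simp add: S_def co_def)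
    have tm: "norm (co i j * u ^ i * v ^ j) \<le> norm (co i j) * \<kappa> ^ j * t ^ (2 * i + j)" for i j
    proof -
      have "norm (u ^ i) \<le> t ^ (2 * i)" unfolding norm_power Mm[symmetric] using M by (intro power_mono) auto
      moreover have "norm (v ^ j) \<le> (\<kappa> * t) ^ j"
        unfolding norm_power using v by (intro power_mono) (auto simp: t_def M_def)
      ultimately have "norm (co i j) * norm (u ^ i) * norm (v ^ j) \<le> norm (co i j) * t ^ (2 * i) * (\<kappa> * t) ^ j"
        using t \<kappa> by (intro mult_mono) auto
      then show ?thesis by (simp add: norm_mult power_add power_mult_distrib mult_ac)
    qed
    have "norm (poly2 R (u, v)) \<le> (\<Sum>(i, j)\<in>S. norm (co i j) * \<kappa> ^ j * t ^ (2 * m))"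
      unfolding f
    proof (rule sum_norm_le, clarify)
      fix i j assume ij: "(i, j) \<in> S"
      have "norm (co i j) * \<kappa> ^ j * t ^ (2 * i + j) \<le> norm (co i j) * \<kappa> ^ j * t ^ (2 * m)"
        using t \<kappa> Sle[OF ij] by (intro mult_left_mono power_increasing) auto
      then show "norm (co i j * u ^ i * v ^ j) \<le> norm (co i j) * \<kappa> ^ j * t ^ (2 * m)"
        using tm[of i j] by linarith
    qed
    then have up: "norm (poly2 R (u, v)) \<le> C1 * M ^ m"
      unfolding C1_def Mm by (simp add: sum_distrib_right case_prod_unfold)
    have Mm1: "M ^ m \<ge> 1" using M by simp
    have C_ge: "C1 + 1 \<le> C" "2 / norm a \<le> C" "t0 ^ (2 * m) \<le> C"
      using C1 by (auto simp: C_def t0_def)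
    have "max 1 (norm (poly2 R (u, v))) \<le> (C1 + 1) * M ^ m"
      using up Mm1 mult_nonneg_nonneg[OF C1, of "M ^ m"] by (auto simp: algebra_simps)
    also have "\<dots> \<le> C * M ^ m" using C_ge(1) Mm1 by (intro mult_right_mono) auto
    finally have 1: "max 1 (norm (poly2 R (u, v))) \<le> C * M ^ m" .
    have 2: "M ^ m \<le> C * max 1 (norm (poly2 R (u, v)))"
    proof (cases "t \<le> t0")
      case True
      have "M ^ m \<le> t0 ^ (2 * m)" unfolding Mm using True t by (intro power_mono) auto
      also have "\<dots> \<le> C * 1" using C_ge by simp
      also have "\<dots> \<le> C * max 1 (norm (poly2 R (u, v)))" using \<open>C \<ge> 1\<close> by (intro mult_left_mono) auto
      finally show ?thesis .
    next
      case False
      have u: "norm u = M"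
      proof (rule ccontr)
        assume "norm u \<noteq> M"
        then have "M = 1" by (auto simp: M_def max_def split: if_splits)
        then show False using False by (simp add: t_def t0_def)
      qed
      have split: "poly2 R (u, v) = a * u ^ m + (\<Sum>(i, j)\<in>S - {(m, 0)}. co i j * u ^ i * v ^ j)"
        unfolding f by (subst sum.remove[OF fin mS]) (simp add: a_def)
      have "norm (\<Sum>(i, j)\<in>S - {(m, 0)}. co i j * u ^ i * v ^ j) \<le>
          (\<Sum>(i, j)\<in>S - {(m, 0)}. norm (co i j) * \<kappa> ^ j * (M ^ m / t))"
      proof (rule sum_norm_le)
        fix x assume x: "x \<in> S - {(m, 0)}"
        obtain i j where xij: "x = (i, j)" by (cases x)
        have ij: "(i, j) \<in> S" "(i, j) \<noteq> (m, 0)" using x xij by auto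
        \<comment> \<open>In the weight 2 for \<open>u\<close> and 1 for \<open>v\<close> all other
          monomials fall short by at least one unit, even those of the same total degree. This is
          where the factor \<open>1 / t\<close> comes from.\<close>
        have "2 * i + j + 1 \<le> 2 * m" using Sle[OF ij(1)] ij(2) by auto
        then have "t ^ (2 * i + j + 1) \<le> M ^ m" unfolding Mm using t by (intro power_increasing) auto
        then have "t ^ (2 * i + j) \<le> M ^ m / t" using t by (simp add: field_simps)
        then have "norm (co i j) * \<kappa> ^ j * t ^ (2 * i + j) \<le> norm (co i j) * \<kappa> ^ j * (M ^ m / t)"
          using \<kappa> by (intro mult_left_mono) auto
        then show "norm (case x of (i, j) \<Rightarrow> co i j * u ^ i * v ^ j) \<le>
            (case x of (i, j) \<Rightarrow> norm (co i j) * \<kappa> ^ j * (M ^ m / t))"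
          using tm[of i j] by (simp add: xij)
      qed
      also have "\<dots> \<le> (\<Sum>(i, j)\<in>S. norm (co i j) * \<kappa> ^ j * (M ^ m / t))"
        using fin \<kappa> t Mm1 by (intro sum_mono2) auto
      also have "\<dots> = C1 * (M ^ m / t)"
        unfolding C1_def by (simp only: sum_distrib_right case_prod_unfold)
      also have "\<dots> \<le> norm a / 2 * M ^ m"
      proof -
        have "2 * C1 / norm a \<le> t" using False by (simp add: t0_def)
        then have "C1 / t \<le> norm a / 2" using t a by (simp add: field_simps)
        from mult_right_mono[OF this, of "M ^ m"] show ?thesis using Mm1 by simp
      qed
      finally have "norm (poly2 R (u, v)) \<ge> norm (a * u ^ m) - norm a / 2 * M ^ m"
        unfolding split using norm_triangle_ineq2[of "a * u ^ m" "- (\<Sum>(i, j)\<in>S - {(m, 0)}. co i j * u ^ i * v ^ j)"]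
        by simp
      also have "norm (a * u ^ m) = norm a * M ^ m" by (simp add: norm_mult norm_power u)
      finally have "norm a / 2 * M ^ m \<le> max 1 (norm (poly2 R (u, v)))" by simp
      then have "M ^ m \<le> 2 / norm a * max 1 (norm (poly2 R (u, v)))" using a by (simp add: field_simps)
      also have "\<dots> \<le> C * max 1 (norm (poly2 R (u, v)))" using C_ge by (intro mult_right_mono) auto
      finally show ?thesis .
    qed
    show ?thesis using 1 2 by (simp add: M_def)
  qed
  ultimately show ?thesis by blast
qed

lemma poly_map_funpow: "poly_map F \<Longrightarrow> poly_map (F ^^ i)"
proof (induction i)
  case 0 show ?case using poly_map_id by (simp add: id_def)
next
  case (Suc i) then show ?case using poly_map_compose[of F "F ^^ i"] by (simp add: o_def)
qed

lemma funpow_inverse: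
  fixes F G :: "'a \<Rightarrow> 'a"
  assumes "\<And>z. G (F z) = z"
  shows "(G ^^ i) ((F ^^ i) z) = z"
proof (induction i arbitrary: z)
  case (Suc i)
  have "(G ^^ Suc i) ((F ^^ Suc i) z) = (G ^^ i) (G (F ((F ^^ i) z)))" by (simp add: funpow_swap1)
  then show ?case using assms Suc by simp
qed simp

section \<open>Growth, properness and rigidity of polynomials in one variable\<close>

lemma poly_growth_le: "\<exists>C. \<forall>y. norm (poly q y :: complex) \<le> C * max 1 (norm y) ^ degree q"
proof (intro exI allI)
  fix y :: complex
  have "norm (poly q y) \<le> (\<Sum>i\<le>degree q. norm (coeff q i) * max 1 (norm y) ^ degree q)"
    unfolding poly_altdef
  proof (rule sum_norm_le)
    fix i assume i: "i \<in> {..degree q}"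
    have "norm y ^ i \<le> max 1 (norm y) ^ i" by (intro power_mono) auto
    also have "\<dots> \<le> max 1 (norm y) ^ degree q" using i by (intro power_increasing) auto
    finally show "norm (coeff q i * y ^ i) \<le> norm (coeff q i) * max 1 (norm y) ^ degree q"
      unfolding norm_mult norm_power by (intro mult_left_mono) auto
  qed
  then show "norm (poly q y) \<le> (\<Sum>i\<le>degree q. norm (coeff q i)) * max 1 (norm y) ^ degree q"
    by (simp add: sum_distrib_right)
qed

lemma poly_growth_ge:
  fixes q :: "complex poly"
  assumes "degree q > 0"
  shows "\<exists>C\<ge>1. \<forall>y. norm y \<ge> C \<longrightarrow> norm y ^ degree q / C \<le> norm (poly q y)"
proof -
  define l where "l = norm (lead_coeff q)"
  have l: "l > 0" using assms by (auto simp: l_def)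
  define s where "s = (\<Sum>i<degree q. norm (coeff q i))"
  have s: "s \<ge> 0" by (auto simp: s_def intro: sum_nonneg)
  \<comment> \<open>The second entry keeps the lower order terms below half of the leading one, the
    third makes \<open>1 / C\<close> at most the remaining half \<open>l / 2\<close>.\<close>
  define C where "C = Max {1, 2 * s / l, 2 / l}"
  have C: "C \<ge> 1" "C \<ge> 2 * s / l" "C \<ge> 2 / l" by (auto simp: C_def)
  have "norm y ^ degree q / C \<le> norm (poly q y)" if y: "norm y \<ge> C" for y
  proof -
    have y1: "norm y \<ge> 1" using y C by linarith
    have "poly q y = (\<Sum>i<degree q. coeff q i * y ^ i) + lead_coeff q * y ^ degree q"
      unfolding poly_altdef lessThan_Suc_atMost[symmetric] by simp
    then have 1: "norm (poly q y) \<ge> l * norm y ^ degree q - norm (\<Sum>i<degree q. coeff q i * y ^ i)"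
      using norm_triangle_ineq2[of "lead_coeff q * y ^ degree q" "- (\<Sum>i<degree q. coeff q i * y ^ i)"]
      by (simp add: l_def norm_mult norm_power add.commute)
    have "norm (\<Sum>i<degree q. coeff q i * y ^ i) \<le> (\<Sum>i<degree q. norm (coeff q i) * (norm y ^ degree q / norm y))"
    proof (rule sum_norm_le)
      fix i assume i: "i \<in> {..<degree q}"
      have "norm y ^ Suc i \<le> norm y ^ degree q" using i y1 by (intro power_increasing) auto
      then have "norm y ^ i \<le> norm y ^ degree q / norm y" using y1 by (subst pos_le_divide_eq) (auto simp: mult.commute)
      then show "norm (coeff q i * y ^ i) \<le> norm (coeff q i) * (norm y ^ degree q / norm y)"
        unfolding norm_mult norm_power by (intro mult_left_mono) auto
    qed
    also have "\<dots> = s / norm y * norm y ^ degree q" by (simp add: s_def sum_distrib_right sum_divide_distrib)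
    also have "\<dots> \<le> l / 2 * norm y ^ degree q"
    proof (rule mult_right_mono)
      have "2 * s / l \<le> norm y" using C y by linarith
      then have "s \<le> l / 2 * norm y" using l by (simp add: field_simps)
      moreover have "norm y > 0" using y1 by linarith
      ultimately show "s / norm y \<le> l / 2" by (simp only: pos_divide_le_eq)
    qed simp
    finally have "norm (poly q y) \<ge> l / 2 * norm y ^ degree q" using 1 by (simp add: algebra_simps)
    moreover have "1 / C * norm y ^ degree q \<le> l / 2 * norm y ^ degree q"
    proof (rule mult_right_mono)
      show "1 / C \<le> l / 2" using C l by (simp add: field_simps)
    qed simp
    ultimately have "1 / C * norm y ^ degree q \<le> norm (poly q y)" by linarith
    then show ?thesis by simp
  qed
  then show ?thesis using C by blast
qed

lemma poly_proper:
  fixes q :: "complex poly"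
  assumes "degree q > 0"
  shows "\<exists>r. \<forall>y. norm (poly q y) \<le> C \<longrightarrow> norm y \<le> r"
proof -
  obtain a s where q: "q = pCons a s" by (cases q)
  then have "s \<noteq> 0" using assms by auto
  from poly_infinity[OF this, of "C + 1" a] obtain r where "\<And>z. r \<le> norm z \<Longrightarrow> C + 1 \<le> norm (poly q z)"
    using q by blast
  then show ?thesis by (intro exI[of _ r]) (smt (verit))
qed

lemma poly_lipschitz:
  fixes q :: "complex poly"
  shows "\<exists>C\<ge>0. \<forall>y z. norm y \<le> r \<longrightarrow> norm z \<le> r \<longrightarrow> norm (poly q y - poly q z) \<le> C * norm (y - z)"
proof -
  have "compact (poly (pderiv q) ` cball 0 r)"
    by (intro compact_continuous_image continuous_intros) auto
  then obtain C where C: "\<And>y. norm y \<le> r \<Longrightarrow> norm (poly (pderiv q) y) \<le> C"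
    using compact_imp_bounded bounded_iff by (metis imageI mem_cball_0)
  have "norm (poly q y - poly q z) \<le> C * norm (y - z)" if "norm y \<le> r" "norm z \<le> r" for y z
    using that C by (intro field_differentiable_bound[of "cball 0 r" _ "poly (pderiv q)"]
      DERIV_subset[OF poly_DERIV]) auto
  then have "norm (poly q y - poly q z) \<le> max C 0 * norm (y - z)" if "norm y \<le> r" "norm z \<le> r" for y z
    using that by (meson max.cobounded1 mult_right_mono norm_ge_zero order_trans)
  then show ?thesis by (intro exI[of _ "max C 0"]) auto
qed

text \<open>Induction on the degree: the Cauchy estimate carries the hypothesis over to \<open>pderiv q\<close>.\<close>

lemma shift_determined:
  fixes q :: "complex poly"
  assumes "degree q > 0" "r > 0" "\<kappa> > 0"
  shows "\<exists>C\<ge>0. \<forall>x y t M. \<kappa> \<le> norm t \<longrightarrow> (\<forall>v. norm v \<le> r \<longrightarrow> norm (poly q (x + t * v) - poly q (y + t * v)) \<le> M)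
     \<longrightarrow> norm (x - y) \<le> C * M"
  using assms
proof (induction "degree q" arbitrary: q r rule: less_induct)
  case less
  show ?case
  proof (cases "degree q = 1")
    case True
    define a b where "a = coeff q 0" and "b = coeff q 1"
    have b: "b \<noteq> 0" using True leading_coeff_0_iff[of q] by (auto simp: b_def)
    have q: "q = [:a, b:]"
      by (rule poly_eqI) (auto simp: coeff_pCons a_def b_def True coeff_eq_0 split: nat.splits)
    have "norm (x - y) \<le> 1 / norm b * M"
      if "\<forall>v. norm v \<le> r \<longrightarrow> norm (poly q (x + t * v) - poly q (y + t * v)) \<le> M" for x y t M
    proof -
      have "norm (b * (x - y)) \<le> M" using that[rule_format, of 0] less.prems(2) by (simp add: q mult.commute right_diff_distrib)
      then show ?thesis using b unfolding norm_mult by (simp add: field_simps)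
    qed
    then show ?thesis by (intro exI[of _ "1 / norm b"]) auto
  next
    case False
    have dq: "degree (pderiv q) = degree q - 1" by (rule degree_pderiv)
    obtain C where C: "C \<ge> 0" "\<And>x y t M. \<lbrakk>\<kappa> \<le> norm t; \<And>v. norm v \<le> r / 2 \<Longrightarrow>
        norm (poly (pderiv q) (x + t * v) - poly (pderiv q) (y + t * v)) \<le> M\<rbrakk> \<Longrightarrow> norm (x - y) \<le> C * M"
      using less.hyps[of "pderiv q" "r / 2"] less.prems False dq by auto
    have "norm (x - y) \<le> C * (2 / (r * \<kappa>)) * M" if t: "\<kappa> \<le> norm t"
      and M: "\<And>v. norm v \<le> r \<Longrightarrow> norm (poly q (x + t * v) - poly q (y + t * v)) \<le> M" for x y t M
    proof -
      define h where "h v = poly q (x + t * v) - poly q (y + t * v)" for v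
      have h': "(h has_field_derivative (poly (pderiv q) (x + t * v) - poly (pderiv q) (y + t * v)) * t) (at v)" for v
        unfolding h_def by (rule derivative_eq_intros DERIV_chain2[OF poly_DERIV] refl | simp add: algebra_simps)+
      have "norm (poly (pderiv q) (x + t * v) - poly (pderiv q) (y + t * v)) \<le> 2 / (r * \<kappa>) * M"
        if v: "norm v \<le> r / 2" for v
      proof -
        have le: "norm s \<le> r" if "norm (v - s) = r / 2" for s
          using that v norm_triangle_ineq2[of s v] by (simp add: norm_minus_commute)
        have hol: "h holomorphic_on S" for S
          using h' by (auto simp: holomorphic_on_def field_differentiable_def intro: DERIV_subset)
        have "norm ((deriv ^^ 1) h v) \<le> fact 1 * M / (r / 2) ^ 1"
          using less.prems(2) le M
          by (intro Cauchy_inequality hol holomorphic_on_imp_continuous_on) (auto simp: h_def)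
        then have "norm ((poly (pderiv q) (x + t * v) - poly (pderiv q) (y + t * v)) * t) \<le> 2 * M / r"
          using DERIV_imp_deriv[OF h'] by (simp add: mult.commute[of M])
        moreover have "norm (poly (pderiv q) (x + t * v) - poly (pderiv q) (y + t * v)) * \<kappa> \<le>
            norm (poly (pderiv q) (x + t * v) - poly (pderiv q) (y + t * v)) * norm t"
          using t by (intro mult_left_mono) auto
        ultimately have "norm (poly (pderiv q) (x + t * v) - poly (pderiv q) (y + t * v)) * \<kappa> \<le> 2 * M / r"
          unfolding norm_mult by linarith
        then show ?thesis using less.prems(2,3) by (simp add: field_simps)
      qed
      from C(2)[OF t this] show ?thesis by (simp add: mult.assoc)
    qed
    then show ?thesis using C(1) less.prems by (intro exI[of _ "C * (2 / (r * \<kappa>))"]) auto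
  qed
qed

section \<open>Escape rates and the geometry of the level set\<close>

text \<open>One constant \<open>A\<close> serves all factors, so that every constant derived from it
  is independent of the time \<open>n\<close>.\<close>

locale henon_seq =
  fixes p :: "nat \<Rightarrow> complex poly" and \<delta> :: "nat \<Rightarrow> complex" and A :: real and c :: real
  assumes A: "A \<ge> 1"
    and deg: "degree (p n) \<ge> 2"
    and \<delta>_le: "norm (\<delta> n) \<le> A" "1 / A \<le> norm (\<delta> n)"
    and p_le: "norm (poly (p n) y) \<le> A * max 1 (norm y) ^ degree (p n)"
    and p_ge: "norm y \<ge> A \<Longrightarrow> norm (poly (p n) y) \<ge> norm y ^ degree (p n) / A"
    and c: "c > 0"
begin

text \<open>\<open>H n\<close> is the elementary Henon map with inverse \<open>Hi n\<close>, \<open>\<Psi> n\<close> is the inverse of \<open>\<Phi> n\<close>, and \<open>g\<close> (the limit of \<open>s\<close>)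
is the Green function. The set \<open>Vp\<close> is invariant, and orbits outside it do not grow.\<close>

definition d where "d n = degree (p n)"
definition D where "D n = (\<Prod>i<n. d i)"
definition H where "H n = (\<lambda>(x, y). (y, poly (p n) y - \<delta> n * x))"
definition Hi where "Hi n = (\<lambda>(u, v). ((poly (p n) u - v) / \<delta> n, u))"

primrec \<Phi> where "\<Phi> 0 z = z" | "\<Phi> (Suc n) z = H n (\<Phi> n z)"
primrec \<Psi> where "\<Psi> 0 z = z" | "\<Psi> (Suc n) z = \<Psi> n (Hi n z)"

text \<open>\<open>R\<close> is \<open>A * B\<close>: from this size of \<open>y\<close> on,
  \<open>A * norm y\<close> is at most \<open>norm y ^ d n / B\<close>. So half of the lower bound
  \<open>norm y ^ d n / A\<close> for the polynomial absorbs the term with \<open>x\<close>, and one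
  step loses at most the factor \<open>B\<close>.\<close>

definition R where "R = 2 * A\<^sup>2"
definition B where "B = 2 * A"
definition N where "N z = Max {norm (fst z), norm (snd z), R}" for z :: "complex \<times> complex"
definition Vp where "Vp = {z :: complex \<times> complex. norm (fst z) \<le> norm (snd z) \<and> R \<le> norm (snd z)}"
definition s where "s n z = ln (N (\<Phi> n z)) / D n"

lemma d2: "d n \<ge> 2" using deg by (simp add: d_def)
lemma \<delta>_nz: "\<delta> n \<noteq> 0" using \<delta>_le(2)[of n] A by (smt (verit) divide_pos_pos norm_zero)
lemma R2: "R \<ge> 2" and RA: "R \<ge> A" and R2A: "R \<ge> 2 * A"
proof -
  have "A * 1 \<le> A\<^sup>2" using A unfolding power2_eq_square by (intro mult_left_mono) auto
  then show "R \<ge> 2" "R \<ge> A" "R \<ge> 2 * A" unfolding R_def using A by auto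
qed
lemma B2: "B \<ge> 2" using A by (simp add: B_def)

lemma H_Hi [simp]: "H n (Hi n z) = z" and Hi_H [simp]: "Hi n (H n z) = z"
  using \<delta>_nz[of n] by (cases z; simp add: H_def Hi_def)+

lemma \<Phi>_\<Psi> [simp]: "\<Phi> n (\<Psi> n z) = z"
  by (induction n arbitrary: z) auto
lemma \<Psi>_\<Phi> [simp]: "\<Psi> n (\<Phi> n z) = z"
  by (induction n arbitrary: z) auto

lemma D0 [simp]: "D 0 = 1" and D_Suc: "D (Suc n) = D n * d n"
  by (auto simp: D_def)
lemma D_pos: "D n \<ge> 1"
  by (induction n) (use d2 in \<open>auto simp: D_Suc intro: order_trans[OF _ d2]\<close>)
lemma D_Suc_ge: "D (Suc n) \<ge> 2 * D n" using d2[of n] by (simp add: D_Suc mult.commute)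
lemma D_ge_exp: "2 ^ n \<le> D n"
proof (induction n)
  case (Suc n) then show ?case using D_Suc_ge[of n] by simp
qed simp
lemma D_le_Suc: "D n \<le> D (Suc n)" using D_Suc_ge[of n] by linarith
lemma D_mono: "m \<le> n \<Longrightarrow> D m \<le> D n"
  by (rule lift_Suc_mono_le[of D]) (rule D_le_Suc)

lemma N_eq: "N z = max (max (norm (fst z)) (norm (snd z))) R"
  by (simp add: N_def max.assoc)
lemma N_ge: "N z \<ge> R" "N z \<ge> norm (fst z)" "N z \<ge> norm (snd z)" by (auto simp: N_eq)
lemma N_ge1: "N z \<ge> 1" using N_ge(1)[of z] R2 by simp

lemma N_H_le: "N (H n z) \<le> B * N z ^ d n"
proof -
  obtain x y where z: "z = (x, y)" by (cases z)
  have pow: "N z \<le> N z ^ d n" using N_ge1 d2[of n] by (intro self_le_power) auto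
  have "norm (poly (p n) y) \<le> A * N z ^ d n"
  proof -
    have "max 1 (norm y) \<le> N z" using N_ge1 N_ge[of z] z by auto
    then have "max 1 (norm y) ^ degree (p n) \<le> N z ^ d n" unfolding d_def by (intro power_mono) auto
    then show ?thesis using p_le[of n y] A by (meson mult_left_mono order_trans zero_le_one)
  qed
  moreover have "norm (\<delta> n * x) \<le> A * N z ^ d n"
    unfolding norm_mult using \<delta>_le(1)[of n] N_ge(2)[of z] pow z A by (intro mult_mono) auto
  ultimately have 1: "norm (poly (p n) y - \<delta> n * x) \<le> B * N z ^ d n"
    unfolding B_def using norm_triangle_ineq4[of "poly (p n) y" "\<delta> n * x"] by linarith
  have 2: "N z \<le> B * N z ^ d n"
    using mult_mono[of 1 B "N z" "N z ^ d n"] pow B2 N_ge1[of z] by auto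
  show ?thesis using 1 2 N_ge[of z] unfolding N_eq[of "H n z"] by (simp add: H_def z)
qed

lemma Vp_H:
  assumes "z \<in> Vp"
  shows "H n z \<in> Vp" "N (H n z) \<ge> N z ^ d n / B" "N z = norm (snd z)"
proof -
  obtain x y where z: "z = (x, y)" by (cases z)
  have y: "norm x \<le> norm y" "R \<le> norm y" using assms by (auto simp: Vp_def z)
  show Nz: "N z = norm (snd z)" using y by (simp add: N_eq z)
  define Y where "Y = norm y"
  have Y: "Y \<ge> R" using y by (simp add: Y_def)
  have Y1: "Y \<ge> 1" using Y R2 by simp
  have YY: "Y * Y \<le> Y ^ d n"
    using power_increasing[OF d2[of n] Y1] by (simp add: power2_eq_square)
  have RY: "R * Y \<le> Y ^ d n" using mult_right_mono[OF Y, of Y] YY Y1 by linarith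
  have 1: "norm (poly (p n) y) \<ge> Y ^ d n / A" using p_ge[of y n] Y RA by (simp add: Y_def d_def)
  have 2: "norm (\<delta> n * x) \<le> A * Y"
    unfolding norm_mult Y_def using \<delta>_le(1)[of n] y A by (intro mult_mono) auto
  have 3: "A * Y \<le> Y ^ d n / B"
    using RY A by (simp add: B_def R_def field_simps power2_eq_square)
  have half: "Y ^ d n / A = Y ^ d n / B + Y ^ d n / B" by (simp add: B_def)
  have 4: "norm (poly (p n) y - \<delta> n * x) \<ge> Y ^ d n / B"
    using 1 2 3 half norm_triangle_ineq2[of "poly (p n) y" "\<delta> n * x"] by linarith
  have "1 * Y \<le> A * Y" using A Y1 by (intro mult_right_mono) auto
  then have 5: "norm (poly (p n) y - \<delta> n * x) \<ge> Y" using 3 4 by linarith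
  show "H n z \<in> Vp" using 5 Y by (auto simp: Vp_def H_def z Y_def)
  show "N (H n z) \<ge> N z ^ d n / B"
    using 4 Nz N_ge(3)[of "H n z"] by (simp add: H_def z Y_def)
qed

lemma Vp_\<Phi>: "m \<ge> n \<Longrightarrow> \<Phi> n z \<in> Vp \<Longrightarrow> \<Phi> m z \<in> Vp"
  by (induction m rule: nat_induct_at_least[of n]) (auto intro: Vp_H)

text \<open>As \<open>Vp\<close> is never left, all earlier points lie outside it too. One step
  keeps the old \<open>y\<close> as new first coordinate, and outside \<open>Vp\<close> the new
  second one is below it or below \<open>R\<close>, so \<open>N\<close> cannot increase.\<close>

lemma not_Vp_N: "\<Phi> n z \<notin> Vp \<Longrightarrow> N (\<Phi> n z) \<le> N z"
proof (induction n)
  case (Suc n)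
  then have n: "\<Phi> n z \<notin> Vp" using Vp_\<Phi>[of n "Suc n" z] by auto
  have "N (\<Phi> (Suc n) z) \<le> N (\<Phi> n z)"
    using Suc.prems n by (cases "\<Phi> n z") (auto simp: N_eq Vp_def H_def)
  then show ?case using Suc.IH n by linarith
qed simp

lemma s_nonneg: "s n z \<ge> 0" using N_ge1 by (simp add: s_def)

lemma s_Suc_le: "s (Suc n) z \<le> s n z + ln B / D (Suc n)"
proof -
  have "ln (N (\<Phi> (Suc n) z)) \<le> ln (B * N (\<Phi> n z) ^ d n)"
    using N_H_le[of n "\<Phi> n z"] N_ge1[of "\<Phi> (Suc n) z"] by (subst ln_le_cancel_iff) auto
  also have "\<dots> = ln B + d n * ln (N (\<Phi> n z))"
    using B2 N_ge1[of "\<Phi> n z"] by (subst ln_mult) (auto simp: ln_realpow)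
  finally have "s (Suc n) z \<le> (ln B + d n * ln (N (\<Phi> n z))) / D (Suc n)"
    unfolding s_def by (intro divide_right_mono) auto
  also have "\<dots> = s n z + ln B / D (Suc n)"
    using d2[of n] D_pos[of n] by (simp add: s_def D_Suc field_simps)
  finally show ?thesis .
qed

lemma s_Suc_ge: "\<Phi> n z \<in> Vp \<Longrightarrow> s (Suc n) z \<ge> s n z - ln B / D (Suc n)"
proof -
  assume V: "\<Phi> n z \<in> Vp"
  have "d n * ln (N (\<Phi> n z)) - ln B = ln (N (\<Phi> n z) ^ d n / B)"
    using B2 N_ge1[of "\<Phi> n z"] by (subst ln_div) (auto simp: ln_realpow)
  also have "\<dots> \<le> ln (N (\<Phi> (Suc n) z))"
    using Vp_H(2)[OF V, of n] N_ge1[of "\<Phi> (Suc n) z"] N_ge1[of "\<Phi> n z"] B2 by (subst ln_le_cancel_iff) auto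
  finally have "(d n * ln (N (\<Phi> n z)) - ln B) / D (Suc n) \<le> s (Suc n) z"
    unfolding s_def by (intro divide_right_mono) auto
  moreover have "(d n * ln (N (\<Phi> n z)) - ln B) / D (Suc n) = s n z - ln B / D (Suc n)"
    using d2[of n] D_pos[of n] by (simp add: s_def D_Suc field_simps)
  ultimately show ?thesis by simp
qed

lemma inv_D_Suc: "2 * (1 / D (Suc n)) \<le> 1 / D n"
proof -
  have "2 * real (D n) \<le> real (D (Suc n))" using D_Suc_ge[of n] by linarith
  then show ?thesis using D_pos[of n] D_pos[of "Suc n"] by (simp add: field_simps)
qed

lemma lnB: "ln B \<ge> 0" using B2 by simp

text \<open>Since \<open>D\<close> at least doubles, the error of one step is bounded by a
  difference of consecutive terms. The errors telescope, and all steps after time \<open>n\<close>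
  together cost at most \<open>ln B / D n\<close>.\<close>

lemma inv_D_step: "ln B / D (Suc n) \<le> ln B * (1 / D n - 1 / D (Suc n))"
  using mult_left_mono[OF inv_D_Suc[of n] lnB] by (simp add: algebra_simps)

lemma s_le: "m \<ge> n \<Longrightarrow> s m z \<le> s n z + ln B * (1 / D n - 1 / D m)"
proof (induction m rule: nat_induct_at_least[of n])
  case (Suc m)
  then show ?case using s_Suc_le[of m z] inv_D_step[of m] by (simp add: algebra_simps)
qed simp

lemma s_ge: "m \<ge> n \<Longrightarrow> \<Phi> n z \<in> Vp \<Longrightarrow> s m z \<ge> s n z - ln B * (1 / D n - 1 / D m)"
proof (induction m rule: nat_induct_at_least[of n])
  case (Suc m)
  then show ?case using s_Suc_ge[OF Vp_\<Phi>[of n m z]] inv_D_step[of m] by (simp add: algebra_simps)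
qed simp

lemma s_le': "m \<ge> n \<Longrightarrow> s m z \<le> s n z + ln B / D n"
  using s_le[of n m z] lnB D_pos[of m] by (simp add: algebra_simps) (smt (verit) divide_nonneg_nonneg of_nat_0_le_iff)

lemma s_ge': "m \<ge> n \<Longrightarrow> \<Phi> n z \<in> Vp \<Longrightarrow> s m z \<ge> s n z - ln B / D n"
  using s_ge[of n m z] lnB D_pos[of m] by (simp add: algebra_simps) (smt (verit) divide_nonneg_nonneg of_nat_0_le_iff)

text \<open>Inside \<open>Vp\<close> both one-sided estimates apply; outside it \<open>s n z\<close>
  is itself small by \<open>not_Vp_N\<close>, and \<open>s m z\<close> can exceed it only slightly.
  The bound is uniform where \<open>N\<close> is bounded, which yields both convergence and
  continuity of the limit.\<close>

lemma s_diff: "m \<ge> n \<Longrightarrow> \<bar>s m z - s n z\<bar> \<le> (ln B + ln (N z)) / D n"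
proof (cases "\<Phi> n z \<in> Vp")
  case True
  assume m: "m \<ge> n"
  have "ln B / D n \<le> (ln B + ln (N z)) / D n" using N_ge1[of z] by (intro divide_right_mono) auto
  then show ?thesis using s_le'[OF m, of z] s_ge'[OF m True] by linarith
next
  case False
  assume m: "m \<ge> n"
  have "s n z \<le> ln (N z) / D n"
    unfolding s_def using not_Vp_N[OF False] N_ge1[of "\<Phi> n z"] by (intro divide_right_mono) auto
  then show ?thesis using s_le'[OF m, of z] s_nonneg[of n z] s_nonneg[of m z] lnB
    by (simp add: add_divide_distrib) (smt (verit) divide_nonneg_nonneg of_nat_0_le_iff)
qed

lemma D_inverse_LIMSEQ: "(\<lambda>n. x / real (D n)) \<longlonglongrightarrow> 0"
proof (rule Lim_null_comparison)
  show "\<forall>\<^sub>F n in sequentially. norm (x / real (D n)) \<le> \<bar>x\<bar> * (1/2) ^ n"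
  proof (rule always_eventually, rule allI)
    fix n
    have "(2::real) ^ n \<le> D n" using D_ge_exp[of n] by (metis of_nat_le_iff of_nat_numeral of_nat_power)
    then have "\<bar>x\<bar> / real (D n) \<le> \<bar>x\<bar> / 2 ^ n" using D_pos[of n] by (intro divide_left_mono) auto
    then show "norm (x / real (D n)) \<le> \<bar>x\<bar> * (1/2) ^ n" by (simp add: power_divide)
  qed
  show "(\<lambda>n. \<bar>x\<bar> * (1/2) ^ n) \<longlonglongrightarrow> 0" by real_asymp
qed

definition g where "g z = lim (\<lambda>n. s n z)"

lemma s_Cauchy: "Cauchy (\<lambda>n. s n z)"
proof (rule metric_CauchyI)
  fix e :: real assume "e > 0"
  with D_inverse_LIMSEQ[of "ln B + ln (N z)"] have "\<forall>\<^sub>F n in sequentially. norm ((ln B + ln (N z)) / D n) < e"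
    unfolding tendsto_iff dist_norm by simp
  then obtain M where M: "\<And>n. n \<ge> M \<Longrightarrow> (ln B + ln (N z)) / D n < e"
    unfolding eventually_sequentially by (metis abs_ge_self order_le_less_trans real_norm_def)
  show "\<exists>M. \<forall>m\<ge>M. \<forall>n\<ge>M. dist (s m z) (s n z) < e"
  proof (intro exI allI impI)
    fix m n assume "m \<ge> M" "n \<ge> M"
    then show "dist (s m z) (s n z) < e"
      using s_diff[of n m z] s_diff[of m n z] M[of n] M[of m] unfolding dist_real_def
      by (cases "m \<ge> n") (auto simp: abs_minus_commute)
  qed
qed

lemma s_LIMSEQ: "(\<lambda>n. s n z) \<longlonglongrightarrow> g z"
  unfolding g_def using s_Cauchy Cauchy_convergent convergent_LIMSEQ_iff by blast

lemma g_le: "g z \<le> s n z + ln B / D n"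
  by (rule LIMSEQ_le_const2[OF s_LIMSEQ]) (use s_le' in blast)

lemma g_ge: "\<Phi> n z \<in> Vp \<Longrightarrow> g z \<ge> s n z - ln B / D n"
  by (rule LIMSEQ_le_const[OF s_LIMSEQ]) (use s_ge' in blast)

lemma g_diff: "\<bar>g z - s n z\<bar> \<le> (ln B + ln (N z)) / D n"
proof -
  have "(\<lambda>m. \<bar>s m z - s n z\<bar>) \<longlonglongrightarrow> \<bar>g z - s n z\<bar>" by (intro tendsto_intros s_LIMSEQ)
  then show ?thesis by (rule LIMSEQ_le_const2) (use s_diff in blast)
qed

lemma continuous_H: "continuous_on S (H n)"
  unfolding H_def case_prod_unfold by (intro continuous_intros)

lemma continuous_Hi: "continuous_on S (Hi n)"
  unfolding Hi_def case_prod_unfold using \<delta>_nz by (intro continuous_intros) auto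

lemma continuous_\<Phi>: "continuous_on S (\<Phi> n)"
proof (induction n)
  case (Suc n)
  then show ?case by (auto intro: continuous_on_compose2[OF continuous_H[of UNIV]])
qed (auto intro: continuous_intros)

lemma continuous_\<Psi>: "continuous_on S (\<Psi> n)"
proof (induction n arbitrary: S)
  case (Suc n)
  show ?case using continuous_on_compose2[OF Suc.IH[of UNIV] continuous_Hi[of S n]] by simp
qed (auto intro: continuous_intros)

lemma continuous_N: "continuous_on S N"
  unfolding N_eq[abs_def] by (intro continuous_intros)

lemma continuous_s: "continuous_on S (s n)"
proof -
  have "continuous_on S (\<lambda>z. ln (N (\<Phi> n z)) / D n)"
    using N_ge1 D_pos[of n]
    by (intro continuous_intros continuous_on_compose2[OF continuous_N[of UNIV]] continuous_\<Phi>)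
      (auto, smt (verit) N_ge1)
  then show ?thesis by (simp add: s_def[abs_def])
qed

lemma continuous_g: "continuous_on UNIV g"
proof -
  have "continuous (at z) g" for z
  proof -
    define M where "M = N z + 1"
    define S where "S = {w. N w < M}"
    have "open S" unfolding S_def
      using continuous_N by (intro open_Collect_less) (auto simp: M_def intro: continuous_intros)
    have "uniform_limit S s g sequentially"
    proof (rule uniform_limitI)
      fix e :: real assume "e > 0"
      with D_inverse_LIMSEQ[of "ln B + ln M"] have "\<forall>\<^sub>F n in sequentially. norm ((ln B + ln M) / D n) < e"
        unfolding tendsto_iff dist_norm by simp
      then show "\<forall>\<^sub>F n in sequentially. \<forall>w\<in>S. dist (s n w) (g w) < e"
      proof eventually_elim
        case (elim n)
        show ?case
        proof
          fix w assume w: "w \<in> S"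
          have "(ln B + ln (N w)) / D n \<le> (ln B + ln M) / D n"
            using w N_ge1[of w] by (intro divide_right_mono add_left_mono) (auto simp: S_def)
          then show "dist (s n w) (g w) < e" using g_diff[of w n] elim unfolding dist_real_def real_norm_def by linarith
        qed
      qed
    qed
    then have "continuous_on S g"
      by (intro uniform_limit_theorem[OF always_eventually]) (auto intro: continuous_s)
    moreover have "z \<in> S" by (simp add: S_def M_def)
    ultimately show ?thesis using \<open>open S\<close> continuous_on_eq_continuous_at by blast
  qed
  then show ?thesis by (simp add: continuous_on_eq_continuous_at)
qed

section \<open>Size of orbits on and below the level set\<close>

definition L where "L = {z. g z = c}"
definition T where "T n = exp (c * D n)"
definition cn where "cn z = max (norm (fst z)) (norm (snd z))" for z :: "complex \<times> complex"

lemma T_pos [simp]: "T n > 0" by (simp add: T_def)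
lemma T_nonneg [simp]: "T n \<ge> 0" by (simp add: T_def)
lemma T_ge1: "T n \<ge> 1" using c by (simp add: T_def)
lemma T_mono: "m \<le> n \<Longrightarrow> T m \<le> T n" using c D_mono by (simp add: T_def)
lemma T_Suc: "T (Suc n) = T n ^ d n"
  by (simp add: T_def D_Suc exp_of_nat_mult[symmetric] mult_ac)
lemma B_pos: "B > 0" using B2 by simp

text \<open>The margin \<open>B\<close> pays for the error \<open>ln B / D n\<close> of all later
  steps.\<close>

lemma g_le_of_N:
  assumes "N (\<Phi> n z) \<le> T n / B"
  shows "g z \<le> c"
proof -
  have "ln (N (\<Phi> n z)) \<le> ln (T n / B)" using assms N_ge1[of "\<Phi> n z"] B_pos by (subst ln_le_cancel_iff) auto
  also have "\<dots> = c * D n - ln B" using B_pos by (subst ln_div) (auto simp: T_def)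
  finally have "s n z \<le> (c * D n - ln B) / D n" unfolding s_def by (intro divide_right_mono) auto
  also have "\<dots> = c - ln B / D n" using D_pos[of n] by (simp add: field_simps)
  finally show ?thesis using g_le[of z n] by linarith
qed

lemma N_le_of_g:
  assumes "g z \<le> c" "\<Phi> n z \<in> Vp"
  shows "N (\<Phi> n z) \<le> B * T n"
proof -
  have "s n z \<le> c + ln B / D n" using g_ge[OF assms(2)] assms(1) by linarith
  then have "ln (N (\<Phi> n z)) \<le> c * D n + ln B" using D_pos[of n] by (simp add: s_def field_simps)
  also have "\<dots> = ln (B * T n)" using B_pos by (subst ln_mult) (auto simp: T_def)
  finally show ?thesis using N_ge1[of "\<Phi> n z"] B_pos by (subst (asm) ln_le_cancel_iff) auto
qed

definition K0 where "K0 = max B R"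
definition K1 where "K1 = 2 * A * (A + K0)"

lemma K0: "K0 \<ge> 2" "K0 \<ge> R" "K0 \<ge> B" using R2 B2 by (auto simp: K0_def)
lemma K1: "K1 \<ge> K0" "K1 \<ge> 1"
proof -
  have "1 * K0 \<le> 2 * A * (A + K0)" using A K0(1) by (intro mult_mono) auto
  then show "K1 \<ge> K0" "K1 \<ge> 1" using K0 by (auto simp: K1_def)
qed

text \<open>In \<open>Vp\<close> an orbit larger than \<open>B * T n\<close> would escape faster
  than the rate \<open>c\<close>; outside \<open>Vp\<close> the second coordinate is below the first
  or below \<open>R\<close>.\<close>

lemma snd_le:
  assumes "g z \<le> c"
  shows "norm (snd (\<Phi> n z)) \<le> max (norm (fst (\<Phi> n z))) (K0 * T n)"
proof (cases "\<Phi> n z \<in> Vp")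
  case True
  have "norm (snd (\<Phi> n z)) \<le> B * T n" using N_le_of_g[OF assms True] N_ge(3)[of "\<Phi> n z"] by linarith
  also have "\<dots> \<le> K0 * T n" using K0 T_pos[of n] by (intro mult_right_mono less_imp_le[OF T_pos]) auto
  finally show ?thesis by simp
next
  case False
  have "R * 1 \<le> K0 * T n" using K0 T_ge1[of n] by (intro mult_mono) auto
  then show ?thesis using False by (auto simp: Vp_def)
qed

declare \<Phi>.simps(2) [simp del]

lemma fst_\<Phi>_Suc [simp]: "fst (\<Phi> (Suc n) z) = snd (\<Phi> n z)"
  by (simp add: H_def case_prod_unfold \<Phi>.simps(2))
lemma snd_\<Phi>_Suc: "snd (\<Phi> (Suc n) z) = poly (p n) (snd (\<Phi> n z)) - \<delta> n * fst (\<Phi> n z)"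
  by (simp add: H_def case_prod_unfold \<Phi>.simps(2))

text \<open>The second coordinate \<open>v\<close> is the first coordinate one step later, so
  \<open>snd_le\<close> at that time bounds the next coordinate \<open>v'\<close> by
  \<open>v\<close> itself or the power of \<open>X\<close>. As \<open>v'\<close> differs from the
  polynomial value at \<open>v\<close> only by \<delta> times the present first coordinate,
  \<open>v\<close> is bounded by a root of degree \<open>d n\<close>.\<close>

lemma snd_le_root:
  assumes "g z \<le> c" "X \<ge> T n" "norm (fst (\<Phi> n z)) \<le> X ^ d n"
  shows "norm (snd (\<Phi> n z)) \<le> K1 * X"
proof -
  define v u v' where "v = snd (\<Phi> n z)" and "u = fst (\<Phi> n z)" and "v' = snd (\<Phi> (Suc n) z)"
  have X1: "X \<ge> 1" using assms(2) T_ge1[of n] by simp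
  have v': "v' = poly (p n) v - \<delta> n * u" unfolding v'_def v_def u_def by (rule snd_\<Phi>_Suc)
  have TX: "T (Suc n) \<le> X ^ d n" unfolding T_Suc using assms(2) by (intro power_mono) (auto intro: less_imp_le)
  have v'_le: "norm v' \<le> max (norm v) (K0 * X ^ d n)"
  proof -
    have "K0 * T (Suc n) \<le> K0 * X ^ d n" using TX K0 by (intro mult_left_mono) auto
    with snd_le[OF assms(1), of "Suc n"] show ?thesis unfolding v'_def v_def
      by (auto intro: order_trans[OF _ max.mono[OF order_refl]])
  qed
  show ?thesis
  proof (cases "norm v \<ge> R")
    case True
    have "0 \<le> K0 * X ^ d n" using K0 X1 by simp
    then have KX: "max (norm v) (K0 * X ^ d n) \<le> norm v + K0 * X ^ d n" by simp
    have Y: "norm v ^ d n / A \<le> norm (poly (p n) v)" using p_ge[of v n] True RA by (simp add: d_def)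
    have "norm (poly (p n) v) \<le> norm v' + norm (\<delta> n * u)"
      using v' norm_triangle_ineq[of v' "\<delta> n * u"] by simp
    also have "norm (\<delta> n * u) \<le> A * X ^ d n"
      unfolding norm_mult using \<delta>_le(1)[of n] assms(3) A by (intro mult_mono) (auto simp: u_def)
    finally have 1: "norm v ^ d n / A \<le> norm v + K0 * X ^ d n + A * X ^ d n"
      using Y v'_le KX by linarith
    have "R * norm v \<le> norm v * norm v" using True by (intro mult_right_mono) auto
    also have "\<dots> \<le> norm v ^ d n"
      using power_increasing[OF d2[of n], of "norm v"] True R2 by (simp add: power2_eq_square)
    finally have "2 * A * norm v \<le> norm v ^ d n" using R2A mult_right_mono[of "2 * A" R "norm v"] by simp
    then have "norm v \<le> norm v ^ d n / (2 * A)" using A by (simp add: field_simps)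
    moreover have "norm v ^ d n / A = norm v ^ d n / (2 * A) + norm v ^ d n / (2 * A)" by simp
    ultimately have "norm v ^ d n / (2 * A) \<le> (A + K0) * X ^ d n" using 1 by (simp add: algebra_simps)
    then have "norm v ^ d n \<le> K1 * X ^ d n" using A by (simp add: field_simps K1_def)
    also have "\<dots> \<le> K1 ^ d n * X ^ d n"
      using K1 d2[of n] X1 by (intro mult_right_mono self_le_power) auto
    finally have "norm v ^ d n \<le> (K1 * X) ^ d n" by (simp add: power_mult_distrib)
    then show ?thesis using d2[of n] K1 X1 unfolding v_def
      by (subst (asm) power_mono_iff) auto
  next
    case False
    have "R * 1 \<le> K1 * X" using K1 K0 X1 by (intro mult_mono) auto
    then show ?thesis using False by (simp add: v_def)
  qed
qed

text \<open>The degree of the composition of the factors from time \<open>j\<close> to time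
  \<open>n\<close>.\<close>

definition E where "E j n = (\<Prod>i\<in>{j..<n}. d i)"

lemma E_step: "j < n \<Longrightarrow> E j n = d j * E (Suc j) n"
  by (simp add: E_def prod.atLeast_Suc_lessThan)
lemma E_self [simp]: "E n n = 1" by (simp add: E_def)
lemma E_0: "E 0 n = D n" by (simp add: E_def D_def atLeast0LessThan)
lemma E_pos: "E j n \<ge> 1"
  unfolding E_def
proof (rule prod_ge_1)
  show "1 \<le> d i" for i using d2[of i] by simp
qed
lemma D_E: "j \<le> n \<Longrightarrow> D j * E j n = D n"
  unfolding D_def E_def atLeast0LessThan[symmetric] by (rule prod.atLeastLessThan_concat) auto

text \<open>One degree is taken off at each step by \<open>snd_le_root\<close>. The constant does
  not accumulate: as \<open>d j \<ge> 2\<close>, the square of \<open>K1\<close> is at most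
  \<open>K1 ^ d j\<close>, whose root is again a single \<open>K1\<close>. The hypothesis on
  \<open>T m\<close> covers all times before \<open>n\<close>.\<close>

lemma fst_le_root:
  assumes "g z \<le> c" "n = Suc m" "X \<ge> T m" "norm (fst z) \<le> K1\<^sup>2 * X ^ D n"
  shows "norm (fst (\<Phi> n z)) \<le> K1\<^sup>2 * X"
proof -
  have X1: "X \<ge> 1" using assms(3) T_ge1[of m] by simp
  have "norm (fst (\<Phi> j z)) \<le> K1\<^sup>2 * X ^ E j n" if "j \<le> n" for j
    using that
  proof (induction j)
    case 0 then show ?case using assms(4) by (simp add: E_0)
  next
    case (Suc j)
    have j: "norm (fst (\<Phi> j z)) \<le> K1\<^sup>2 * X ^ E j n" using Suc by simp
    have "K1\<^sup>2 * X ^ E j n \<le> K1 ^ d j * X ^ E j n"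
      using K1 d2 X1 by (intro mult_right_mono power_increasing) auto
    also have "\<dots> = (K1 * X ^ E (Suc j) n) ^ d j"
      using Suc.prems by (simp add: E_step power_mult_distrib power_mult[symmetric] mult.commute)
    finally have 1: "norm (fst (\<Phi> j z)) \<le> (K1 * X ^ E (Suc j) n) ^ d j" using j by linarith
    have "T j \<le> 1 * X" using T_mono[of j m] assms(2,3) Suc.prems by simp
    also have "\<dots> \<le> K1 * X ^ E (Suc j) n"
      using K1 X1 E_pos[of "Suc j" n] by (intro mult_mono self_le_power) auto
    finally have "norm (snd (\<Phi> j z)) \<le> K1 * (K1 * X ^ E (Suc j) n)"
      using 1 by (intro snd_le_root[OF assms(1)])
    then show ?case by (simp add: power2_eq_square mult.assoc)
  qed
  from this[of n] show ?thesis by simp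
qed

definition K3 where "K3 = 2 * A\<^sup>2"
lemma K3: "K3 \<ge> 1" using R2 by (simp add: K3_def R_def)

lemma norm_Hi_le:
  assumes "max 1 (cn w) \<le> Y"
  shows "max 1 (cn (Hi n w)) \<le> K3 * Y ^ d n"
proof -
  obtain u v where w: "w = (u, v)" by (cases w)
  have Y: "1 \<le> Y" "norm u \<le> Y" "norm v \<le> Y" using assms by (auto simp: cn_def w)
  have pow: "Y \<le> Y ^ d n" using Y d2[of n] by (intro self_le_power) auto
  have KY: "Y \<le> K3 * Y ^ d n" using mult_mono[of 1 K3 Y "Y ^ d n"] K3 Y pow by auto
  have 1: "norm (poly (p n) u) \<le> A * Y ^ d n"
  proof -
    have "max 1 (norm u) ^ degree (p n) \<le> Y ^ d n" unfolding d_def using Y by (intro power_mono) auto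
    then show ?thesis using p_le[of n u] A by (meson mult_left_mono order_trans zero_le_one)
  qed
  have "1 * Y \<le> A * Y ^ d n" using A Y pow by (intro mult_mono) auto
  then have "norm (poly (p n) u - v) \<le> 2 * A * Y ^ d n"
    using norm_triangle_ineq4[of "poly (p n) u" v] 1 Y by linarith
  then have "norm (poly (p n) u - v) / norm (\<delta> n) \<le> 2 * A * Y ^ d n / (1 / A)"
    using \<delta>_le(2)[of n] A Y by (intro frac_le) auto
  also have "\<dots> = K3 * Y ^ d n" by (simp add: K3_def power2_eq_square)
  finally show ?thesis using KY Y by (simp add: cn_def w Hi_def norm_divide)
qed

text \<open>Each step back multiplies by \<open>K3\<close> and raises to a degree at least 2, which
  absorbs the square of \<open>K3\<close>; so only one \<open>K3\<close> is left inside the power.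
  This is the converse of \<open>fst_le_root\<close>.\<close>

lemma norm_\<Psi>_le:
  assumes "max 1 (cn w) \<le> Y"
  shows "max 1 (cn (\<Psi> n w)) \<le> (K3 * Y) ^ D n"
  using assms
proof (induction n arbitrary: w Y)
  case 0
  have "1 * Y \<le> K3 * Y" using K3 0 by (intro mult_right_mono) auto
  then have "max 1 (cn w) \<le> K3 * Y" using 0 by linarith
  then show ?case by simp
next
  case (Suc n)
  have Y: "Y \<ge> 1" using Suc.prems by simp
  have "max 1 (cn (\<Psi> n (Hi n w))) \<le> (K3 * (K3 * Y ^ d n)) ^ D n"
    by (rule Suc.IH[OF norm_Hi_le[OF Suc.prems]])
  also have "\<dots> \<le> ((K3 * Y) ^ d n) ^ D n"
  proof (rule power_mono)
    have "K3 * (K3 * Y ^ d n) = K3 ^ 2 * Y ^ d n" by (simp add: power2_eq_square)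
    also have "\<dots> \<le> K3 ^ d n * Y ^ d n" using K3 d2 Y by (intro mult_right_mono power_increasing) auto
    finally show "K3 * (K3 * Y ^ d n) \<le> (K3 * Y) ^ d n" by (simp add: power_mult_distrib)
  qed (use K3 Y in auto)
  finally show ?case by (simp add: D_Suc power_mult[symmetric] mult.commute)
qed

section \<open>Growth exponents of polynomials on the level set\<close>

lemma poly_map_H: "poly_map (H n)"
  unfolding poly_map_def H_def case_prod_unfold fst_conv snd_conv
  by (intro conjI poly_fun_diff poly_fun_mult poly_fun_poly poly_fun_const poly_fun_fst poly_fun_snd)

lemma poly_map_Hi: "poly_map (Hi n)"
proof -
  have "poly_fun (\<lambda>z. (poly (p n) (fst z) - snd z) * (1 / \<delta> n))"
    by (intro poly_fun_diff poly_fun_mult poly_fun_poly poly_fun_const poly_fun_fst poly_fun_snd)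
  then show ?thesis
    unfolding poly_map_def Hi_def case_prod_unfold fst_conv snd_conv by (simp add: poly_fun_fst)
qed

lemma poly_map_\<Phi>: "poly_map (\<Phi> n)"
proof (induction n)
  case (Suc n) then show ?case
    using poly_map_compose[OF poly_map_H Suc] by (simp add: \<Phi>.simps(2)[abs_def])
qed (use poly_map_id in simp)

lemma poly_map_\<Psi>: "poly_map (\<Psi> n)"
proof (induction n)
  case (Suc n) then show ?case
    using poly_map_compose[OF Suc poly_map_Hi] by simp
qed (use poly_map_id in simp)

text \<open>Each factor divides the power of \<open>y\<close> in the top monomial by its degree,
  hence at least halves it.\<close>

lemma top_mono_\<Psi>:
  assumes "top_mono R0 i0 j0"
  shows "\<exists>R i j. (\<forall>w. poly2 R w = poly2 R0 (\<Psi> n w)) \<and> top_mono R i j \<and> 2 ^ n * j \<le> j0"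
proof (induction n)
  case 0 show ?case using assms by (intro exI[of _ R0] exI[of _ i0] exI[of _ j0]) simp
next
  case (Suc n)
  then obtain R i j where R: "\<And>w. poly2 R w = poly2 R0 (\<Psi> n w)" "top_mono R i j" "2 ^ n * j \<le> j0" by blast
  from top_mono_step[OF R(2) deg[of n] \<delta>_nz[of n]] obtain R' i' j' where
    R': "\<And>u v. poly2 R' (u, v) = poly2 R ((poly (p n) u - v) / \<delta> n, u)" "top_mono R' i' j'" "degree (p n) * j' \<le> j"
    by blast
  have "2 * j' \<le> j" using R'(3) mult_le_mono1[OF deg[of n], of j'] by linarith
  then have "2 ^ n * (2 * j') \<le> 2 ^ n * j" by simp
  moreover have "2 ^ Suc n * j' = 2 ^ n * (2 * j')" by simp
  ultimately have "2 ^ Suc n * j' \<le> j0" using R(3) by linarith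
  moreover have "poly2 R' w = poly2 R0 (\<Psi> (Suc n) w)" for w
    by (cases w) (simp add: R' R Hi_def)
  ultimately show ?case using R'(2) by blast
qed

text \<open>A natural number \<open>j\<close> with \<open>2 ^ n * j \<le> j0\<close> vanishes once
  \<open>n\<close> is at least \<open>j0\<close>, so a pure power of \<open>x\<close> ends up on
  top.\<close>

lemma poly_fun_dominated:
  assumes "poly_fun f" "f z \<noteq> 0"
  shows "\<exists>n0. \<forall>n\<ge>n0. \<exists>R m. (\<forall>w. poly2 R w = f (\<Psi> n w)) \<and> top_mono R m 0"
proof -
  obtain R0 where R0: "f = poly2 R0" using assms by (auto simp: poly_fun_def)
  then have "R0 \<noteq> 0" using assms(2) by auto
  then obtain i0 j0 where t: "top_mono R0 i0 j0" using top_mono_exists by blast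
  have "\<exists>R m. (\<forall>w. poly2 R w = f (\<Psi> n w)) \<and> top_mono R m 0" if "n \<ge> j0" for n
  proof -
    obtain R i j where R: "\<forall>w. poly2 R w = poly2 R0 (\<Psi> n w)" "top_mono R i j" "2 ^ n * j \<le> j0"
      using top_mono_\<Psi>[OF t] by blast
    have "j = 0"
    proof (rule ccontr)
      assume "j \<noteq> 0"
      then have "2 ^ n * 1 \<le> 2 ^ n * j" by (intro mult_le_mono2) auto
      then show False using R(3) that less_exp[of n] by linarith
    qed
    then show ?thesis using R R0 by auto
  qed
  then show ?thesis by blast
qed

text \<open>The choice \<open>X = T n * sqrt M\<close> is admissible in \<open>snd_le_root\<close>
  because all degrees are at least 2. The result is the hypothesis of
  \<open>top_mono_growth\<close>.\<close>

lemma snd_le_sqrt: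
  assumes "z \<in> L"
  shows "norm (snd (\<Phi> n z)) \<le> K1 * T n * sqrt (max 1 (norm (fst (\<Phi> n z))))"
proof -
  define M where "M = max 1 (norm (fst (\<Phi> n z)))"
  have s1: "sqrt M \<ge> 1" by (simp add: M_def)
  have X: "T n * 1 \<le> T n * sqrt M" using s1 by (intro mult_left_mono) (auto intro: less_imp_le)
  have X1: "1 * sqrt M \<le> T n * sqrt M" using s1 T_ge1[of n] by (intro mult_right_mono) auto
  have "norm (fst (\<Phi> n z)) \<le> (sqrt M) ^ 2" by (simp add: M_def)
  also have "\<dots> \<le> (T n * sqrt M) ^ 2" using X1 s1 by (intro power_mono) auto
  also have "\<dots> \<le> (T n * sqrt M) ^ d n" using X1 s1 d2[of n] by (intro power_increasing) linarith+
  finally have "norm (snd (\<Phi> n z)) \<le> K1 * (T n * sqrt M)"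
    using X assms by (intro snd_le_root) (auto simp: L_def)
  then show ?thesis by (simp add: M_def mult.assoc)
qed

lemma T_unbounded: "\<exists>n0. \<forall>n\<ge>n0. T n \<ge> X"
proof -
  have "T n \<ge> c * n" for n
  proof -
    have "real n \<le> real (D n)" using D_ge_exp[of n] less_exp[of n] by linarith
    then have "c * n \<le> c * D n" using c by simp
    also have "\<dots> \<le> T n" unfolding T_def using exp_ge_add_one_self[of "c * D n"] by linarith
    finally show ?thesis .
  qed
  moreover obtain n0 :: nat where "n0 \<ge> X / c" using real_arch_simple by blast
  ultimately have "T n \<ge> X" if "n \<ge> n0" for n
  proof -
    have "X \<le> c * n0" using \<open>n0 \<ge> X / c\<close> c by (simp add: field_simps)
    also have "\<dots> \<le> c * n" using that c by simp
    finally show ?thesis using \<open>T n \<ge> c * n\<close> by linarith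
  qed
  then show ?thesis by blast
qed

text \<open>On the vertical line over a point \<open>u\<close> of size \<open>T n / B\<close> the
  Green function passes the value \<open>c\<close>, so \<open>L\<close> is met by the intermediate
  value theorem. By \<open>fst_le_root\<close> such a point at time \<open>n\<close> cannot come
  from a point with small \<open>x\<close>.\<close>

lemma L_unbounded: "\<exists>z\<in>L. norm (fst z) > X"
proof -
  \<comment> \<open>With these bounds \<open>T n / B\<close> exceeds both \<open>R\<close> and the
    bound \<open>K1 ^ 2 * T m\<close> of \<open>fst_le_root\<close>, while \<open>T m\<close>
    exceeds \<open>X\<close>.\<close>
  define Q where "Q = Max {B * K1\<^sup>2 + 1, X, B * R, 1}"
  obtain m where m: "T m \<ge> Q" using T_unbounded by blast
  then have Tm: "T m \<ge> B * K1\<^sup>2 + 1" "T m \<ge> X" "T m \<ge> B * R" by (auto simp: Q_def)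
  define n where "n = Suc m"
  have Tn: "T n \<ge> T m * T m"
    using power_increasing[OF d2[of m] T_ge1[of m]] by (simp add: n_def T_Suc power2_eq_square)
  have TnB: "T n / B > K1\<^sup>2 * T m"
  proof -
    have "B * K1\<^sup>2 * T m < T m * T m" using Tm(1) by (intro mult_strict_right_mono) auto
    moreover have "K1\<^sup>2 * T m * B = B * K1\<^sup>2 * T m" by simp
    ultimately have "K1\<^sup>2 * T m * B < T n" using Tn by linarith
    then show ?thesis using B_pos by (simp add: less_divide_eq)
  qed
  have "T m * 1 \<le> T m * T m" using T_ge1[of m] by (intro mult_left_mono) auto
  then have "T n \<ge> B * R" using Tn Tm(3) by linarith
  then have TnR: "T n / B \<ge> R" using B_pos by (simp add: field_simps)
  define u where "u = complex_of_real (T n / B)"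
  have nu: "norm u = T n / B" using B_pos T_ge1[of n] by (simp add: u_def norm_divide)
  define G where "G t = g (\<Psi> n (u, complex_of_real t))" for t
  have cont: "continuous_on {0..b} G" for b
    unfolding G_def
    by (intro continuous_on_compose2[OF continuous_g] continuous_on_compose2[OF continuous_\<Psi>[of UNIV]] continuous_intros) auto
  have "G 0 \<le> c" unfolding G_def using nu TnR R2 by (intro g_le_of_N[of n]) (simp add: N_eq)
  \<comment> \<open>At this height the point lies in \<open>Vp\<close> and is larger than
    \<open>B * T n\<close>, too large for a rate below \<open>c\<close>.\<close>
  define V where "V = B * T n + T n / B + 1"
  have V: "V \<ge> T n / B" "V \<ge> R" "V > B * T n" "V \<ge> 0"
  proof -
    have "B * T n \<ge> 0" "T n / B \<ge> 0" using B_pos by auto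
    then show "V \<ge> T n / B" "V \<ge> R" "V > B * T n" "V \<ge> 0"
      using TnR by (simp_all only: V_def)
  qed
  have "G V \<ge> c"
  proof (rule ccontr)
    assume "\<not> c \<le> G V"
    then have "N (\<Phi> n (\<Psi> n (u, complex_of_real V))) \<le> B * T n"
      unfolding G_def using V nu by (intro N_le_of_g) (auto simp: Vp_def)
    then show False using V by (simp add: N_eq)
  qed
  then obtain t where t: "G t = c" using IVT'[of G 0 c V] \<open>G 0 \<le> c\<close> cont V by auto
  define z where "z = \<Psi> n (u, complex_of_real t)"
  have "z \<in> L" using t by (simp add: L_def z_def G_def)
  moreover have "norm (fst z) > X"
  proof (rule ccontr)
    assume "\<not> norm (fst z) > X"
    then have "norm (fst z) \<le> 1 * T m" using Tm by simp
    also have "\<dots> \<le> K1\<^sup>2 * T m ^ D n"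
      using K1 T_ge1[of m] D_pos[of n] by (intro mult_mono self_le_power) (auto simp: one_le_power)
    finally have "norm (fst (\<Phi> n z)) \<le> K1\<^sup>2 * T m"
      using \<open>z \<in> L\<close> by (intro fst_le_root) (auto simp: L_def n_def)
    then show False using TnB nu by (simp add: z_def)
  qed
  ultimately show ?thesis by blast
qed

definition mx :: "complex \<times> complex \<Rightarrow> real" where "mx z = max 1 (norm (fst z))"

lemma mx_ge1 [simp]: "mx z \<ge> 1" by (simp add: mx_def)

text \<open>At a late common time both \<open>f\<close> and \<open>x\<close> are comparable on
  \<open>L\<close> to powers \<open>m1\<close> and \<open>m2\<close> of the same quantity
  \<open>M\<close>, so the exponent is \<open>m1 / m2\<close>. Here \<open>m2\<close> is positive
  because \<open>x\<close> is unbounded on \<open>L\<close>.\<close>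

lemma L_growth:
  assumes "poly_fun f" "f z0 \<noteq> 0"
  shows "\<exists>lam C. lam \<ge> 0 \<and> C \<ge> 1 \<and> (\<forall>z\<in>L. max 1 (norm (f z)) \<le> C * mx z powr lam \<and>
     mx z powr lam \<le> C * max 1 (norm (f z)))"
proof -
  obtain n1 where n1: "\<And>n. n \<ge> n1 \<Longrightarrow> \<exists>R m. (\<forall>w. poly2 R w = f (\<Psi> n w)) \<and> top_mono R m 0"
    using poly_fun_dominated[OF assms] by blast
  have pf: "poly_fun fst" using poly_fun_fst by simp
  obtain n2 where n2: "\<And>n. n \<ge> n2 \<Longrightarrow> \<exists>R m. (\<forall>w. poly2 R w = fst (\<Psi> n w)) \<and> top_mono R m 0"
    using poly_fun_dominated[OF pf, of "(1, 0)"] by auto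
  define n where "n = max n1 n2"
  obtain R1 m1 where R1: "\<And>w. poly2 R1 w = f (\<Psi> n w)" "top_mono R1 m1 0" using n1[of n] by (auto simp: n_def)
  obtain R2 m2 where R2: "\<And>w. poly2 R2 w = fst (\<Psi> n w)" "top_mono R2 m2 0" using n2[of n] by (auto simp: n_def)
  have \<kappa>: "1 \<le> K1 * T n" using mult_mono[of 1 K1 1 "T n"] K1 T_ge1[of n] by auto
  obtain C1 where C1: "C1 \<ge> 1" "\<And>u v. norm v \<le> K1 * T n * sqrt (max 1 (norm u)) \<Longrightarrow>
      max 1 (norm (poly2 R1 (u, v))) \<le> C1 * max 1 (norm u) ^ m1 \<and>
      max 1 (norm u) ^ m1 \<le> C1 * max 1 (norm (poly2 R1 (u, v)))"
    using top_mono_growth[OF R1(2) \<kappa>] by blast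
  obtain C2 where C2: "C2 \<ge> 1" "\<And>u v. norm v \<le> K1 * T n * sqrt (max 1 (norm u)) \<Longrightarrow>
      max 1 (norm (poly2 R2 (u, v))) \<le> C2 * max 1 (norm u) ^ m2 \<and>
      max 1 (norm u) ^ m2 \<le> C2 * max 1 (norm (poly2 R2 (u, v)))"
    using top_mono_growth[OF R2(2) \<kappa>] by blast
  define M where "M z = max 1 (norm (fst (\<Phi> n z)))" for z
  have M1: "M z \<ge> 1" for z by (simp add: M_def)
  have b1: "max 1 (norm (f z)) \<le> C1 * M z ^ m1" "M z ^ m1 \<le> C1 * max 1 (norm (f z))" if "z \<in> L" for z
    using C1(2)[OF snd_le_sqrt[OF that]] by (auto simp: R1 M_def)
  have b2: "mx z \<le> C2 * M z ^ m2" "M z ^ m2 \<le> C2 * mx z" if "z \<in> L" for z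
    using C2(2)[OF snd_le_sqrt[OF that]] by (auto simp: R2 M_def mx_def)
  have m2: "m2 > 0"
  proof (rule ccontr)
    assume "\<not> m2 > 0"
    moreover obtain z where z: "z \<in> L" "norm (fst z) > C2" using L_unbounded by blast
    ultimately show False using b2(1)[OF z(1)] by (simp add: mx_def)
  qed
  define lam where "lam = real m1 / real m2"
  have lam: "lam \<ge> 0" by (simp add: lam_def)
  have Mp: "(M z ^ m2) powr lam = M z ^ m1" for z
    using m2 M1[of z] by (simp add: powr_realpow[symmetric] powr_powr lam_def)
  define C where "C = C1 * C2 powr lam"
  have C2p: "C2 powr lam \<ge> 1" using C2(1) lam by (simp add: ge_one_powr_ge_zero)
  have "C \<ge> 1" unfolding C_def using C1(1) C2p mult_mono[of 1 C1 1 "C2 powr lam"] by auto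
  moreover have "max 1 (norm (f z)) \<le> C * mx z powr lam \<and> mx z powr lam \<le> C * max 1 (norm (f z))"
    if z: "z \<in> L" for z
  proof
    have "M z ^ m1 \<le> (C2 * mx z) powr lam"
      unfolding Mp[symmetric] using b2(2)[OF z] M1[of z] lam by (intro powr_mono2) auto
    also have "\<dots> = C2 powr lam * mx z powr lam" by (rule powr_mult)
    finally have "C1 * M z ^ m1 \<le> C * mx z powr lam" unfolding C_def using C1(1) by simp
    then show "max 1 (norm (f z)) \<le> C * mx z powr lam" using b1(1)[OF z] by linarith
    have "mx z powr lam \<le> (C2 * M z ^ m2) powr lam"
      using b2(1)[OF z] lam mx_ge1[of z] by (intro powr_mono2) linarith+
    also have "\<dots> = C2 powr lam * M z ^ m1" using C2(1) M1[of z] by (simp add: powr_mult Mp)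
    also have "\<dots> \<le> C2 powr lam * (C1 * max 1 (norm (f z)))" using b1(2)[OF z] by (intro mult_left_mono) auto
    finally show "mx z powr lam \<le> C * max 1 (norm (f z))" by (simp add: C_def mult_ac)
  qed
  ultimately show ?thesis using lam by blast
qed

text \<open>The frontier of the slice of \<open>{g \<le> c}\<close> lies in \<open>L\<close>.\<close>

lemma L_slice_max_modulus:
  assumes f: "poly_fun f" and M: "\<And>v. \<Psi> n (u, v) \<in> L \<Longrightarrow> norm v \<le> K0 * T n \<Longrightarrow> norm (f (u, v)) \<le> M"
    and u: "norm u \<le> T n / B" and v: "norm v \<le> T n / B" and R: "R \<le> T n / B"
  shows "norm (f (u, v)) \<le> M"
proof -
  define S where "S = {t. g (\<Psi> n (u, t)) \<le> c}"
  have cont: "continuous_on UNIV (\<lambda>t. g (\<Psi> n (u, t)))"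
    by (intro continuous_on_compose2[OF continuous_g] continuous_on_compose2[OF continuous_\<Psi>[of UNIV]] continuous_intros) auto
  have uT: "norm u \<le> K0 * T n"
  proof -
    have "T n / B \<le> T n / 1" using B2 by (intro divide_left_mono) auto
    also have "\<dots> \<le> K0 * T n" using mult_right_mono[of 1 K0 "T n"] K0 by simp
    finally show ?thesis using u by linarith
  qed
  have S_le: "norm t \<le> K0 * T n" if "t \<in> S" for t
    using snd_le[of "\<Psi> n (u, t)" n] that uT by (simp add: S_def)
  have "closed S" unfolding S_def using cont by (intro closed_Collect_le) (auto intro: continuous_intros)
  show ?thesis
  proof (rule maximum_modulus_frontier[of "\<lambda>t. f (u, t)" S])
    show "(\<lambda>t. f (u, t)) holomorphic_on interior S" by (rule univariate_holomorphic[OF f])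
    show "continuous_on (closure S) (\<lambda>t. f (u, t))"
      by (rule holomorphic_on_imp_continuous_on[OF univariate_holomorphic(2)[OF f]])
    show "bounded S" using S_le unfolding bounded_iff by blast
    show "v \<in> S" unfolding S_def using u v R by (auto intro!: g_le_of_N[of n] simp: N_eq)
    fix t assume "t \<in> frontier S"
    then have t: "t \<in> S" "t \<notin> interior S" using \<open>closed S\<close> by (auto simp: frontier_def)
    have "g (\<Psi> n (u, t)) = c"
    proof (rule ccontr)
      assume "g (\<Psi> n (u, t)) \<noteq> c"
      then have "t \<in> {t. g (\<Psi> n (u, t)) < c}" using t by (auto simp: S_def)
      moreover have "open {t. g (\<Psi> n (u, t)) < c}" using cont by (intro open_Collect_less) auto
      moreover have "{t. g (\<Psi> n (u, t)) < c} \<subseteq> S" by (auto simp: S_def)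
      ultimately have "t \<in> interior S" by (meson interiorI)
      then show False using t by simp
    qed
    then show "norm (f (u, t)) \<le> M" using M S_le[OF t(1)] by (simp add: L_def)
  qed
qed

section \<open>Conjugates on bidiscs and the lower bound for growth exponents\<close>

lemma poly_map_conj: "poly_map F \<Longrightarrow> poly_map (\<lambda>w. \<Phi> m (F (\<Psi> n w)))"
  by (rule poly_map_compose[OF poly_map_\<Phi> poly_map_compose[OF _ poly_map_\<Psi>]])

definition K5 where "K5 = K3 * K0"
lemma K5: "K5 \<ge> 1" using mult_mono[of 1 K3 1 K0] K3 K0 by (simp add: K5_def)

text \<open>Points of \<open>L\<close> over the bidisc have \<open>x\<close> of size about
  \<open>T n ^ D n\<close>. The map raises this to the power \<mu>, and the condition on \<mu> says
  that the result is at most about \<open>T q ^ D q\<close> for \<open>q = Suc m\<close>; going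
  forward to time \<open>q\<close> then takes the root. The maximum principle extends the bound from
  \<open>L\<close> to the bidisc.\<close>

lemma conj_bound:
  assumes F: "poly_map F" "\<And>z. z \<in> L \<Longrightarrow> F z \<in> L" and C: "C \<ge> 1" and \<mu>: "\<mu> \<ge> 0"
    and gr: "\<And>z. z \<in> L \<Longrightarrow> mx (F z) \<le> C * mx z powr \<mu>"
  shows "\<exists>K\<ge>1. \<forall>n m. Suc m \<le> n \<longrightarrow> \<mu> * D n * D n \<le> D (Suc m) * D (Suc m) \<longrightarrow> T n \<ge> K \<longrightarrow>
    (\<forall>u v. norm u \<le> T n / K \<longrightarrow> norm v \<le> T n / K \<longrightarrow> cn (\<Phi> (Suc m) (F (\<Psi> n (u, v)))) \<le> K * T (Suc m))"
proof -
  \<comment> \<open>The first three factors bound the image of points of \<open>L\<close>. The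
    factor \<open>B * R\<close> ensures that the bidisc lies where \<open>g \<le> c\<close>, as
    \<open>L_slice_max_modulus\<close> requires.\<close>
  define K where "K = K1\<^sup>2 * C * K5 * (B * R)"
  have BR: "B * R \<ge> 1" "B * R \<ge> B" using mult_mono[of 1 B 1 R] mult_mono[of B B 1 R] B2 R2 by auto
  have KK: "K1\<^sup>2 * C * K5 \<ge> 1"
    using mult_mono[of 1 "K1\<^sup>2 * C" 1 K5] mult_mono[of 1 "K1\<^sup>2" 1 C] K1 C K5 by auto
  have K: "K \<ge> 1" "K \<ge> B * R" "K \<ge> K1\<^sup>2 * C * K5"
    unfolding K_def using mult_mono[of 1 "K1\<^sup>2 * C * K5" 1 "B * R"] mult_mono[of 1 "K1\<^sup>2 * C * K5" "B * R" "B * R"]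
      mult_mono[of "K1\<^sup>2 * C * K5" "K1\<^sup>2 * C * K5" 1 "B * R"] KK BR by auto
  have "cn (\<Phi> (Suc m) (F (\<Psi> n (u0, v0)))) \<le> K * T (Suc m)"
    if nm: "Suc m \<le> n" and \<mu>D: "\<mu> * D n * D n \<le> D (Suc m) * D (Suc m)" and Tn: "T n \<ge> K"
      and u0: "norm u0 \<le> T n / K" and v0: "norm v0 \<le> T n / K" for n m u0 v0
  proof -
    define q where "q = Suc m"
    have "B \<le> K" using K BR by linarith
    then have TK: "T n / K \<le> T n / B" using K(1) B_pos by (intro divide_left_mono) auto
    have RB: "R \<le> T n / B" using Tn K(2) B_pos by (simp add: field_simps)
    have key: "cn (\<Phi> q (F (\<Psi> n (u0, v)))) \<le> K * T q" if zL: "\<Psi> n (u0, v) \<in> L" and v: "norm v \<le> K0 * T n" for v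
    proof -
      define z where "z = \<Psi> n (u0, v)"
      have "norm u0 \<le> T n / 1" using u0 K(1) by (intro order_trans[OF u0] divide_left_mono) auto
      also have "\<dots> \<le> K0 * T n" using mult_right_mono[of 1 K0 "T n"] K0 by simp
      finally have "max 1 (cn (u0, v)) \<le> K0 * T n"
        using v mult_mono[of 1 K0 1 "T n"] K0 T_ge1[of n] by (simp add: cn_def)
      from norm_\<Psi>_le[OF this, of n] have mz: "mx z \<le> (K5 * T n) ^ D n"
        by (simp add: mx_def z_def cn_def K5_def mult_ac)
      have "mx z powr \<mu> \<le> ((K5 * T n) ^ D n) powr \<mu>"
        using mz \<mu> mx_ge1[of z] by (intro powr_mono2) linarith+
      also have "\<dots> = K5 powr (D n * \<mu>) * T n powr (D n * \<mu>)"
        using K5 T_pos[of n] by (simp add: powr_realpow[symmetric] powr_powr powr_mult)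
      also have "\<dots> \<le> K5 ^ D q * T q ^ D q"
      proof (rule mult_mono)
        have "D n * \<mu> \<le> D q"
        proof -
          have "real (D q) * D q \<le> D q * real (D n)" using D_mono[OF nm] by (intro mult_left_mono) (auto simp: q_def)
          then have "(D n * \<mu>) * D n \<le> D q * real (D n)" using \<mu>D by (simp add: q_def mult_ac)
          then show ?thesis using D_pos[of n] by (simp add: mult.commute)
        qed
        then have "K5 powr (D n * \<mu>) \<le> K5 powr (D q)" using K5 by (intro powr_mono) auto
        then show "K5 powr (D n * \<mu>) \<le> K5 ^ D q" using K5 by (simp add: powr_realpow)
        have "T n powr (D n * \<mu>) = exp (c * (\<mu> * D n * D n))" by (simp add: T_def powr_def mult_ac)
        also have "\<dots> \<le> exp (c * (D q * D q))" using \<mu>D c unfolding q_def by simp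
        also have "\<dots> = T q ^ D q" by (simp add: T_def exp_of_nat_mult[symmetric] mult_ac)
        finally show "T n powr (D n * \<mu>) \<le> T q ^ D q" .
      qed (use K5 in auto)
      \<comment> \<open>The constant is put under the power \<open>D q\<close>, so that the root
        taken afterwards returns it unchanged.\<close>
      finally have "C * mx z powr \<mu> \<le> C ^ D q * (K5 ^ D q * T q ^ D q)"
        using C D_pos[of q] K5 by (intro mult_mono self_le_power) auto
      also have "\<dots> = (C * K5 * T q) ^ D q" by (simp add: power_mult_distrib)
      also have "\<dots> \<le> K1\<^sup>2 * (C * K5 * T q) ^ D q"
        using mult_right_mono[of 1 "K1\<^sup>2" "(C * K5 * T q) ^ D q"] K1 C K5 by (simp add: one_le_power)
      finally have xb: "norm (fst (F z)) \<le> K1\<^sup>2 * (C * K5 * T q) ^ D q"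
        using gr[of z] zL by (simp add: z_def mx_def)
      have CK5: "C * K5 \<ge> 1" using mult_mono[of 1 C 1 K5] C K5 by auto
      have Y: "T q \<le> C * K5 * T q" using mult_right_mono[OF CK5, of "T q"] by simp
      have "T m \<le> T q" by (rule T_mono) (simp add: q_def)
      then have "T m \<le> C * K5 * T q" using Y by linarith
      moreover have Fz: "g (F z) \<le> c" using F(2)[of z] zL by (simp add: L_def z_def)
      ultimately have f: "norm (fst (\<Phi> q (F z))) \<le> K1\<^sup>2 * (C * K5 * T q)"
        using xb by (intro fst_le_root[of _ q m]) (auto simp: q_def)
      have "K0 \<le> K1\<^sup>2" using K1 self_le_power[of K1 2] by auto
      then have "K0 * T q \<le> K1\<^sup>2 * (C * K5 * T q)" using Y K0 by (intro mult_mono) auto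
      then have "max (norm (fst (\<Phi> q (F z)))) (K0 * T q) \<le> K1\<^sup>2 * (C * K5 * T q)" using f by linarith
      then have "norm (snd (\<Phi> q (F z))) \<le> K1\<^sup>2 * (C * K5 * T q)" using snd_le[OF Fz, of q] by linarith
      then have "cn (\<Phi> q (F z)) \<le> K1\<^sup>2 * (C * K5 * T q)" using f unfolding cn_def by linarith
      then have "cn (\<Phi> q (F z)) \<le> K1\<^sup>2 * C * K5 * T q" by (simp add: mult.assoc)
      also have "\<dots> \<le> K * T q" using K by (intro mult_right_mono) auto
      finally show ?thesis by (simp add: z_def)
    qed
    have pm: "poly_map (\<lambda>w. \<Phi> q (F (\<Psi> n w)))"
      by (rule poly_map_conj[OF F(1)])
    have pf: "poly_fun (\<lambda>w. fst (\<Phi> q (F (\<Psi> n w))))" "poly_fun (\<lambda>w. snd (\<Phi> q (F (\<Psi> n w))))"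
      using pm by (simp_all add: poly_map_def)
    have uv: "norm u0 \<le> T n / B" "norm v0 \<le> T n / B" using u0 v0 TK by linarith+
    have key': "norm (fst (\<Phi> q (F (\<Psi> n (u0, v))))) \<le> K * T q" "norm (snd (\<Phi> q (F (\<Psi> n (u0, v))))) \<le> K * T q"
      if "\<Psi> n (u0, v) \<in> L" "norm v \<le> K0 * T n" for v
      using key[OF that] by (simp_all add: cn_def)
    have "norm (fst (\<Phi> q (F (\<Psi> n (u0, v0))))) \<le> K * T q"
      by (rule L_slice_max_modulus[OF pf(1) key'(1) uv RB])
    moreover have "norm (snd (\<Phi> q (F (\<Psi> n (u0, v0))))) \<le> K * T q"
      by (rule L_slice_max_modulus[OF pf(2) key'(2) uv RB])
    ultimately show ?thesis by (simp add: cn_def q_def)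
  qed
  then show ?thesis using K(1) by blast
qed

lemma Dx_Dy_H: "Dx (\<lambda>z. fst (H n z)) z = 0" "Dy (\<lambda>z. fst (H n z)) z = 1"
  "Dx (\<lambda>z. snd (H n z)) z = - \<delta> n" "Dy (\<lambda>z. snd (H n z)) z = poly (pderiv (p n)) (snd z)"
proof -
  have pf: "poly_fun (\<lambda>z. fst (H n z))" "poly_fun (\<lambda>z. snd (H n z))"
    using poly_map_H by (auto simp: poly_map_def)
  have "((\<lambda>z. fst (H n z)) has_derivative (\<lambda>h. 0 * fst h + 1 * snd h)) (at z)"
    unfolding H_def case_prod_unfold fst_conv by (auto intro!: derivative_eq_intros)
  from Dx_Dy_unique[OF pf(1) this]
  show "Dx (\<lambda>z. fst (H n z)) z = 0" "Dy (\<lambda>z. fst (H n z)) z = 1" by auto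
  have "(poly (p n) has_derivative (\<lambda>h. poly (pderiv (p n)) (snd z) * h)) (at (snd z))"
    using poly_DERIV[of "p n" "snd z"] by (simp add: has_field_derivative_def)
  from has_derivative_compose[OF has_derivative_snd[OF has_derivative_ident] this]
  have d: "((\<lambda>z. poly (p n) (snd z)) has_derivative (\<lambda>h. poly (pderiv (p n)) (snd z) * snd h)) (at z)" by simp
  have "((\<lambda>z. snd (H n z)) has_derivative (\<lambda>h. - \<delta> n * fst h + poly (pderiv (p n)) (snd z) * snd h)) (at z)"
    unfolding H_def case_prod_unfold snd_conv by (rule derivative_eq_intros d refl)+ auto
  from Dx_Dy_unique[OF pf(2) this]
  show "Dx (\<lambda>z. snd (H n z)) z = - \<delta> n" "Dy (\<lambda>z. snd (H n z)) z = poly (pderiv (p n)) (snd z)" by auto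
qed

lemma jac_\<Phi>: "jac (\<Phi> n) z = (\<Prod>i<n. \<delta> i)"
proof (induction n)
  case 0 show ?case using jac_id by simp
next
  case (Suc n)
  have "jac (\<Phi> (Suc n)) z = jac (\<lambda>z. H n (\<Phi> n z)) z" by (simp add: \<Phi>.simps(2)[abs_def])
  also have "\<dots> = jac (H n) (\<Phi> n z) * jac (\<Phi> n) z" by (rule jac_compose[OF poly_map_H poly_map_\<Phi>])
  finally show ?case using Suc by (simp add: jac_def[of "H n"] Dx_Dy_H)
qed

lemma jac_\<Psi>: "jac (\<Psi> n) z = 1 / (\<Prod>i<n. \<delta> i)"
proof -
  have "jac (\<lambda>z. \<Phi> n (\<Psi> n z)) z = jac (\<Phi> n) (\<Psi> n z) * jac (\<Psi> n) z"
    by (rule jac_compose[OF poly_map_\<Phi> poly_map_\<Psi>])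
  then have "(\<Prod>i<n. \<delta> i) * jac (\<Psi> n) z = 1" by (simp add: jac_id jac_\<Phi>)
  then show ?thesis using nonzero_eq_divide_eq by (metis mult.commute mult_zero_left zero_neq_one)
qed

lemma jac_conj:
  assumes "poly_map F"
  shows "jac (\<lambda>w. \<Phi> m (F (\<Psi> n w))) w = (\<Prod>i<m. \<delta> i) * jac F (\<Psi> n w) / (\<Prod>i<n. \<delta> i)"
  using jac_compose[OF poly_map_\<Phi>[of m] poly_map_compose[OF assms poly_map_\<Psi>[of n]], of w]
    jac_compose[OF assms poly_map_\<Psi>[of n], of w]
  by (simp add: jac_\<Phi> jac_\<Psi>)

text \<open>The conjugate maps a bidisc of radius about \<open>T (q + 1)\<close>, which is at least \<open>(T q)\<^sup>2\<close>, into one of radius about \<open>T q\<close>.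
Its Jacobian at 0 is then at most of order \<open>1 / (T q)\<^sup>2\<close>, although it is bounded below.\<close>

lemma no_contraction:
  assumes F: "poly_map F" "poly_map G" "\<And>z. G (F z) = z" "\<And>z. z \<in> L \<Longrightarrow> F z \<in> L" and C: "C \<ge> 1" and \<mu>: "\<mu> \<ge> 0"
    and gr: "\<And>z. z \<in> L \<Longrightarrow> mx (F z) \<le> C * mx z powr \<mu>" and dm: "\<And>n. d n \<le> dm" "\<mu> * dm\<^sup>2 \<le> 1"
  shows False
proof -
  obtain K where K: "K \<ge> 1" "\<And>n m u v. \<lbrakk>Suc m \<le> n; \<mu> * D n * D n \<le> D (Suc m) * D (Suc m); T n \<ge> K;
     norm u \<le> T n / K; norm v \<le> T n / K\<rbrakk> \<Longrightarrow> cn (\<Phi> (Suc m) (F (\<Psi> n (u, v)))) \<le> K * T (Suc m)"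
    using conj_bound[OF F(1,4) C \<mu> gr] by blast
  define J where "J = norm (jac F (0, 0))"
  have J: "J > 0" "norm (jac F z) = J" for z
    using jac_automorphism[OF F(1,2,3)] unfolding J_def by (auto, metis)
  \<comment> \<open>The four first derivatives at 0 will be at most \<open>2 * K ^ 2 / T q\<close>,
    so the Jacobian is at most \<open>8 * K ^ 4 / T q\<close>; this has to fall below its lower
    bound \<open>J / A\<close>.\<close>
  obtain m where m: "T m \<ge> max K (8 * K ^ 4 * A / J + 1)" using T_unbounded by blast
  define q n where "q = Suc m" and "n = Suc q"
  have Tq: "T q \<ge> K" "T q > 8 * K ^ 4 * A / J" "T q \<ge> 1"
    using m T_mono[of m q] T_ge1[of q] by (auto simp: q_def)
  have Tn: "T n \<ge> T q * T q" "T n \<ge> T q"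
    using power_increasing[OF d2[of q] T_ge1[of q]] T_mono[of q n] by (auto simp: n_def T_Suc power2_eq_square)
  have "\<mu> * D n * D n \<le> D q * D q"
  proof -
    have "\<mu> * D n * D n = \<mu> * (real (d q))\<^sup>2 * (D q * D q)" by (simp add: n_def D_Suc power2_eq_square)
    also have "\<dots> \<le> \<mu> * (real dm)\<^sup>2 * (D q * D q)"
      using \<mu> dm(1)[of q] by (intro mult_right_mono mult_left_mono power_mono) auto
    also have "\<dots> \<le> 1 * real (D q * D q)" using dm(2) by (intro mult_right_mono) auto
    finally show ?thesis by simp
  qed
  then have bd: "cn (\<Phi> q (F (\<Psi> n (u, v)))) \<le> K * T q" if "norm u \<le> T n / K" "norm v \<le> T n / K" for u v
    using K(2)[of m n u v] that Tq Tn by (simp add: q_def n_def)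
  define E where "E = (\<lambda>w. \<Phi> q (F (\<Psi> n w)))"
  have pm: "poly_map E" unfolding E_def by (rule poly_map_conj[OF F(1)])
  define \<epsilon> where "\<epsilon> = 2 * (K * T q) / (T n / K)"
  have TK: "T n / K > 0" using K by simp
  have e1: "norm (Dx (\<lambda>z. fst (E z)) (0, 0)) \<le> \<epsilon>" "norm (Dy (\<lambda>z. fst (E z)) (0, 0)) \<le> \<epsilon>"
    unfolding \<epsilon>_def using pm bd TK by (intro Cauchy_partial[OF _ TK]; auto simp: poly_map_def cn_def E_def)+
  have e2: "norm (Dx (\<lambda>z. snd (E z)) (0, 0)) \<le> \<epsilon>" "norm (Dy (\<lambda>z. snd (E z)) (0, 0)) \<le> \<epsilon>"
    unfolding \<epsilon>_def using pm bd TK by (intro Cauchy_partial[OF _ TK]; auto simp: poly_map_def cn_def E_def)+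
  have e0: "\<epsilon> \<ge> 0" using e1(1) norm_ge_zero order_trans by blast
  have "norm (jac E (0, 0)) \<le> \<epsilon> * \<epsilon> + \<epsilon> * \<epsilon>"
    unfolding jac_def using e1 e2 e0
    by (intro order_trans[OF norm_triangle_ineq4] add_mono) (auto simp: norm_mult intro!: mult_mono)
  moreover have "norm (jac E (0, 0)) \<ge> J / A"
  proof -
    have "jac E (0, 0) = jac F (\<Psi> n (0, 0)) / \<delta> q"
      unfolding E_def jac_conj[OF F(1)] n_def using \<delta>_nz by simp
    then have "norm (jac E (0, 0)) = J / norm (\<delta> q)" by (simp add: norm_divide J)
    also have "\<dots> \<ge> J / A" using \<delta>_le(1)[of q] J(1) \<delta>_nz[of q] A by (intro divide_left_mono) auto
    finally show ?thesis .
  qed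
  moreover have "\<epsilon> * \<epsilon> + \<epsilon> * \<epsilon> < J / A"
  proof -
    have "\<epsilon> = 2 * K\<^sup>2 * (T q / T n)" using K by (simp add: \<epsilon>_def power2_eq_square)
    also have "\<dots> \<le> 2 * K\<^sup>2 * (1 / T q)"
      using Tn(1) Tq K T_pos[of n] by (intro mult_left_mono) (auto simp: field_simps)
    finally have "\<epsilon> * \<epsilon> \<le> (2 * K\<^sup>2 * (1 / T q)) * (2 * K\<^sup>2 * (1 / T q))" using e0 by (intro mult_mono) auto
    also have "\<dots> = 4 * K ^ 4 / (T q * T q)" by (simp add: power2_eq_square power4_eq_xxxx)
    also have "\<dots> \<le> 4 * K ^ 4 / (T q * 1)" using Tq K by (intro divide_left_mono mult_left_mono) auto
    finally have "\<epsilon> * \<epsilon> + \<epsilon> * \<epsilon> \<le> 8 * K ^ 4 / T q" by simp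
    also have "\<dots> < J / A" using Tq J(1) A by (simp add: field_simps)
    finally show ?thesis .
  qed
  ultimately show False by linarith
qed

lemma mx_funpow_le:
  assumes F: "\<And>z. z \<in> L \<Longrightarrow> F z \<in> L" and C: "C \<ge> 1" and \<mu>: "\<mu> \<ge> 0"
    and gr: "\<And>z. z \<in> L \<Longrightarrow> mx (F z) \<le> C * mx z powr \<mu>"
  shows "\<exists>C'\<ge>1. \<forall>z\<in>L. (F ^^ i) z \<in> L \<and> mx ((F ^^ i) z) \<le> C' * mx z powr (\<mu> ^ i)"
proof (induction i)
  case 0 show ?case using mx_ge1 by (intro exI[of _ 1]) (auto intro: order_trans[OF zero_le_one])
next
  case (Suc i)
  then obtain C' where C': "C' \<ge> 1" "\<And>z. z \<in> L \<Longrightarrow> (F ^^ i) z \<in> L"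
    "\<And>z. z \<in> L \<Longrightarrow> mx ((F ^^ i) z) \<le> C' * mx z powr (\<mu> ^ i)" by blast
  have "C * C' powr \<mu> \<ge> 1" using mult_mono[of 1 C 1 "C' powr \<mu>"] C C' \<mu> by (simp add: ge_one_powr_ge_zero)
  moreover have "mx ((F ^^ Suc i) z) \<le> C * C' powr \<mu> * mx z powr (\<mu> ^ Suc i)" if z: "z \<in> L" for z
  proof -
    have "mx ((F ^^ Suc i) z) \<le> C * mx ((F ^^ i) z) powr \<mu>" using gr[OF C'(2)[OF z]] by simp
    also have "\<dots> \<le> C * (C' * mx z powr (\<mu> ^ i)) powr \<mu>"
      using C'(3)[OF z] C \<mu> order_trans[OF zero_le_one mx_ge1] by (intro mult_left_mono powr_mono2) auto
    also have "\<dots> = C * C' powr \<mu> * mx z powr (\<mu> ^ Suc i)"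
      by (simp add: powr_mult powr_powr mult.commute)
    finally show ?thesis .
  qed
  ultimately show ?case using F C'(2) by (intro exI[of _ "C * C' powr \<mu>"]) auto
qed

text \<open>Since \<open>mx\<close> takes arbitrarily large values on \<open>L\<close>, no constant
  compensates a larger exponent.\<close>

lemma powr_le_imp_exponent_le:
  assumes "\<And>z. z \<in> L \<Longrightarrow> mx z powr \<alpha> \<le> C * mx z powr \<beta>"
  shows "\<alpha> \<le> \<beta>"
proof (rule ccontr)
  assume "\<not> \<alpha> \<le> \<beta>"
  define \<gamma> where "\<gamma> = \<alpha> - \<beta>"
  have \<gamma>: "\<gamma> > 0" using \<open>\<not> \<alpha> \<le> \<beta>\<close> by (simp add: \<gamma>_def)
  obtain z where z: "z \<in> L" "norm (fst z) > max C 1 powr (1 / \<gamma>)" using L_unbounded by blast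
  then have m: "mx z > max C 1 powr (1 / \<gamma>)" by (simp add: mx_def)
  have "mx z powr \<gamma> > (max C 1 powr (1 / \<gamma>)) powr \<gamma>" using m \<gamma> by (intro powr_less_mono2) auto
  then have "mx z powr \<gamma> > C" using \<gamma> by (simp add: powr_powr)
  moreover have "mx z powr \<beta> > 0" using mx_ge1[of z] by (simp del: mx_ge1)
  ultimately have "mx z powr \<gamma> * mx z powr \<beta> > C * mx z powr \<beta>" by (intro mult_strict_right_mono)
  then show False using assms[OF z(1)] by (simp add: powr_add[symmetric] \<gamma>_def)
qed

lemma cn_nonneg: "cn z \<ge> 0" by (simp add: cn_def max.coboundedI1)

text \<open>The orbit started at time \<open>q\<close> instead of 0: \<open>W q j\<close> is \<Phi>
  at time \<open>q + j\<close> after \<Psi> at time \<open>q\<close>.\<close>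

primrec W where "W q 0 w = w" | "W q (Suc j) w = H (q + j) (W q j w)"

lemma E_Suc: "E q (q + Suc j) = E q (q + j) * d (q + j)"
  by (simp add: E_def)

lemma E_Suc_ge: "2 * E q (q + j) \<le> E q (q + Suc j)"
  unfolding E_Suc using mult_le_mono2[OF d2[of "q + j"], of "E q (q + j)"] by (simp add: mult.commute)

lemma E_ge: "j \<le> E q (q + j)"
proof (induction j)
  case (Suc j) then show ?case using E_Suc_ge[of q j] E_pos[of q "q + j"] by linarith
qed simp

lemma N_W_le:
  assumes "N w \<le> Q"
  shows "N (W q j w) \<le> (B * Q) ^ E q (q + j)"
proof -
  have Q: "Q \<ge> 1" using assms N_ge1[of w] by linarith
  have BQ: "B * Q \<ge> 1" using mult_mono[of 1 B 1 Q] Q B2 by auto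
  \<comment> \<open>The additional factor \<open>1 / B\<close> makes the induction close: the
    \<open>B\<close> lost in a step is outweighed by raising \<open>1 / B\<close> to a degree at
    least 2.\<close>
  have 1: "N (W q j w) \<le> (B * Q) ^ E q (q + j) / B"
  proof (induction j)
    case 0 show ?case using assms B_pos by simp
  next
    case (Suc j)
    have "N (W q (Suc j) w) \<le> B * N (W q j w) ^ d (q + j)" using N_H_le by simp
    also have "\<dots> \<le> B * ((B * Q) ^ E q (q + j) / B) ^ d (q + j)"
      using Suc B_pos N_ge1[of "W q j w"] by (intro mult_left_mono power_mono) auto
    also have "\<dots> = (B * Q) ^ E q (q + Suc j) * (B / B ^ d (q + j))"
      unfolding E_Suc by (simp add: power_mult power_divide)
    also have "\<dots> \<le> (B * Q) ^ E q (q + Suc j) * (1 / B)"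
    proof (rule mult_left_mono)
      have "B * B \<le> B ^ d (q + j)" using power_increasing[OF d2[of "q + j"], of B] B2 by (simp add: power2_eq_square)
      then show "B / B ^ d (q + j) \<le> 1 / B" using B_pos by (simp add: field_simps)
    qed (use BQ in simp)
    finally show ?case by simp
  qed
  also have "\<dots> \<le> (B * Q) ^ E q (q + j) / 1" using B2 BQ by (intro divide_left_mono) auto
  finally show ?thesis by simp
qed

end

section \<open>Linear growth on the level set\<close>

locale henon_periodic = henon_seq +
  fixes k :: nat
  assumes k: "k > 0" and per: "p (n + k) = p n" "\<delta> (n + k) = \<delta> n"
begin

lemma periodic_mod:
  assumes "\<And>n. x (n + k) = x n"
  shows "x n = x (n mod k)"
proof (induction n rule: less_induct)
  case (less n)
  show ?case
  proof (cases "n < k")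
    case False
    then have "x n = x (n - k)" using assms[of "n - k"] by simp
    also have "\<dots> = x ((n - k) mod k)" using less[of "n - k"] False k by simp
    also have "(n - k) mod k = n mod k" using False by (simp add: le_mod_geq)
    finally show ?thesis .
  qed simp
qed

text \<open>There are only \<open>k\<close> different factors, so a constant that may be enlarged
  can be chosen once for all. The property speaks of the polynomial and the scalar, not of
  \<open>n\<close>, so that periodicity carries it over.\<close>

lemma uniform_bound:
  fixes P :: "complex poly \<Rightarrow> complex \<Rightarrow> real \<Rightarrow> bool"
  assumes "\<And>n. \<exists>C. P (p n) (\<delta> n) C" "\<And>n C C'. P (p n) (\<delta> n) C \<Longrightarrow> C \<le> C' \<Longrightarrow> P (p n) (\<delta> n) C'"
  shows "\<exists>C. \<forall>n. P (p n) (\<delta> n) C"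
proof -
  obtain f where f: "\<And>n. P (p n) (\<delta> n) (f n)" using assms(1) by metis
  have "P (p n) (\<delta> n) (Max (f ` {..<k}))" for n
  proof -
    have "P (p (n mod k)) (\<delta> (n mod k)) (Max (f ` {..<k}))"
      using k by (intro assms(2)[OF f] Max_ge) auto
    then show ?thesis using periodic_mod[of p n] periodic_mod[of \<delta> n] per by simp
  qed
  then show ?thesis by blast
qed

lemma degree_bounded: "\<exists>dm\<ge>2. \<forall>n. d n \<le> dm"
proof -
  have "\<exists>C. \<forall>n. real (degree (p n)) \<le> C"
    by (rule uniform_bound[of "\<lambda>q _ C. real (degree q) \<le> C"]) auto
  then obtain C where C: "\<And>n. real (degree (p n)) \<le> C" by blast
  have "d n \<le> max 2 (nat \<lceil>C\<rceil>)" for n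
  proof -
    have "real (d n) \<le> C" using C[of n] by (simp add: d_def)
    then have "d n \<le> nat \<lceil>C\<rceil>" by linarith
    then show ?thesis by simp
  qed
  then show ?thesis by (intro exI[of _ "max 2 (nat \<lceil>C\<rceil>)"]) auto
qed

text \<open>The iterates of \<open>F\<close> have exponents \<mu> to the power \<open>i\<close>. If
  \<mu> were below 1, some iterate would fall under the threshold \<open>1 / dm ^ 2\<close> of
  \<open>no_contraction\<close>.\<close>

lemma growth_exponent_ge_1:
  assumes F: "poly_map F" "poly_map G" "\<And>z. G (F z) = z" "\<And>z. z \<in> L \<Longrightarrow> F z \<in> L" and C: "C \<ge> 1" and \<mu>: "\<mu> \<ge> 0"
    and gr: "\<And>z. z \<in> L \<Longrightarrow> mx (F z) \<le> C * mx z powr \<mu>"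
  shows "\<mu> \<ge> 1"
proof (rule ccontr)
  assume "\<not> \<mu> \<ge> 1"
  obtain dm where dm: "dm \<ge> 2" "\<And>n. d n \<le> dm" using degree_bounded by blast
  obtain i where i: "\<mu> ^ i < 1 / (real dm)\<^sup>2"
    using real_arch_pow_inv[of "1 / (real dm)\<^sup>2" \<mu>] dm \<open>\<not> \<mu> \<ge> 1\<close> by auto
  obtain C' where C': "C' \<ge> 1" "\<And>z. z \<in> L \<Longrightarrow> (F ^^ i) z \<in> L"
    "\<And>z. z \<in> L \<Longrightarrow> mx ((F ^^ i) z) \<le> C' * mx z powr (\<mu> ^ i)"
    using mx_funpow_le[where F = F and i = i, OF F(4) C \<mu> gr] by auto
  show False
    by (rule no_contraction[where F = "F ^^ i" and G = "G ^^ i" and dm = dm and \<mu> = "\<mu> ^ i" and C = C'])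
      (use F C' dm i \<mu> in \<open>auto simp: poly_map_funpow funpow_inverse field_simps\<close>)
qed

text \<open>The lower growth bounds for \<open>F\<close> and then \<open>G\<close> compose to one
  for the identity, so the product of the exponents is at most 1, while each is at least 1.\<close>

lemma linear_growth:
  assumes F: "poly_map F" and G: "poly_map G" and GF: "\<And>z. G (F z) = z" and FG: "\<And>z. F (G z) = z"
    and FL: "\<And>z. z \<in> L \<Longrightarrow> F z \<in> L" and GL: "\<And>z. z \<in> L \<Longrightarrow> G z \<in> L"
  shows "\<exists>C\<ge>1. \<forall>z\<in>L. mx (F z) \<le> C * mx z"
proof -
  obtain lam C where C: "lam \<ge> 0" "C \<ge> 1" "\<And>z. z \<in> L \<Longrightarrow> mx (F z) \<le> C * mx z powr lam"
    "\<And>z. z \<in> L \<Longrightarrow> mx z powr lam \<le> C * mx (F z)"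
  proof -
    have pf: "poly_fun (\<lambda>z. fst (F z))" "fst (F (G (1, 0))) \<noteq> 0"
      using F FG by (auto simp: poly_map_def)
    from L_growth[OF pf] that show thesis unfolding mx_def by blast
  qed
  obtain lam' C' where C': "lam' \<ge> 0" "C' \<ge> 1" "\<And>z. z \<in> L \<Longrightarrow> mx (G z) \<le> C' * mx z powr lam'"
    "\<And>z. z \<in> L \<Longrightarrow> mx z powr lam' \<le> C' * mx (G z)"
  proof -
    have pf: "poly_fun (\<lambda>z. fst (G z))" "fst (G (F (1, 0))) \<noteq> 0"
      using G GF by (auto simp: poly_map_def)
    from L_growth[OF pf] that show thesis unfolding mx_def by blast
  qed
  have ge: "lam \<ge> 1" "lam' \<ge> 1"
    using growth_exponent_ge_1[where F = F and G = G] growth_exponent_ge_1[where F = G and G = F]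
      F G GF FG FL GL C C' by blast+
  have "lam * lam' \<le> 1"
  proof (rule powr_le_imp_exponent_le[where C = "C powr lam' * C'"])
    fix z assume z: "z \<in> L"
    have "mx z powr (lam * lam') = (mx z powr lam) powr lam'" by (simp add: powr_powr)
    also have "\<dots> \<le> (C * mx (F z)) powr lam'" using C(4)[OF z] C'(1) by (intro powr_mono2) auto
    also have "\<dots> = C powr lam' * mx (F z) powr lam'" by (rule powr_mult)
    also have "\<dots> \<le> C powr lam' * (C' * mx (G (F z)))" using C'(4)[OF FL[OF z]] by (intro mult_left_mono) auto
    finally show "mx z powr (lam * lam') \<le> C powr lam' * C' * mx z powr 1"
      using GF order_trans[OF zero_le_one mx_ge1[of z]] by (simp add: mult.assoc del: mx_ge1)
  qed
  moreover have "lam * 1 \<le> lam * lam'" using ge by (intro mult_left_mono) auto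
  ultimately have "lam = 1" using ge by linarith
  then show ?thesis using C mx_ge1 by (intro exI[of _ C]) (auto simp: order_trans[OF zero_le_one mx_ge1])
qed

lemma pderiv_growth: "\<exists>C\<ge>1. \<forall>n y. norm (poly (pderiv (p n)) y) \<le> C * max 1 (norm y) ^ d n"
proof -
  have "\<exists>C. \<forall>n. C \<ge> 1 \<and> (\<forall>y. norm (poly (pderiv (p n)) y) \<le> C * max 1 (norm y) ^ degree (p n))"
  proof (rule uniform_bound[of "\<lambda>q e C. C \<ge> 1 \<and> (\<forall>y. norm (poly (pderiv q) y) \<le> C * max 1 (norm y) ^ degree q)"])
    fix n
    obtain C where C: "\<And>y. norm (poly (pderiv (p n)) y) \<le> C * max 1 (norm y) ^ degree (pderiv (p n))"
      using poly_growth_le by blast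
    have "norm (poly (pderiv (p n)) y) \<le> max C 1 * max 1 (norm y) ^ degree (p n)" for y
    proof -
      have "C * max 1 (norm y) ^ degree (pderiv (p n)) \<le> max C 1 * max 1 (norm y) ^ degree (p n)"
        by (intro mult_mono power_increasing) (auto simp: degree_pderiv)
      then show ?thesis using C[of y] by linarith
    qed
    then show "\<exists>C. C \<ge> 1 \<and> (\<forall>y. norm (poly (pderiv (p n)) y) \<le> C * max 1 (norm y) ^ degree (p n))"
      by (intro exI[of _ "max C 1"]) auto
  next
    fix n and C C' :: real
    assume a: "C \<ge> 1 \<and> (\<forall>y. norm (poly (pderiv (p n)) y) \<le> C * max 1 (norm y) ^ degree (p n))" "C \<le> C'"
    have "C * max 1 (norm y) ^ degree (p n) \<le> C' * max 1 (norm y) ^ degree (p n)" for y :: complex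
      using a(2) by (intro mult_right_mono) auto
    then show "C' \<ge> 1 \<and> (\<forall>y. norm (poly (pderiv (p n)) y) \<le> C' * max 1 (norm y) ^ degree (p n))"
      using a by (auto intro: order_trans)
  qed
  then show ?thesis unfolding d_def by blast
qed

text \<open>The inverse recovers \<open>x\<close> from a difference of polynomial values divided by
  \<delta>, and the derivative of the polynomial is crudely bounded by a multiple of
  \<open>Y ^ d n\<close>. What matters is that the exponent is the degree of the step.\<close>

lemma backward_lipschitz:
  "\<exists>\<Lambda>\<ge>1. \<forall>n z w Y. N z \<le> Y \<longrightarrow> N w \<le> Y \<longrightarrow> cn (z - w) \<le> \<Lambda> * Y ^ d n * cn (H n z - H n w)"
proof -
  obtain C where C: "C \<ge> 1" "\<And>n y. norm (poly (pderiv (p n)) y) \<le> C * max 1 (norm y) ^ d n"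
    using pderiv_growth by blast
  define \<Lambda> where "\<Lambda> = A * (C + 1)"
  have \<Lambda>: "\<Lambda> \<ge> 1" unfolding \<Lambda>_def using mult_mono[of 1 A 1 "C + 1"] A C by auto
  have "cn (z - w) \<le> \<Lambda> * Y ^ d n * cn (H n z - H n w)" if z: "N z \<le> Y" and w: "N w \<le> Y" for n z w Y
  proof -
    define \<eta> where "\<eta> = cn (H n z - H n w)"
    obtain x y where zz: "z = (x, y)" by (cases z)
    obtain x' y' where ww: "w = (x', y')" by (cases w)
    have Y: "Y \<ge> 1" "norm y \<le> Y" "norm y' \<le> Y" using z w N_ge1[of z] N_ge(3)[of z] N_ge(3)[of w] by (auto simp: zz ww)
    have Yd: "Y ^ d n \<ge> 1" using Y by simp
    define v v' where "v = poly (p n) y - \<delta> n * x" and "v' = poly (p n) y' - \<delta> n * x'"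
    have \<eta>: "norm (y - y') \<le> \<eta>" "norm (v - v') \<le> \<eta>" by (auto simp: \<eta>_def cn_def zz ww H_def v_def v'_def)
    have \<eta>0: "\<eta> \<ge> 0" using \<eta>(1) norm_ge_zero order_trans by blast
    have lip: "norm (poly (p n) y - poly (p n) y') \<le> C * Y ^ d n * norm (y - y')"
    proof (rule field_differentiable_bound[of "cball 0 Y" _ "poly (pderiv (p n))"])
      fix t :: complex assume "t \<in> cball 0 Y"
      then have "max 1 (norm t) ^ d n \<le> Y ^ d n" using Y by (intro power_mono) auto
      then show "norm (poly (pderiv (p n)) t) \<le> C * Y ^ d n"
        using C(2)[of n t] C(1) mult_left_mono[of "max 1 (norm t) ^ d n" "Y ^ d n" C] by linarith
    qed (use Y in \<open>auto intro: DERIV_subset[OF poly_DERIV]\<close>)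
    have "norm (\<delta> n * (x - x')) = norm ((poly (p n) y - poly (p n) y') - (v - v'))"
      by (simp add: v_def v'_def algebra_simps)
    also have "\<dots> \<le> C * Y ^ d n * \<eta> + 1 * \<eta>"
    proof -
      have "C * Y ^ d n * norm (y - y') \<le> C * Y ^ d n * \<eta>" using \<eta>(1) C(1) Yd by (intro mult_left_mono) auto
      then show ?thesis
        using norm_triangle_ineq4[of "poly (p n) y - poly (p n) y'" "v - v'"] lip \<eta>(2) by linarith
    qed
    also have "\<dots> \<le> C * Y ^ d n * \<eta> + Y ^ d n * \<eta>" using Yd \<eta>0 by (intro add_left_mono mult_right_mono) auto
    also have "\<dots> = (C + 1) * Y ^ d n * \<eta>" by (simp add: algebra_simps)
    finally have 1: "norm (\<delta> n) * norm (x - x') \<le> (C + 1) * Y ^ d n * \<eta>" by (simp add: norm_mult)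
    have "norm (x - x') = (A * (1 / A)) * norm (x - x')" using A by simp
    also have "\<dots> \<le> (A * norm (\<delta> n)) * norm (x - x')"
      using \<delta>_le(2)[of n] A by (intro mult_right_mono mult_left_mono) auto
    also have "\<dots> \<le> A * ((C + 1) * Y ^ d n * \<eta>)" using 1 A by (simp add: mult.assoc)
    finally have 2: "norm (x - x') \<le> \<Lambda> * Y ^ d n * \<eta>" by (simp add: \<Lambda>_def mult_ac)
    have "1 * \<eta> \<le> (\<Lambda> * Y ^ d n) * \<eta>"
      using mult_mono[of 1 \<Lambda> 1 "Y ^ d n"] \<Lambda> Yd \<eta>0 by (intro mult_right_mono) auto
    then have "norm (y - y') \<le> \<Lambda> * Y ^ d n * \<eta>" using \<eta> by linarith
    then show ?thesis using 2 by (simp add: cn_def zz ww \<eta>_def)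
  qed
  then show ?thesis using \<Lambda> by blast
qed

section \<open>Identification of \<open>g\<close> with the Green function\<close>

lemma H_mod: "H (n * k + j) = H j"
proof (induction n)
  case (Suc n)
  have "Suc n * k + j = (n * k + j) + k" by simp
  then have "H (Suc n * k + j) = H (n * k + j)" using per[of "n * k + j"] by (simp only: H_def)
  then show ?case using Suc by simp
qed simp

lemma \<Phi>_mult_add: "\<Phi> (n * k + j) z = \<Phi> j (\<Phi> (n * k) z)"
  by (induction j) (simp_all add: \<Phi>.simps(2) H_mod)

lemma \<Phi>_mult: "\<Phi> (n * k) z = (\<Phi> k ^^ n) z"
proof (induction n)
  case (Suc n)
  have "\<Phi> (Suc n * k) z = \<Phi> (n * k + k) z" by (simp add: add.commute)
  then show ?case using Suc \<Phi>_mult_add[of n k z] by simp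
qed simp

lemma d_mod: "d (n * k + j) = d j"
proof (induction n)
  case (Suc n)
  have "Suc n * k + j = (n * k + j) + k" by simp
  then have "d (Suc n * k + j) = d (n * k + j)" using per(1)[of "n * k + j"] by (simp only: d_def)
  then show ?case using Suc by simp
qed simp

lemma D_mult: "D (n * k) = D k ^ n"
proof (induction n)
  case (Suc n)
  have "D (n * k + j) = D (n * k) * D j" for j
    by (induction j) (simp_all add: D_Suc d_mod)
  from this[of k] show ?case using Suc by (simp add: add.commute mult.commute)
qed simp

text \<open>The error is bounded independently of the point, so it disappears after division by
  \<open>D (n * k)\<close>; the limit is then that of \<open>s\<close> along the multiples of
  \<open>k\<close>.\<close>

lemma log_plus_N: "\<bar>log_plus (norm w) - ln (N w)\<bar> \<le> ln R + ln 2"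
proof -
  define t where "t = max 1 (norm w)"
  have lp: "log_plus (norm w) = ln t"
  proof (cases "norm w \<ge> 1")
    case False
    then have "ln (norm w) \<le> 0" by (cases "norm w = 0") auto
    then show ?thesis using False by (simp add: log_plus_def t_def)
  qed (simp add: log_plus_def t_def)
  have t: "t \<ge> 1" by (simp add: t_def)
  have c: "norm (fst w) \<le> norm w" "norm (snd w) \<le> norm w" by (cases w; simp add: norm_fst_le norm_snd_le)+
  have "R * 1 \<le> R * t" using R2 t by (intro mult_left_mono) auto
  moreover have "1 * norm w \<le> R * t" using R2 t by (intro mult_mono) (auto simp: t_def)
  ultimately have "R \<le> R * t" "norm w \<le> R * t" by simp_all
  then have "N w \<le> R * t" using c by (simp add: N_eq)
  then have "ln (N w) \<le> ln (R * t)" using N_ge1[of w] t R2 by (subst ln_le_cancel_iff) auto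
  then have 1: "ln (N w) \<le> ln R + ln t" using R2 t by (simp add: ln_mult)
  have "norm w \<le> norm (fst w) + norm (snd w)" using norm_Pair_le[of "fst w" "snd w"] by simp
  then have "t \<le> 2 * N w" using N_ge[of w] N_ge1[of w] by (simp add: t_def)
  then have "ln t \<le> ln (2 * N w)" using t N_ge1[of w] by (subst ln_le_cancel_iff) auto
  then have 2: "ln t \<le> ln 2 + ln (N w)" using N_ge1[of w] by (simp add: ln_mult)
  have "ln R \<ge> 0" "ln (2::real) \<ge> 0" using R2 by auto
  then show ?thesis unfolding lp using 1 2 by linarith
qed

lemma green_eq_lim: "lim (\<lambda>n. 1 / real (D k) ^ n * log_plus (norm ((\<Phi> k ^^ n) z))) = g z"
proof (rule limI)
  have mono: "strict_mono (\<lambda>n. n * k)" using k by (auto intro!: strict_monoI)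
  have 1: "(\<lambda>n. s (n * k) z) \<longlonglongrightarrow> g z" using LIMSEQ_subseq_LIMSEQ[OF s_LIMSEQ mono] by (simp add: o_def)
  have 2: "(\<lambda>n. (ln R + ln 2) / real (D (n * k))) \<longlonglongrightarrow> 0"
    using LIMSEQ_subseq_LIMSEQ[OF D_inverse_LIMSEQ mono] by (simp add: o_def)
  have "(\<lambda>n. 1 / real (D k) ^ n * log_plus (norm ((\<Phi> k ^^ n) z)) - s (n * k) z) \<longlonglongrightarrow> 0"
  proof (rule Lim_null_comparison[OF always_eventually 2], rule allI)
    fix n
    define w where "w = \<Phi> (n * k) z"
    have "1 / real (D k) ^ n * log_plus (norm ((\<Phi> k ^^ n) z)) - s (n * k) z = (log_plus (norm w) - ln (N w)) / real (D (n * k))"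
      by (simp add: s_def \<Phi>_mult[symmetric] D_mult w_def diff_divide_distrib)
    then show "norm (1 / real (D k) ^ n * log_plus (norm ((\<Phi> k ^^ n) z)) - s (n * k) z) \<le> (ln R + ln 2) / real (D (n * k))"
      using log_plus_N[of w] by (simp add: divide_right_mono)
  qed
  from tendsto_add[OF this 1] show "(\<lambda>n. 1 / real (D k) ^ n * log_plus (norm ((\<Phi> k ^^ n) z))) \<longlonglongrightarrow> g z" by simp
qed

end

section \<open>Asymptotics of the conjugates of the automorphism\<close>

text \<open>The invariance of \<open>L\<close> enters from here on only through \<open>bd\<close>,
  the outcome of \<open>conj_bound\<close> for exponent 1. The left inverse \<open>G\<close> makes
  the Jacobian of \<open>F\<close> constant and nonzero.\<close>

locale henon_aut = henon_periodic +
  fixes F G :: "complex \<times> complex \<Rightarrow> complex \<times> complex" and K :: real and n1 :: nat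
  assumes F: "poly_map F" and G: "poly_map G" and GF: "G (F z) = z"
    and K: "K \<ge> 1" and bd: "\<lbrakk>n \<ge> n1; norm u \<le> T n / K; norm v \<le> T n / K\<rbrakk> \<Longrightarrow> cn (\<Phi> n (F (\<Psi> n (u, v)))) \<le> K * T n"
begin

definition Fn where "Fn n w = \<Phi> n (F (\<Psi> n w))"
definition f1 where "f1 n w = fst (Fn n w)"
definition f2 where "f2 n w = snd (Fn n w)"

lemma poly_map_Fn: "poly_map (Fn n)"
  unfolding Fn_def[abs_def] by (rule poly_map_conj[OF F])
lemma poly_fun_f12: "poly_fun (f1 n)" "poly_fun (f2 n)"
  using poly_map_Fn unfolding poly_map_def f1_def[abs_def] f2_def[abs_def] by auto

lemma Fn_H: "Fn (Suc n) (H n w) = H n (Fn n w)"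
  by (simp add: Fn_def \<Phi>.simps(2))

lemma Fn_eq: "Fn n w = (f1 n w, f2 n w)" by (simp add: f1_def f2_def)

lemma f1_H: "f1 (Suc n) (H n w) = f2 n w"
  by (simp add: f1_def f2_def Fn_H) (simp add: H_def case_prod_unfold)
lemma f2_H: "f2 (Suc n) (H n w) = snd (H n (Fn n w))"
  by (simp add: f2_def Fn_H)

text \<open>The chain rule for \<open>f1_H\<close> and \<open>f2_H\<close>, that is, for the two
  coordinates of the intertwining relation \<open>Fn_H\<close>.\<close>

lemma deriv_rel:
  "Dx (f2 n) w = - \<delta> n * Dy (f1 (Suc n)) (H n w)"
  "Dy (f2 n) w = Dx (f1 (Suc n)) (H n w) + Dy (f1 (Suc n)) (H n w) * poly (pderiv (p n)) (snd w)"
  "- \<delta> n * Dy (f2 (Suc n)) (H n w) = - \<delta> n * Dx (f1 n) w + poly (pderiv (p n)) (f2 n w) * Dx (f2 n) w"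
  "Dx (f2 (Suc n)) (H n w) + Dy (f2 (Suc n)) (H n w) * poly (pderiv (p n)) (snd w) =
     - \<delta> n * Dy (f1 n) w + poly (pderiv (p n)) (f2 n w) * Dy (f2 n) w"
proof -
  have e1: "f2 n = (\<lambda>w. f1 (Suc n) (H n w))" by (simp add: f1_H)
  show "Dx (f2 n) w = - \<delta> n * Dy (f1 (Suc n)) (H n w)"
    "Dy (f2 n) w = Dx (f1 (Suc n)) (H n w) + Dy (f1 (Suc n)) (H n w) * poly (pderiv (p n)) (snd w)"
    by (simp_all add: e1 chain_Dx_Dy[OF poly_fun_f12(1) poly_map_H] Dx_Dy_H)
  have sH: "poly_fun (\<lambda>w. snd (H n w))" using poly_map_H by (simp add: poly_map_def)
  have e2: "(\<lambda>w. f2 (Suc n) (H n w)) = (\<lambda>w. snd (H n (Fn n w)))" by (simp add: f2_H)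
  have "Dx (\<lambda>w. f2 (Suc n) (H n w)) w = Dx (\<lambda>w. snd (H n (Fn n w))) w"
    "Dy (\<lambda>w. f2 (Suc n) (H n w)) w = Dy (\<lambda>w. snd (H n (Fn n w))) w" by (simp_all only: e2)
  then show "- \<delta> n * Dy (f2 (Suc n)) (H n w) = - \<delta> n * Dx (f1 n) w + poly (pderiv (p n)) (f2 n w) * Dx (f2 n) w"
    "Dx (f2 (Suc n)) (H n w) + Dy (f2 (Suc n)) (H n w) * poly (pderiv (p n)) (snd w) =
     - \<delta> n * Dy (f1 n) w + poly (pderiv (p n)) (f2 n w) * Dy (f2 n) w"
    unfolding chain_Dx_Dy[OF poly_fun_f12(2) poly_map_H] chain_Dx_Dy[OF sH poly_map_Fn] Dx_Dy_H
    by (simp_all add: f1_def[abs_def] f2_def[abs_def] mult.commute)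
qed

definition K6 where "K6 = 32 * K ^ 3"

lemma K6: "K6 \<ge> 1" using one_le_power[OF K, of 3] unfolding K6_def by linarith

lemma f_bound:
  assumes "n \<ge> n1" "norm u \<le> T n / K" "norm v \<le> T n / K"
  shows "norm (f1 n (u, v)) \<le> K * T n" "norm (f2 n (u, v)) \<le> K * T n"
  using bd[OF assms] by (simp_all add: f1_def f2_def Fn_def cn_def)

text \<open>Cauchy estimates with radius \<open>T n / K\<close> and bound \<open>K * T n\<close>:
  their ratio is independent of \<open>n\<close>, so first derivatives stay bounded, while second
  derivatives are of order \<open>1 / T n\<close>. The constant 32 in \<open>K6\<close> is that of
  \<open>almost_affine\<close>.\<close>

lemma estimates:
  assumes n: "n \<ge> n1" and f: "f = f1 n \<or> f = f2 n" and r: "norm u \<le> r" "norm v \<le> r" "r \<le> T n / (4 * K)"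
  shows "norm (Dx f (u, v)) \<le> 2 * K\<^sup>2" "norm (Dy f (u, v)) \<le> 2 * K\<^sup>2"
    "norm (Dx f (u, v) - Dx f (0, 0)) \<le> K6 * r / T n"
    "norm (Dy f (u, v) - Dy f (0, 0)) \<le> K6 * r / T n"
    "norm (f (u, v) - (f (0, 0) + Dx f (0, 0) * u + Dy f (0, 0) * v)) \<le> K6 * r\<^sup>2 / T n"
proof -
  have pff: "poly_fun f" using f poly_fun_f12 by auto
  have \<rho>: "T n / K > 0" using K by simp
  have M: "norm (f (u, v)) \<le> K * T n" if "norm u \<le> T n / K" "norm v \<le> T n / K" for u v
    using f f_bound[OF n that] by auto
  have r4: "r \<le> T n / K / 4" using r(3) by simp
  have r0: "r \<ge> 0" using r(1) norm_ge_zero order_trans by blast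
  have half: "norm u \<le> T n / K / 2" "norm v \<le> T n / K / 2" using r r4 \<rho> by linarith+
  have c: "2 * (K * T n) / (T n / K) = 2 * K\<^sup>2" "16 * (K * T n) * r / (T n / K)\<^sup>2 = 16 * K ^ 3 * r / T n"
    "32 * (K * T n) * r\<^sup>2 / (T n / K)\<^sup>2 = K6 * r\<^sup>2 / T n"
    using K T_ge1[of n] by (auto simp: power2_eq_square power3_eq_cube field_simps K6_def)
  have "16 * K ^ 3 * r / T n \<le> K6 * r / T n"
    unfolding K6_def using K r0 by (intro divide_right_mono mult_right_mono) auto
  then show "norm (Dx f (u, v)) \<le> 2 * K\<^sup>2" "norm (Dy f (u, v)) \<le> 2 * K\<^sup>2"
    "norm (Dx f (u, v) - Dx f (0, 0)) \<le> K6 * r / T n"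
    "norm (Dy f (u, v) - Dy f (0, 0)) \<le> K6 * r / T n"
    "norm (f (u, v) - (f (0, 0) + Dx f (0, 0) * u + Dy f (0, 0) * v)) \<le> K6 * r\<^sup>2 / T n"
    using Cauchy_partial[OF pff \<rho> M half] Dx_almost_const[OF pff \<rho> M r(1,2) r4]
      Dy_almost_const[OF pff \<rho> M r(1,2) r4] almost_affine[OF pff \<rho> M r(1,2) r4] unfolding c by auto
qed

text \<open>The relations between the coefficients are asymptotic in \<open>n\<close>, uniformly for an auxiliary variable \<open>v\<close> in the
unit disc: \<open>bdd\<close> stands for order 1 and \<open>sml\<close> for order \<open>1 / T n\<close>.\<close>

definition bdd :: "(nat \<Rightarrow> complex \<Rightarrow> complex) \<Rightarrow> bool" where
  "bdd X \<longleftrightarrow> (\<exists>C\<ge>0. \<exists>m. \<forall>n\<ge>m. \<forall>v. norm v \<le> 1 \<longrightarrow> norm (X n v) \<le> C)"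

definition sml :: "(nat \<Rightarrow> complex \<Rightarrow> complex) \<Rightarrow> bool" where
  "sml X \<longleftrightarrow> (\<exists>C\<ge>0. \<exists>m. \<forall>n\<ge>m. \<forall>v. norm v \<le> 1 \<longrightarrow> norm (X n v) \<le> C / T n)"

lemma bddI: "C \<ge> 0 \<Longrightarrow> (\<And>n v. n \<ge> m \<Longrightarrow> norm v \<le> 1 \<Longrightarrow> norm (X n v) \<le> C) \<Longrightarrow> bdd X"
  unfolding bdd_def by blast
lemma smlI: "C \<ge> 0 \<Longrightarrow> (\<And>n v. n \<ge> m \<Longrightarrow> norm v \<le> 1 \<Longrightarrow> norm (X n v) \<le> C / T n) \<Longrightarrow> sml X"
  unfolding sml_def by blast

lemma bddE: assumes "bdd X" obtains C m where "C \<ge> 0" "\<And>n v. n \<ge> m \<Longrightarrow> norm v \<le> 1 \<Longrightarrow> norm (X n v) \<le> C"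
  using assms unfolding bdd_def by blast
lemma smlE: assumes "sml X" obtains C m where "C \<ge> 0" "\<And>n v. n \<ge> m \<Longrightarrow> norm v \<le> 1 \<Longrightarrow> norm (X n v) \<le> C / T n"
  using assms unfolding sml_def by blast

lemma sml_add: assumes "sml X" "sml Y" shows "sml (\<lambda>n v. X n v + Y n v)"
proof -
  obtain C m where X: "C \<ge> 0" "\<And>n v. n \<ge> m \<Longrightarrow> norm v \<le> 1 \<Longrightarrow> norm (X n v) \<le> C / T n" using that by (rule smlE[OF assms(1)])
  obtain C' m' where Y: "C' \<ge> 0" "\<And>n v. n \<ge> m' \<Longrightarrow> norm v \<le> 1 \<Longrightarrow> norm (Y n v) \<le> C' / T n" using that by (rule smlE[OF assms(2)])
  show ?thesis
    by (rule smlI[of "C + C'" "max m m'"]) (use X Y in \<open>auto simp: add_divide_distrib intro!: norm_triangle_mono\<close>)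
qed

lemma bdd_add: assumes "bdd X" "bdd Y" shows "bdd (\<lambda>n v. X n v + Y n v)"
proof -
  obtain C m where X: "C \<ge> 0" "\<And>n v. n \<ge> m \<Longrightarrow> norm v \<le> 1 \<Longrightarrow> norm (X n v) \<le> C" using that by (rule bddE[OF assms(1)])
  obtain C' m' where Y: "C' \<ge> 0" "\<And>n v. n \<ge> m' \<Longrightarrow> norm v \<le> 1 \<Longrightarrow> norm (Y n v) \<le> C'" using that by (rule bddE[OF assms(2)])
  show ?thesis
    by (rule bddI[of "C + C'" "max m m'"]) (use X Y in \<open>auto intro!: norm_triangle_mono\<close>)
qed

lemma bdd_mult: assumes "bdd X" "bdd Y" shows "bdd (\<lambda>n v. X n v * Y n v)"
proof -
  obtain C m where X: "C \<ge> 0" "\<And>n v. n \<ge> m \<Longrightarrow> norm v \<le> 1 \<Longrightarrow> norm (X n v) \<le> C" using that by (rule bddE[OF assms(1)])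
  obtain C' m' where Y: "C' \<ge> 0" "\<And>n v. n \<ge> m' \<Longrightarrow> norm v \<le> 1 \<Longrightarrow> norm (Y n v) \<le> C'" using that by (rule bddE[OF assms(2)])
  show ?thesis
    by (rule bddI[of "C * C'" "max m m'"]) (use X Y in \<open>auto simp: norm_mult intro!: mult_mono\<close>)
qed

lemma sml_mult: assumes "bdd X" "sml Y" shows "sml (\<lambda>n v. X n v * Y n v)"
proof -
  obtain C m where X: "C \<ge> 0" "\<And>n v. n \<ge> m \<Longrightarrow> norm v \<le> 1 \<Longrightarrow> norm (X n v) \<le> C" using that by (rule bddE[OF assms(1)])
  obtain C' m' where Y: "C' \<ge> 0" "\<And>n v. n \<ge> m' \<Longrightarrow> norm v \<le> 1 \<Longrightarrow> norm (Y n v) \<le> C' / T n" using that by (rule smlE[OF assms(2)])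
  have "norm (X n v * Y n v) \<le> C * (C' / T n)" if "n \<ge> max m m'" "norm v \<le> 1" for n v
    unfolding norm_mult using X Y that by (intro mult_mono) auto
  then show ?thesis using X Y by (intro smlI[of "C * C'" "max m m'"]) auto
qed

lemma sml_imp_bdd: assumes "sml X" shows "bdd X"
proof -
  obtain C m where X: "C \<ge> 0" "\<And>n v. n \<ge> m \<Longrightarrow> norm v \<le> 1 \<Longrightarrow> norm (X n v) \<le> C / T n" using that by (rule smlE[OF assms])
  have "C / T n \<le> C / 1" for n using X(1) T_ge1[of n] by (intro divide_left_mono) auto
  then show ?thesis using X by (intro bddI[of C m]) (auto intro: order_trans)
qed

lemma bdd_const [simp]: "bdd (\<lambda>n v. a)" by (rule bddI[of "norm a"]) auto

lemma sml_minus: "sml X \<Longrightarrow> sml (\<lambda>n v. - X n v)"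
  using sml_mult[OF bdd_const[of "-1"]] by simp
lemma sml_diff: "sml X \<Longrightarrow> sml Y \<Longrightarrow> sml (\<lambda>n v. X n v - Y n v)"
  using sml_add[OF _ sml_minus] by simp
lemma sml_trans: "sml (\<lambda>n v. X n v - Y n v) \<Longrightarrow> sml (\<lambda>n v. Y n v - Z n v) \<Longrightarrow> sml (\<lambda>n v. X n v - Z n v)"
  using sml_add[of "\<lambda>n v. X n v - Y n v" "\<lambda>n v. Y n v - Z n v"] by simp
lemma bdd_of_sml_diff: "sml (\<lambda>n v. X n v - Y n v) \<Longrightarrow> bdd Y \<Longrightarrow> bdd X"
  using bdd_add[OF sml_imp_bdd, of "\<lambda>n v. X n v - Y n v" Y] by simp

lemma sml_shift: assumes "sml X" shows "sml (\<lambda>n v. X (n + i) v)"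
proof -
  obtain C m where X: "C \<ge> 0" "\<And>n v. n \<ge> m \<Longrightarrow> norm v \<le> 1 \<Longrightarrow> norm (X n v) \<le> C / T n" using that by (rule smlE[OF assms])
  have "C / T (n + i) \<le> C / T n" for n using X(1) T_mono[of n "n + i"] by (intro divide_left_mono) auto
  then have "norm (X (n + i) v) \<le> C / T n" if "n \<ge> m" "norm v \<le> 1" for n v
    using X(2)[of "n + i" v] that by (meson order_trans trans_le_add1)
  then show ?thesis using X by (intro smlI[of C m]) auto
qed
lemma bdd_shift: assumes "bdd X" shows "bdd (\<lambda>n v. X (n + i) v)"
proof -
  obtain C m where X: "C \<ge> 0" "\<And>n v. n \<ge> m \<Longrightarrow> norm v \<le> 1 \<Longrightarrow> norm (X n v) \<le> C" using that by (rule bddE[OF assms])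
  then show ?thesis by (intro bddI[of C m]) auto
qed

lemma sml_at: assumes "sml X" "\<And>n. norm (w n) \<le> 1" shows "sml (\<lambda>n v. X n (w n))"
proof -
  obtain C m where X: "C \<ge> 0" "\<And>n v. n \<ge> m \<Longrightarrow> norm v \<le> 1 \<Longrightarrow> norm (X n v) \<le> C / T n" using that by (rule smlE[OF assms(1)])
  then show ?thesis using assms(2) by (intro smlI[of C m]) auto
qed

lemma sml_arbitrarily_small:
  assumes "sml X" "\<epsilon> > 0" shows "\<exists>m. \<forall>n\<ge>m. norm (X n 0) < \<epsilon>"
proof -
  obtain C m where X: "C \<ge> 0" "\<And>n v. n \<ge> m \<Longrightarrow> norm v \<le> 1 \<Longrightarrow> norm (X n v) \<le> C / T n" using that by (rule smlE[OF assms(1)])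
  obtain m' where m': "\<And>n. n \<ge> m' \<Longrightarrow> T n \<ge> C / \<epsilon> + 1" using T_unbounded by blast
  have "norm (X n 0) < \<epsilon>" if "n \<ge> max m m'" for n
  proof -
    have "C / \<epsilon> < T n" using m'[of n] that by simp
    then have "C / T n < \<epsilon>" using assms(2) by (simp add: field_simps)
    then show ?thesis using X(2)[of n 0] that by simp
  qed
  then show ?thesis by blast
qed

section \<open>Asymptotic relations between the affine parts at 0\<close>

definition a1 where "a1 n = Dx (f1 n) (0, 0)"
definition b1 where "b1 n = Dy (f1 n) (0, 0)"
definition a2 where "a2 n = Dx (f2 n) (0, 0)"
definition b2 where "b2 n = Dy (f2 n) (0, 0)"
definition c1 where "c1 n = f1 n (0, 0)"
definition c2 where "c2 n = f2 n (0, 0)"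
abbreviation p' where "p' n \<equiv> poly (pderiv (p n))"

lemma T_large: "\<exists>m. \<forall>n\<ge>m. n \<ge> n1 \<and> r \<le> T n / (4 * K)"
proof -
  obtain m where m: "\<And>n. n \<ge> m \<Longrightarrow> T n \<ge> 4 * K * r" using T_unbounded by blast
  then have "r \<le> T n / (4 * K)" if "n \<ge> m" for n using m[OF that] K by (simp add: field_simps)
  then show ?thesis by (intro exI[of _ "max m n1"]) auto
qed

text \<open>The points stay in a bidisc of fixed radius, so the powers of \<open>r\<close> disappear
  into the constant.\<close>

lemma sml_estimates:
  assumes "\<And>n v. norm v \<le> 1 \<Longrightarrow> norm (x n v) \<le> r \<and> norm (y n v) \<le> r"
  shows "sml (\<lambda>n v. Dx (f1 n) (x n v, y n v) - a1 n)" "sml (\<lambda>n v. Dy (f1 n) (x n v, y n v) - b1 n)"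
    "sml (\<lambda>n v. Dx (f2 n) (x n v, y n v) - a2 n)" "sml (\<lambda>n v. Dy (f2 n) (x n v, y n v) - b2 n)"
    "sml (\<lambda>n v. f1 n (x n v, y n v) - (c1 n + a1 n * x n v + b1 n * y n v))"
    "sml (\<lambda>n v. f2 n (x n v, y n v) - (c2 n + a2 n * x n v + b2 n * y n v))"
proof -
  have r: "r \<ge> 0" using assms[of 0] norm_ge_zero order_trans by (metis norm_zero zero_le_one)
  obtain m where m: "\<And>n. n \<ge> m \<Longrightarrow> n \<ge> n1 \<and> r \<le> T n / (4 * K)" using T_large by blast
  have C: "K6 * r \<ge> 0" "K6 * r\<^sup>2 \<ge> 0" using K6 r by auto
  have E1: "norm (Dx (f1 n) (x n v, y n v) - Dx (f1 n) (0, 0)) \<le> K6 * r / T n"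
    "norm (Dy (f1 n) (x n v, y n v) - Dy (f1 n) (0, 0)) \<le> K6 * r / T n"
    "norm (f1 n (x n v, y n v) - (f1 n (0, 0) + Dx (f1 n) (0, 0) * x n v + Dy (f1 n) (0, 0) * y n v)) \<le> K6 * r\<^sup>2 / T n"
    if "n \<ge> m" "norm v \<le> 1" for n v
    using estimates(3-5)[of n "f1 n" "x n v" r "y n v"] m[OF that(1)] assms[OF that(2)] by simp_all
  have E2: "norm (Dx (f2 n) (x n v, y n v) - Dx (f2 n) (0, 0)) \<le> K6 * r / T n"
    "norm (Dy (f2 n) (x n v, y n v) - Dy (f2 n) (0, 0)) \<le> K6 * r / T n"
    "norm (f2 n (x n v, y n v) - (f2 n (0, 0) + Dx (f2 n) (0, 0) * x n v + Dy (f2 n) (0, 0) * y n v)) \<le> K6 * r\<^sup>2 / T n"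
    if "n \<ge> m" "norm v \<le> 1" for n v
    using estimates(3-5)[of n "f2 n" "x n v" r "y n v"] m[OF that(1)] assms[OF that(2)] by simp_all
  show "sml (\<lambda>n v. Dx (f1 n) (x n v, y n v) - a1 n)" "sml (\<lambda>n v. Dy (f1 n) (x n v, y n v) - b1 n)"
    "sml (\<lambda>n v. Dx (f2 n) (x n v, y n v) - a2 n)" "sml (\<lambda>n v. Dy (f2 n) (x n v, y n v) - b2 n)"
    unfolding a1_def b1_def a2_def b2_def
    using smlI[OF C(1) E1(1)] smlI[OF C(1) E1(2)] smlI[OF C(1) E2(1)] smlI[OF C(1) E2(2)] by simp_all
  show "sml (\<lambda>n v. f1 n (x n v, y n v) - (c1 n + a1 n * x n v + b1 n * y n v))"
    "sml (\<lambda>n v. f2 n (x n v, y n v) - (c2 n + a2 n * x n v + b2 n * y n v))"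
    unfolding a1_def b1_def a2_def b2_def c1_def c2_def
    using smlI[OF C(2) E1(3)] smlI[OF C(2) E2(3)] by simp_all
qed

lemma bdd_coeffs: "bdd (\<lambda>n v. a1 n)" "bdd (\<lambda>n v. b1 n)" "bdd (\<lambda>n v. a2 n)" "bdd (\<lambda>n v. b2 n)"
proof -
  have E: "norm (a1 n) \<le> 2 * K\<^sup>2" "norm (b1 n) \<le> 2 * K\<^sup>2" "norm (a2 n) \<le> 2 * K\<^sup>2" "norm (b2 n) \<le> 2 * K\<^sup>2"
    if "n \<ge> n1" for n
    unfolding a1_def b1_def a2_def b2_def
    using estimates(1,2)[of n "f1 n" 0 0 0] estimates(1,2)[of n "f2 n" 0 0 0] that K by simp_all
  have C: "2 * K\<^sup>2 \<ge> 0" by simp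
  show "bdd (\<lambda>n v. a1 n)" "bdd (\<lambda>n v. b1 n)" "bdd (\<lambda>n v. a2 n)" "bdd (\<lambda>n v. b2 n)"
    using bddI[OF C E(1)] bddI[OF C E(2)] bddI[OF C E(3)] bddI[OF C E(4)] by simp_all
qed

lemma norm_p_le_A: "norm v \<le> 1 \<Longrightarrow> norm (poly (p n) v) \<le> A"
  using p_le[of n v] by (simp add: max_def split: if_splits)

lemma bdd_periodic:
  assumes "\<And>q e v. X q e v = X' q e v" "\<And>q e. \<exists>C. \<forall>v. norm v \<le> 1 \<longrightarrow> norm (X' q e v :: complex) \<le> C"
  shows "bdd (\<lambda>n v. X (p n) (\<delta> n) v)"
proof -
  have "\<exists>C. \<forall>n. \<forall>v. norm v \<le> 1 \<longrightarrow> norm (X' (p n) (\<delta> n) v) \<le> C"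
    by (rule uniform_bound[of "\<lambda>q e C. \<forall>v. norm v \<le> 1 \<longrightarrow> norm (X' q e v) \<le> C"]) (use assms in \<open>auto intro: order_trans\<close>)
  then obtain C where "\<And>n v. norm v \<le> 1 \<Longrightarrow> norm (X' (p n) (\<delta> n) v) \<le> C" by blast
  then show ?thesis using assms(1) by (intro bddI[of "max C 0" 0]) (auto intro: max.coboundedI1)
qed

lemma poly_bounded_on_disc: "\<exists>C. \<forall>v. norm v \<le> r \<longrightarrow> norm (poly q v :: complex) \<le> C"
proof -
  have "compact (poly q ` cball 0 r)"
    by (intro compact_continuous_image continuous_intros) auto
  then show ?thesis
    using compact_imp_bounded bounded_iff by (metis imageI mem_cball_0)
qed

lemma bdd_p': "bdd (\<lambda>n v. p' n v)"
  by (rule bdd_periodic[of "\<lambda>q e v. poly (pderiv q) v"]) (use poly_bounded_on_disc in auto)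
lemma bdd_\<delta>: "bdd (\<lambda>n v. \<delta> n)"
  using A \<delta>_le by (intro bddI[of A 0]) auto

lemma inverse_\<delta>_bdd: "bdd (\<lambda>n v. 1 / \<delta> n)"
proof (rule bddI[of A 0])
  fix n
  show "norm (1 / \<delta> n) \<le> A"
    using \<delta>_le(2)[of n] A \<delta>_nz[of n] by (simp add: norm_divide field_simps)
qed (use A in auto)

text \<open>The second relation of \<open>deriv_rel\<close> at \<open>(0, v)\<close>, a point which
  \<open>H n\<close> sends to \<open>(v, poly (p n) v)\<close>, again bounded. Since
  \<open>b2 n\<close> does not involve \<open>v\<close>, varying \<open>v\<close> will separate the
  two terms subtracted from it.\<close>

lemma sml_row1: "sml (\<lambda>n v. b2 n - (a1 (Suc n) + b1 (Suc n) * p' n v))"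
proof -
  have r: "norm v \<le> 1 \<Longrightarrow> norm v \<le> A \<and> norm (poly (p n) v) \<le> A" for n v
    using norm_p_le_A[of v n] A by linarith
  have r': "norm v \<le> 1 \<Longrightarrow> norm v \<le> A \<and> norm (poly (p (n - 1)) v) \<le> A" for n v using r by blast
  \<comment> \<open>The points use \<open>p (n - 1)\<close> because \<open>sml_estimates\<close>
    concerns \<open>f1 n\<close>; the shift by 1 turns these into \<open>p n\<close> and
    \<open>f1 (Suc n)\<close>.\<close>
  have 1: "sml (\<lambda>n v. Dx (f1 (Suc n)) (v, poly (p n) v) - a1 (Suc n))"
    using sml_shift[OF sml_estimates(1)[of "\<lambda>n v. v" A "\<lambda>n v. poly (p (n - 1)) v", OF r'], of 1] by simp
  have 2: "sml (\<lambda>n v. Dy (f1 (Suc n)) (v, poly (p n) v) - b1 (Suc n))"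
    using sml_shift[OF sml_estimates(2)[of "\<lambda>n v. v" A "\<lambda>n v. poly (p (n - 1)) v", OF r'], of 1] by simp
  have 3: "sml (\<lambda>n v. Dy (f2 n) (0, v) - b2 n)"
    by (rule sml_estimates(4)[of "\<lambda>n v. 0" 1 "\<lambda>n v. v"]) auto
  have "sml (\<lambda>n v. (Dx (f1 (Suc n)) (v, poly (p n) v) - a1 (Suc n)) +
      p' n v * (Dy (f1 (Suc n)) (v, poly (p n) v) - b1 (Suc n)) - (Dy (f2 n) (0, v) - b2 n))"
    by (intro sml_diff sml_add sml_mult 1 2 3 bdd_p')
  moreover have "Dy (f2 n) (0, v) = Dx (f1 (Suc n)) (v, poly (p n) v) + Dy (f1 (Suc n)) (v, poly (p n) v) * p' n v" for n v
    using deriv_rel(2)[of n "(0, v)"] by (simp add: H_def)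
  ultimately show ?thesis by (simp add: algebra_simps)
qed

lemma degree_p': "degree (pderiv (p n)) > 0" using deg[of n] by (simp add: degree_pderiv)

lemma p'_gap: "\<exists>C. \<forall>n. \<exists>v. norm v \<le> 1 \<and> p' n v \<noteq> p' n 0 \<and> norm (1 / (p' n v - p' n 0)) \<le> C"
proof (rule uniform_bound[of "\<lambda>q e C. \<exists>v. norm v \<le> 1 \<and> poly (pderiv q) v \<noteq> poly (pderiv q) 0 \<and>
    norm (1 / (poly (pderiv q) v - poly (pderiv q) 0)) \<le> C"])
  fix n
  have "\<exists>v. norm v \<le> 1 \<and> p' n v \<noteq> p' n 0"
  proof (rule ccontr)
    assume *: "\<nexists>v. norm v \<le> 1 \<and> p' n v \<noteq> p' n 0"
    define q where "q = pderiv (p n) - [:p' n 0:]"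
    have "q \<noteq> 0"
    proof
      assume "q = 0"
      then have "pderiv (p n) = [:p' n 0:]" by (simp add: q_def)
      then have "degree (pderiv (p n)) = 0" by (metis degree_pCons_0)
      then show False using degree_p'[of n] by simp
    qed
    then have "finite {v. poly q v = 0}" by (rule poly_roots_finite)
    moreover have "cball 0 1 \<subseteq> {v. poly q v = 0}"
    proof
      fix v :: complex assume "v \<in> cball 0 1"
      then have "norm v \<le> 1" by simp
      then have "p' n v = p' n 0" using * by blast
      then show "v \<in> {v. poly q v = 0}" by (simp add: q_def)
    qed
    moreover have "infinite (cball (0::complex) 1)" by (rule uncountable_infinite) (simp add: uncountable_cball)
    ultimately show False by (meson finite_subset)
  qed
  then show "\<exists>C v. norm v \<le> 1 \<and> p' n v \<noteq> p' n 0 \<and> norm (1 / (p' n v - p' n 0)) \<le> C" by blast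
qed (auto intro: order_trans)

text \<open>Two values of \<open>v\<close> with different \<open>p' n v\<close> are subtracted in
  \<open>sml_row1\<close>. The gap is bounded below uniformly in \<open>n\<close>, as only finitely
  many nonconstant polynomials occur.\<close>

lemma sml_b1: "sml (\<lambda>n v. b1 (Suc n))"
proof -
  obtain C w where w: "\<And>n. norm (w n) \<le> 1" "\<And>n. p' n (w n) \<noteq> p' n 0" "\<And>n. norm (1 / (p' n (w n) - p' n 0)) \<le> C"
    using p'_gap by metis
  have C: "C \<ge> 0" using w(3)[of 0] norm_ge_zero order_trans by blast
  have "sml (\<lambda>n v. 1 / (p' n (w n) - p' n 0) * ((b2 n - (a1 (Suc n) + b1 (Suc n) * p' n 0)) - (b2 n - (a1 (Suc n) + b1 (Suc n) * p' n (w n)))))"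
    by (intro sml_mult sml_diff sml_at[OF sml_row1] bddI[OF C, of 0]) (use w in auto)
  moreover have "1 / (p' n (w n) - p' n 0) * ((b2 n - (a1 (Suc n) + b1 (Suc n) * p' n 0)) - (b2 n - (a1 (Suc n) + b1 (Suc n) * p' n (w n)))) = b1 (Suc n)" for n
    using w(2)[of n] by (simp add: field_simps)
  ultimately show ?thesis by simp
qed

lemma sml_b2_a1: "sml (\<lambda>n v. a1 (Suc n) - b2 n)"
proof -
  have "sml (\<lambda>n v. - (b2 n - (a1 (Suc n) + b1 (Suc n) * p' n v)) - p' n v * b1 (Suc n))"
    by (intro sml_diff sml_minus sml_row1 sml_mult bdd_p' sml_b1)
  then show ?thesis by (simp add: algebra_simps)
qed

text \<open>By the first relation at the origin, \<open>a2 n\<close> is a bounded multiple of a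
  derivative that is close to \<open>b1 (Suc n)\<close>.\<close>

lemma sml_a2: "sml (\<lambda>n v. a2 n)"
proof -
  have "sml (\<lambda>n v. Dy (f1 n) (0, poly (p (n - 1)) 0) - b1 n)"
    by (rule sml_estimates(2)[of "\<lambda>n v. 0" A "\<lambda>n v. poly (p (n - 1)) 0"]) (use norm_p_le_A A in auto)
  from sml_add[OF sml_shift[OF this, of 1] sml_b1[unfolded Suc_eq_plus1]]
  have "sml (\<lambda>n v. Dy (f1 (Suc n)) (0, poly (p n) 0))" by simp
  from sml_minus[OF sml_mult[OF bdd_\<delta> this]]
  show ?thesis using deriv_rel(1)[of _ "(0, 0)"] by (simp add: a2_def H_def)
qed

lemma sml_shift': "sml X \<Longrightarrow> (\<And>n v. X (n + i) v = Y n v) \<Longrightarrow> sml Y"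
  using sml_shift[of X i] by presburger
lemma bdd_shift': "bdd X \<Longrightarrow> (\<And>n v. X (n + i) v = Y n v) \<Longrightarrow> bdd Y"
  using bdd_shift[of X i] by presburger

lemma bdd_scalarE:
  assumes "bdd (\<lambda>n v. x n)"
  obtains C m where "C \<ge> 0" "\<And>n. n \<ge> m \<Longrightarrow> norm (x n) \<le> C"
proof -
  obtain C m where "C \<ge> 0" "\<And>n v :: complex. n \<ge> m \<Longrightarrow> norm v \<le> 1 \<Longrightarrow> norm (x n) \<le> C"
    using assms unfolding bdd_def by blast
  then show ?thesis using that by (metis norm_zero zero_le_one)
qed

lemma sml_scalarE:
  assumes "sml (\<lambda>n v. x n)"
  obtains C m where "C \<ge> 0" "\<And>n. n \<ge> m \<Longrightarrow> norm (x n) \<le> C / T n"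
proof -
  obtain C m where "C \<ge> 0" "\<And>n v :: complex. n \<ge> m \<Longrightarrow> norm v \<le> 1 \<Longrightarrow> norm (x n) \<le> C / T n"
    using assms unfolding sml_def by blast
  then show ?thesis using that by (metis norm_zero zero_le_one)
qed

lemma per_2k: "p (n + 2 * k) = p n" "\<delta> (n + 2 * k) = \<delta> n"
proof -
  have "n + 2 * k = (n + k) + k" by simp
  then show "p (n + 2 * k) = p n" "\<delta> (n + 2 * k) = \<delta> n" using per by metis+
qed

lemma jac_F: "jac F z \<noteq> 0" "jac F z = jac F w"
  using jac_automorphism[OF F G GF] by auto

lemma jac_Fn: "a1 n * b2 n - b1 n * a2 n = jac F (0, 0)"
proof -
  have "jac (Fn n) (0, 0) = jac F (\<Psi> n (0, 0))"
    unfolding Fn_def[abs_def] jac_conj[OF F] using \<delta>_nz by simp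
  then show ?thesis using jac_F(2) by (simp add: jac_def a1_def a2_def b1_def b2_def f1_def[abs_def] f2_def[abs_def])
qed

text \<open>The Jacobian is a nonzero constant and its off-diagonal product tends to 0, so
  \<open>a1 n * b2 n\<close> stays away from 0 while \<open>a1 n\<close> is bounded.\<close>

lemma b2_bounded_below: "\<exists>\<kappa>>0. \<exists>m. \<forall>n\<ge>m. \<kappa> \<le> norm (b2 n)"
proof -
  define J where "J = norm (jac F (0, 0))"
  have J: "J > 0" using jac_F(1) by (simp add: J_def)
  have s: "sml (\<lambda>n v. a2 (Suc n) * b1 (Suc n))"
    using sml_mult[OF bdd_shift[OF bdd_coeffs(3), of 1] sml_b1] by simp
  have "J / 2 > 0" using J by simp
  from sml_arbitrarily_small[OF s this]
  obtain m where m: "\<And>n. n \<ge> m \<Longrightarrow> norm (a2 (Suc n) * b1 (Suc n)) < J / 2" by blast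
  obtain C m' where C: "C \<ge> 0" "\<And>n. n \<ge> m' \<Longrightarrow> norm (a1 n) \<le> C"
    using that by (rule bdd_scalarE[OF bdd_coeffs(1)])
  have "J / (2 * (C + 1)) \<le> norm (b2 n)" if n: "n \<ge> max (Suc m) m'" for n
  proof -
    obtain l where l: "n = Suc l" using n by (cases n) auto
    have 1: "norm (b1 n * a2 n) < J / 2" using m[of l] l n by (simp add: mult.commute)
    have "J \<le> norm (a1 n * b2 n) + norm (b1 n * a2 n)"
      unfolding J_def jac_Fn[of n, symmetric] by (rule norm_triangle_ineq4)
    then have "J / 2 \<le> norm (a1 n) * norm (b2 n)" using 1 by (simp add: norm_mult)
    also have "\<dots> \<le> (C + 1) * norm (b2 n)" using C(2)[of n] n by (intro mult_right_mono) auto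
    finally show ?thesis using C(1) by (simp add: field_simps)
  qed
  moreover have "J / (2 * (C + 1)) > 0" using J C(1) by simp
  ultimately show ?thesis by blast
qed

lemma bdd_inverse_b2: "bdd (\<lambda>n v. 1 / b2 n)"
proof -
  obtain \<kappa> m where \<kappa>: "\<kappa> > 0" "\<And>n. n \<ge> m \<Longrightarrow> \<kappa> \<le> norm (b2 n)" using b2_bounded_below by blast
  have "norm (1 / b2 n) \<le> 1 / \<kappa>" if "n \<ge> m" for n
    using \<kappa>(2)[OF that] \<kappa>(1) unfolding norm_divide norm_one by (intro divide_left_mono mult_pos_pos) linarith+
  then show ?thesis using \<kappa>(1) by (intro bddI[of "1 / \<kappa>" m]) auto
qed

lemma lipschitz_p': "\<exists>C\<ge>0. \<forall>n y z. norm y \<le> r \<longrightarrow> norm z \<le> r \<longrightarrow> norm (p' n y - p' n z) \<le> C * norm (y - z)"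
proof -
  have "\<exists>C. \<forall>n. C \<ge> 0 \<and> (\<forall>y z. norm y \<le> r \<longrightarrow> norm z \<le> r \<longrightarrow> norm (p' n y - p' n z) \<le> C * norm (y - z))"
    by (rule uniform_bound[of "\<lambda>q e C. C \<ge> 0 \<and> (\<forall>y z. norm y \<le> r \<longrightarrow> norm z \<le> r \<longrightarrow> norm (poly (pderiv q) y - poly (pderiv q) z) \<le> C * norm (y - z))"])
      (use poly_lipschitz in blast, meson mult_right_mono norm_ge_zero order_trans)
  then show ?thesis by blast
qed

lemma sml_p'_diff:
  assumes "bdd X" "bdd Y" "sml (\<lambda>n v. X n v - Y n v)"
  shows "sml (\<lambda>n v. p' (n + i) (X n v) - p' (n + i) (Y n v))"
proof -
  obtain C m where X: "C \<ge> 0" "\<And>n v. n \<ge> m \<Longrightarrow> norm v \<le> 1 \<Longrightarrow> norm (X n v) \<le> C" using assms(1) that by (rule bddE)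
  obtain C' m' where Y: "C' \<ge> 0" "\<And>n v. n \<ge> m' \<Longrightarrow> norm v \<le> 1 \<Longrightarrow> norm (Y n v) \<le> C'" using assms(2) that by (rule bddE)
  obtain e m'' where e: "e \<ge> 0" "\<And>n v. n \<ge> m'' \<Longrightarrow> norm v \<le> 1 \<Longrightarrow> norm (X n v - Y n v) \<le> e / T n"
    using assms(3) that by (rule smlE)
  obtain l where l: "l \<ge> 0" "\<And>n y z. norm y \<le> max C C' \<Longrightarrow> norm z \<le> max C C' \<Longrightarrow> norm (p' n y - p' n z) \<le> l * norm (y - z)"
    using lipschitz_p' by blast
  have "norm (p' (n + i) (X n v) - p' (n + i) (Y n v)) \<le> l * e / T n" if n: "n \<ge> max m (max m' m'')" and v: "norm v \<le> 1" for n v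
  proof -
    have "norm (p' (n + i) (X n v) - p' (n + i) (Y n v)) \<le> l * norm (X n v - Y n v)"
      using X(2)[of n v] Y(2)[of n v] n v by (intro l(2)) auto
    also have "\<dots> \<le> l * (e / T n)" using e(2)[of n v] l(1) n v by (intro mult_left_mono) auto
    finally show ?thesis by simp
  qed
  then show ?thesis using l(1) e(1) by (intro smlI[of "l * e" "max m (max m' m'')"]) auto
qed

lemma bdd_p'_at:
  assumes "bdd X" shows "bdd (\<lambda>n v. p' n (X n v))"
proof -
  obtain C m where X: "C \<ge> 0" "\<And>n v. n \<ge> m \<Longrightarrow> norm v \<le> 1 \<Longrightarrow> norm (X n v) \<le> C" using assms that by (rule bddE)
  have "\<exists>c. \<forall>n. \<forall>y. norm y \<le> C \<longrightarrow> norm (p' n y) \<le> c"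
    by (rule uniform_bound[of "\<lambda>q e c. \<forall>y. norm y \<le> C \<longrightarrow> norm (poly (pderiv q) y) \<le> c"])
      (use poly_bounded_on_disc in blast, meson order_trans)
  then obtain c where "\<And>n y. norm y \<le> C \<Longrightarrow> norm (p' n y) \<le> c" by blast
  then have "norm (p' n (X n v)) \<le> max c 0" if "n \<ge> m" "norm v \<le> 1" for n v
    using X(2)[OF that] by (simp add: max.coboundedI1)
  then show ?thesis by (intro bddI[of "max c 0" m]) auto
qed

lemma H_at: "H n (0, v) = (v, poly (p n) v)" by (simp add: H_def)

lemma norm_p_le_A': "norm v \<le> 1 \<Longrightarrow> norm v \<le> A \<and> norm (poly (p n) v) \<le> A"
  using norm_p_le_A[of v n] A by linarith

lemma sml_H:
  "sml (\<lambda>n v. Dx (f2 (Suc n)) (H n (0, v)) - a2 (Suc n))"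
  "sml (\<lambda>n v. Dy (f2 (Suc n)) (H n (0, v)) - b2 (Suc n))"
  "sml (\<lambda>n v. f1 (Suc n) (H n (0, v)) - (c1 (Suc n) + a1 (Suc n) * v + b1 (Suc n) * poly (p n) v))"
proof -
  have r: "norm v \<le> 1 \<Longrightarrow> norm v \<le> A \<and> norm (poly (p (n - 1)) v) \<le> A" for n v by (rule norm_p_le_A')
  show "sml (\<lambda>n v. Dx (f2 (Suc n)) (H n (0, v)) - a2 (Suc n))"
    using sml_shift[OF sml_estimates(3)[of "\<lambda>n v. v" A "\<lambda>n v. poly (p (n - 1)) v", OF r], of 1] by (simp add: H_at)
  show "sml (\<lambda>n v. Dy (f2 (Suc n)) (H n (0, v)) - b2 (Suc n))"
    using sml_shift[OF sml_estimates(4)[of "\<lambda>n v. v" A "\<lambda>n v. poly (p (n - 1)) v", OF r], of 1] by (simp add: H_at)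
  show "sml (\<lambda>n v. f1 (Suc n) (H n (0, v)) - (c1 (Suc n) + a1 (Suc n) * v + b1 (Suc n) * poly (p n) v))"
    using sml_shift[OF sml_estimates(5)[of "\<lambda>n v. v" A "\<lambda>n v. poly (p (n - 1)) v", OF r], of 1] by (simp add: H_at)
qed

text \<open>Otherwise the derivative of \<open>H n\<close> at \<open>Fn n (0, 0)\<close> would be too large for that of \<open>Fn (Suc n)\<close> to be bounded.\<close>

lemma bdd_c2: "bdd (\<lambda>n v. c2 n)"
proof -
  have 0: "norm (0::complex) \<le> 1" by simp
  have 1: "bdd (\<lambda>n v. Dx (f2 (Suc n)) (H n (0, 0)))"
    using bdd_of_sml_diff[OF sml_at[OF sml_H(1) 0] bdd_shift[OF bdd_coeffs(3), of 1, simplified]] .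
  have 2: "bdd (\<lambda>n v. Dy (f2 (Suc n)) (H n (0, 0)))"
    using bdd_of_sml_diff[OF sml_at[OF sml_H(2) 0] bdd_shift[OF bdd_coeffs(4), of 1, simplified]] .
  have 3: "bdd (\<lambda>n v. p' n 0)" by (rule bdd_p'_at[OF bdd_const])
  have 4: "p' n (c2 n) * b2 n = (Dx (f2 (Suc n)) (H n (0, 0)) + p' n 0 * Dy (f2 (Suc n)) (H n (0, 0))) + \<delta> n * b1 n" for n
    using deriv_rel(4)[of n "(0, 0)"] unfolding b1_def b2_def c2_def snd_conv by (simp add: algebra_simps)
  have "bdd (\<lambda>n v. p' n (c2 n) * b2 n)"
    unfolding 4 by (intro bdd_add bdd_mult 1 2 3 bdd_\<delta> bdd_coeffs)
  then obtain C m where C: "C \<ge> 0" "\<And>n. n \<ge> m \<Longrightarrow> norm (p' n (c2 n) * b2 n) \<le> C"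
    using that by (rule bdd_scalarE)
  obtain \<kappa> m' where \<kappa>: "\<kappa> > 0" "\<And>n. n \<ge> m' \<Longrightarrow> \<kappa> \<le> norm (b2 n)" using b2_bounded_below by blast
  have "\<exists>r. \<forall>n y. norm (p' n y) \<le> C / \<kappa> \<longrightarrow> norm y \<le> r"
    by (rule uniform_bound[of "\<lambda>q e r. \<forall>y. norm (poly (pderiv q) y) \<le> C / \<kappa> \<longrightarrow> norm y \<le> r"])
      (use poly_proper[OF degree_p'] in blast, meson order_trans)
  then obtain r where r: "\<And>n y. norm (p' n y) \<le> C / \<kappa> \<Longrightarrow> norm y \<le> r" by blast
  have "norm (c2 n) \<le> max r 0" if "n \<ge> max m m'" for n
  proof -
    have "norm (p' n (c2 n)) * \<kappa> \<le> norm (p' n (c2 n)) * norm (b2 n)" using \<kappa> that by (intro mult_left_mono) auto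
    also have "\<dots> \<le> C" using C(2)[of n] that by (simp add: norm_mult)
    finally have "norm (p' n (c2 n)) \<le> C / \<kappa>" using \<kappa>(1) by (simp add: field_simps)
    then show ?thesis using r by (simp add: max.coboundedI1)
  qed
  then show ?thesis by (intro bddI[of "max r 0" "max m m'"]) auto
qed

text \<open>The third relation at the origin: the term with \<open>a2\<close> is negligible, but
  only because \<open>c2\<close> is bounded.\<close>

lemma sml_a1_b2: "sml (\<lambda>n v. b2 (Suc n) - a1 n)"
proof -
  have 0: "norm (0::complex) \<le> 1" by simp
  have "sml (\<lambda>n v. - (Dy (f2 (Suc n)) (H n (0, 0)) - b2 (Suc n)) - 1 / \<delta> n * (p' n (c2 n) * a2 n))"
    by (intro sml_diff sml_minus sml_mult sml_at[OF sml_H(2) 0] inverse_\<delta>_bdd bdd_p'_at bdd_c2 sml_a2)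
  moreover have "- (Dy (f2 (Suc n)) (H n (0, 0)) - b2 (Suc n)) - 1 / \<delta> n * (p' n (c2 n) * a2 n) = b2 (Suc n) - a1 n" for n
    using deriv_rel(3)[of n "(0, 0)"] \<delta>_nz[of n] unfolding a1_def a2_def c2_def by (simp add: field_simps)
  ultimately show ?thesis by (simp only:)
qed

lemma sml_shift_even:
  assumes "sml (\<lambda>n v. x (Suc (Suc n)) - x n)"
  shows "sml (\<lambda>n v. x (n + 2 * j) - x n)"
proof (induction j)
  case 0 show ?case by (rule smlI[of 0 0]) auto
next
  case (Suc j)
  from sml_add[OF sml_shift[OF assms, of "2 * j"] Suc] show ?case by simp
qed

text \<open>A step turns \<open>b2\<close> into \<open>a1\<close> and \<open>a1\<close> into
  \<open>b2\<close>, so two steps return to the same entry; \<open>2 * k\<close> is even and also a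
  period of the factors.\<close>

lemma sml_period_a1: "sml (\<lambda>n v. a1 (n + 2 * k) - a1 n)"
proof -
  have "sml (\<lambda>n v. a1 (Suc (Suc n)) - b2 (Suc n))" by (rule sml_shift'[OF sml_b2_a1, of 1]) simp
  from sml_shift_even[OF sml_trans[OF this sml_a1_b2]] show ?thesis .
qed

lemma sml_period_b2: "sml (\<lambda>n v. b2 (n + 2 * k) - b2 n)"
proof -
  have "sml (\<lambda>n v. b2 (Suc (Suc n)) - a1 (Suc n))" by (rule sml_shift'[OF sml_a1_b2, of 1]) simp
  from sml_shift_even[OF sml_trans[OF this sml_b2_a1]] show ?thesis .
qed

lemma bdd_affine: "bdd (\<lambda>n v. c2 n + b2 n * v)"
proof -
  have "bdd (\<lambda>n v. v)" by (rule bddI[of 1 0]) auto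
  then show ?thesis by (intro bdd_add bdd_mult bdd_c2 bdd_coeffs)
qed

text \<open>The fourth relation at \<open>(0, v)\<close>, where \<open>f2 n\<close> is replaced by
  its affine part. All terms with \<open>a2\<close> or \<open>b1\<close> are negligible; the shift
  to \<open>n + 1\<close> is needed since \<open>sml_b1\<close> concerns
  \<open>b1 (Suc n)\<close>.\<close>

lemma sml_row2: "sml (\<lambda>n v. b2 (n + 2) * p' (n + 1) v - p' (n + 1) (c2 (n + 1) + b2 (n + 1) * v) * b2 (n + 1))"
proof -
  have r: "norm v \<le> 1 \<Longrightarrow> norm (0::complex) \<le> 1 \<and> norm v \<le> 1" for v :: complex by simp
  note est = sml_estimates[of "\<lambda>n v. 0" 1 "\<lambda>n v. v", OF r]
  have f2: "sml (\<lambda>n v. f2 n (0, v) - (c2 n + b2 n * v))" using est(6) by simp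
  have X: "bdd (\<lambda>n v. f2 n (0, v))" by (rule bdd_of_sml_diff[OF f2 bdd_affine])
  have A1: "sml (\<lambda>n v. Dx (f2 (Suc n)) (H n (0, v)))"
    using sml_add[OF sml_H(1) sml_shift[OF sml_a2, of 1]] by simp
  note A2 = sml_mult[OF bdd_p' sml_H(2)]
  note A3 = sml_mult[OF bdd_\<delta> est(2)]
  note A4 = sml_mult[OF bdd_p'_at[OF X] est(4)]
  note A5 = sml_mult[OF bdd_coeffs(4) sml_p'_diff[OF X bdd_affine f2, of 0, unfolded add_0_right]]
  have "- Dx (f2 (Suc n)) (H n (0, v))
      - p' n v * (Dy (f2 (Suc n)) (H n (0, v)) - b2 (Suc n))
      - \<delta> n * (Dy (f1 n) (0, v) - b1 n)
      + p' n (f2 n (0, v)) * (Dy (f2 n) (0, v) - b2 n)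
      + b2 n * (p' n (f2 n (0, v)) - p' n (c2 n + b2 n * v)) =
      b2 (Suc n) * p' n v - p' n (c2 n + b2 n * v) * b2 n + \<delta> n * b1 n" for n v
    using deriv_rel(4)[of n "(0, v)"] by (simp add: algebra_simps)
  with sml_add[OF sml_add[OF sml_diff[OF sml_diff[OF sml_minus[OF A1] A2] A3] A4] A5]
  have "sml (\<lambda>n v. b2 (Suc n) * p' n v - p' n (c2 n + b2 n * v) * b2 n + \<delta> n * b1 n)" by (simp only:)
  from sml_diff[OF sml_shift[OF this, of 1] sml_mult[OF bdd_shift[OF bdd_\<delta>, of 1] sml_b1]]
  show ?thesis by simp
qed

text \<open>By \<open>f1_H\<close>, \<open>c2 n\<close> is the value of \<open>f1 (Suc n)\<close> at
  \<open>H n (0, 0)\<close>, whose first coordinate is 0; the second contributes only through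
  \<open>b1 (Suc n)\<close>.\<close>

lemma sml_c1: "sml (\<lambda>n v. c1 (Suc n) - c2 n)"
proof -
  have 0: "norm (0::complex) \<le> 1" by simp
  have "sml (\<lambda>n v. - (f1 (Suc n) (H n (0, 0)) - (c1 (Suc n) + a1 (Suc n) * 0 + b1 (Suc n) * poly (p n) 0)) - poly (p n) 0 * b1 (Suc n))"
    using norm_p_le_A[of 0] A by (intro sml_diff sml_minus sml_mult sml_at[OF sml_H(3) 0] sml_b1 bddI[of A 0]) auto
  then show ?thesis by (simp add: f1_H c2_def)
qed

text \<open>The relation \<open>sml_row2\<close> at times differing by \<open>2 * k\<close> involves
  the same polynomial and nearly the same \<open>b2\<close>. Hence \<open>p'\<close> nearly agrees
  on two translates of one disc, of radius bounded below, and \<open>shift_determined\<close> makes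
  the translates close.\<close>

lemma sml_period_c2: "sml (\<lambda>n v. c2 (n + 1 + 2 * k) - c2 (n + 1))"
proof -
  let ?d = "\<lambda>n. c2 (n + 1 + 2 * k)" and ?b = "\<lambda>n. b2 (n + 1 + 2 * k)"
  have vb: "bdd (\<lambda>n v. v)" by (rule bddI[of 1 0]) auto
  have pb: "sml (\<lambda>n v. ?b n - b2 (n + 1))" by (rule sml_shift'[OF sml_period_b2, of 1]) (simp add: add_ac)
  have bb: "bdd (\<lambda>n v. b2 (n + 1))" using bdd_shift[OF bdd_coeffs(4), of 1] .
  have bb': "bdd (\<lambda>n v. ?b n)" by (rule bdd_shift'[OF bdd_coeffs(4), of "1 + 2 * k"]) (simp add: add_ac)
  have db: "bdd (\<lambda>n v. ?d n)" by (rule bdd_shift'[OF bdd_c2, of "1 + 2 * k"]) (simp add: add_ac)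
  have pp: "p (Suc (n + 2 * k)) = p (Suc n)" for n using per_2k(1)[of "Suc n"] by simp
  have r1: "sml (\<lambda>n v. b2 (n + 2 + 2 * k) * p' (n + 1) v - p' (n + 1) (?d n + ?b n * v) * ?b n)"
    by (rule sml_shift'[OF sml_row2, of "2 * k"]) (simp add: add_ac pp)
  have r2: "sml (\<lambda>n v. b2 (n + 2 + 2 * k) - b2 (n + 2))" by (rule sml_shift'[OF sml_period_b2, of 2]) (simp add: add_ac)
  have bp: "bdd (\<lambda>n v. p' (n + 1) v)" using bdd_shift[OF bdd_p', of 1] .
  have bpd: "bdd (\<lambda>n v. p' (n + 1) (?d n + ?b n * v))"
    by (rule bdd_shift'[OF bdd_p'_at[OF bdd_affine], of "1 + 2 * k"]) (simp add: add_ac pp)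
  have aff: "sml (\<lambda>n v. (?d n + ?b n * v) - (?d n + b2 (n + 1) * v))"
    using sml_mult[OF vb pb] by (simp add: algebra_simps)
  have m1: "sml (\<lambda>n v. p' (n + 1) (?d n + ?b n * v) - p' (n + 1) (?d n + b2 (n + 1) * v))"
    by (intro sml_p'_diff aff bdd_add bdd_mult db bb bb' vb)
  \<comment> \<open>The later instance of \<open>sml_row2\<close> minus the earlier one, with every
    later \<open>b2\<close> replaced by the earlier one.\<close>
  have eq: "(b2 (n + 2 + 2 * k) * p' (n + 1) v - p' (n + 1) (?d n + ?b n * v) * ?b n)
      - p' (n + 1) v * (b2 (n + 2 + 2 * k) - b2 (n + 2))
      - (b2 (n + 2) * p' (n + 1) v - p' (n + 1) (c2 (n + 1) + b2 (n + 1) * v) * b2 (n + 1))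
      + p' (n + 1) (?d n + ?b n * v) * (?b n - b2 (n + 1))
      + b2 (n + 1) * (p' (n + 1) (?d n + ?b n * v) - p' (n + 1) (?d n + b2 (n + 1) * v))
      = b2 (n + 1) * (p' (n + 1) (c2 (n + 1) + b2 (n + 1) * v) - p' (n + 1) (?d n + b2 (n + 1) * v))" for n v
    by (simp only: algebra_simps)
  from sml_add[OF sml_add[OF sml_diff[OF sml_diff[OF r1 sml_mult[OF bp r2]] sml_row2] sml_mult[OF bpd pb]] sml_mult[OF bb m1]]
  have "sml (\<lambda>n v. b2 (n + 1) * (p' (n + 1) (c2 (n + 1) + b2 (n + 1) * v) - p' (n + 1) (?d n + b2 (n + 1) * v)))"
    unfolding eq .
  from sml_mult[OF bdd_shift[OF bdd_inverse_b2, of 1] this]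
  obtain C m where C: "C \<ge> 0" "\<And>n v. n \<ge> m \<Longrightarrow> norm v \<le> 1 \<Longrightarrow> norm (1 / b2 (n + 1) *
      (b2 (n + 1) * (p' (n + 1) (c2 (n + 1) + b2 (n + 1) * v) - p' (n + 1) (?d n + b2 (n + 1) * v)))) \<le> C / T n"
    using that by (rule smlE)
  obtain \<kappa> m' where \<kappa>: "\<kappa> > 0" "\<And>n. n \<ge> m' \<Longrightarrow> \<kappa> \<le> norm (b2 n)" using b2_bounded_below by blast
  \<comment> \<open>The absolute value makes the statement monotone in \<open>C\<close>, as
    \<open>uniform_bound\<close> demands.\<close>
  have "\<exists>C. \<forall>n. C \<ge> 0 \<and> (\<forall>x y t M. \<kappa> \<le> norm t \<longrightarrow> (\<forall>v. norm v \<le> 1 \<longrightarrow> norm (p' n (x + t * v) - p' n (y + t * v)) \<le> M)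
     \<longrightarrow> norm (x - y) \<le> C * \<bar>M\<bar>)"
    by (rule uniform_bound[of "\<lambda>q e C. C \<ge> 0 \<and> (\<forall>x y t M. \<kappa> \<le> norm t \<longrightarrow> (\<forall>v. norm v \<le> 1 \<longrightarrow> norm (poly (pderiv q) (x + t * v) - poly (pderiv q) (y + t * v)) \<le> M)
     \<longrightarrow> norm (x - y) \<le> C * \<bar>M\<bar>)"])
      (use shift_determined[OF degree_p' _ \<kappa>(1), of 1] in \<open>meson zero_less_one abs_ge_self mult_left_mono order_trans\<close>,
       meson mult_right_mono abs_ge_zero order_trans)
  then obtain C' where C': "C' \<ge> 0" "\<And>n x y t M. \<kappa> \<le> norm t \<Longrightarrow> (\<And>v. norm v \<le> 1 \<Longrightarrow> norm (p' n (x + t * v) - p' n (y + t * v)) \<le> M)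
     \<Longrightarrow> norm (x - y) \<le> C' * \<bar>M\<bar>" by blast
  have "norm (?d n - c2 (n + 1)) \<le> C' * C / T n" if n: "n \<ge> max m m'" for n
  proof -
    have b: "\<kappa> \<le> norm (b2 (n + 1))" using \<kappa>(2)[of "n + 1"] n by simp
    then have nz: "b2 (n + 1) \<noteq> 0" using \<kappa>(1) by auto
    have "norm (p' (n + 1) (c2 (n + 1) + b2 (n + 1) * v) - p' (n + 1) (?d n + b2 (n + 1) * v)) \<le> C / T n"
      if v: "norm v \<le> 1" for v
      using C(2)[of n v] n v nz by simp
    from C'(2)[OF b this] have "norm (c2 (n + 1) - ?d n) \<le> C' * \<bar>C / T n\<bar>" .
    then show ?thesis using C(1) by (simp add: norm_minus_commute)
  qed
  then show ?thesis using C C' by (intro smlI[of "C' * C" "max m m'"]) auto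
qed

lemma sml_period_c1: "sml (\<lambda>n v. c1 (n + 2 + 2 * k) - c1 (n + 2))"
proof -
  have "sml (\<lambda>n v. (c1 (n + 2 + 2 * k) - c2 (n + 1 + 2 * k)) + (c2 (n + 1 + 2 * k) - c2 (n + 1)) - (c1 (n + 2) - c2 (n + 1)))"
    by (intro sml_add[OF sml_add sml_minus, unfolded add_uminus_conv_diff] sml_period_c2
        sml_shift'[OF sml_c1, of "1 + 2 * k"] sml_shift'[OF sml_c1, of 1]) (simp_all add: add_ac)
  then show ?thesis by simp
qed

text \<open>The affine parts differ by order \<open>1 / T n\<close> in each coefficient, the
  remainders are at most \<open>K6 * r ^ 2 / T n\<close>, and \<open>r \<ge> 1\<close> lets
  \<open>r ^ 2\<close> dominate all. The radius may grow with \<open>n\<close>, which is needed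
  along orbits; the offset 2 comes from the shifts in the relations for the coefficients.\<close>

lemma period_close:
  "\<exists>C\<ge>0. \<exists>m. \<forall>n\<ge>m. \<forall>r u v. 1 \<le> r \<longrightarrow> r \<le> T (n + 2) / (4 * K) \<longrightarrow> norm u \<le> r \<longrightarrow> norm v \<le> r \<longrightarrow>
     norm (f1 (n + 2 + 2 * k) (u, v) - f1 (n + 2) (u, v)) \<le> C * r\<^sup>2 / T n \<and>
     norm (f2 (n + 2 + 2 * k) (u, v) - f2 (n + 2) (u, v)) \<le> C * r\<^sup>2 / T n"
proof -
  have key: "\<exists>C\<ge>0. \<exists>m. \<forall>n\<ge>m. \<forall>r u v. 1 \<le> r \<longrightarrow> r \<le> T (n + 2) / (4 * K) \<longrightarrow> norm u \<le> r \<longrightarrow> norm v \<le> r \<longrightarrow>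
     norm (f (n + 2 + 2 * k) (u, v) - f (n + 2) (u, v)) \<le> C * r\<^sup>2 / T n"
    if f: "f = f1 \<or> f = f2"
      and s1: "sml (\<lambda>n v. f (n + 2 + 2 * k) (0, 0) - f (n + 2) (0, 0))"
      and s2: "sml (\<lambda>n v. Dx (f (n + 2 + 2 * k)) (0, 0) - Dx (f (n + 2)) (0, 0))"
      and s3: "sml (\<lambda>n v. Dy (f (n + 2 + 2 * k)) (0, 0) - Dy (f (n + 2)) (0, 0))" for f
  proof -
    obtain C1 m1 where C1: "C1 \<ge> 0" "\<And>n. n \<ge> m1 \<Longrightarrow> norm (f (n + 2 + 2 * k) (0, 0) - f (n + 2) (0, 0)) \<le> C1 / T n"
      using that by (rule sml_scalarE[OF s1])
    obtain C2 m2 where C2: "C2 \<ge> 0" "\<And>n. n \<ge> m2 \<Longrightarrow> norm (Dx (f (n + 2 + 2 * k)) (0, 0) - Dx (f (n + 2)) (0, 0)) \<le> C2 / T n"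
      using that by (rule sml_scalarE[OF s2])
    obtain C3 m3 where C3: "C3 \<ge> 0" "\<And>n. n \<ge> m3 \<Longrightarrow> norm (Dy (f (n + 2 + 2 * k)) (0, 0) - Dy (f (n + 2)) (0, 0)) \<le> C3 / T n"
      using that by (rule sml_scalarE[OF s3])
    define C where "C = K6 + K6 + C1 + C2 + C3"
    have "norm (f (n + 2 + 2 * k) (u, v) - f (n + 2) (u, v)) \<le> C * r\<^sup>2 / T n"
      if n: "n \<ge> Max {m1, m2, m3, n1}" and r: "1 \<le> r" "r \<le> T (n + 2) / (4 * K)" and u: "norm u \<le> r" "norm v \<le> r" for n r u v
    proof -
      have n': "n \<ge> m1" "n \<ge> m2" "n \<ge> m3" "n + 2 \<ge> n1" "n + 2 + 2 * k \<ge> n1" using n by auto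
      define g where "g = f (n + 2 + 2 * k)"
      define h where "h = f (n + 2)"
      have "T (n + 2) / (4 * K) \<le> T (n + 2 + 2 * k) / (4 * K)" using K T_mono[of "n + 2" "n + 2 + 2 * k"] by (intro divide_right_mono) auto
      then have r': "r \<le> T (n + 2 + 2 * k) / (4 * K)" using r by linarith
      have e1: "norm (h (u, v) - (h (0, 0) + Dx h (0, 0) * u + Dy h (0, 0) * v)) \<le> K6 * r\<^sup>2 / T (n + 2)"
        unfolding h_def by (rule estimates(5)[OF n'(4) _ u r(2)]) (use f in auto)
      have e2: "norm (g (u, v) - (g (0, 0) + Dx g (0, 0) * u + Dy g (0, 0) * v)) \<le> K6 * r\<^sup>2 / T (n + 2 + 2 * k)"
        unfolding g_def by (rule estimates(5)[OF n'(5) _ u r']) (use f in auto)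
      have tT: "K6 * r\<^sup>2 / T (n + i) \<le> K6 * r\<^sup>2 / T n" for i
        using K6 T_mono[of n "n + i"] by (intro divide_left_mono) auto
      have rr: "r \<le> r\<^sup>2" "1 \<le> r\<^sup>2" using self_le_power[OF r(1), of 2] one_le_power[OF r(1), of 2] by auto
      have d1: "norm (g (0, 0) - h (0, 0)) \<le> C1 * r\<^sup>2 / T n"
        using C1(2)[of n] n' order_trans[OF _ divide_right_mono[OF mult_left_mono[OF rr(2) C1(1)], of "T n"]]
        unfolding g_def h_def by auto
      have dd: "norm (x * w) \<le> c * r\<^sup>2 / T n" if "norm x \<le> c / T n" "norm w \<le> r" "c \<ge> 0" for x w :: complex and c
      proof -
        have "norm (x * w) \<le> c / T n * r\<^sup>2"
          unfolding norm_mult using that rr by (intro mult_mono) auto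
        then show ?thesis by simp
      qed
      have d2: "norm ((Dx g (0, 0) - Dx h (0, 0)) * u) \<le> C2 * r\<^sup>2 / T n"
        using C2 n' u unfolding g_def h_def by (intro dd C2(2)[of n]) auto
      have d3: "norm ((Dy g (0, 0) - Dy h (0, 0)) * v) \<le> C3 * r\<^sup>2 / T n"
        using C3 n' u unfolding g_def h_def by (intro dd C3(2)[of n]) auto
      have split: "g (u, v) - h (u, v) = (g (u, v) - (g (0, 0) + Dx g (0, 0) * u + Dy g (0, 0) * v))
        - (h (u, v) - (h (0, 0) + Dx h (0, 0) * u + Dy h (0, 0) * v))
        + (g (0, 0) - h (0, 0)) + (Dx g (0, 0) - Dx h (0, 0)) * u + (Dy g (0, 0) - Dy h (0, 0)) * v"
        by (simp add: algebra_simps)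
      have "norm (g (u, v) - h (u, v)) \<le> K6 * r\<^sup>2 / T n + K6 * r\<^sup>2 / T n + C1 * r\<^sup>2 / T n + C2 * r\<^sup>2 / T n + C3 * r\<^sup>2 / T n"
      proof -
        have tri: "norm (x - y + z + w + s) \<le> norm x + norm y + norm z + norm w + norm s" for x y z w s :: complex
          using norm_triangle_ineq4[of x y] norm_triangle_ineq[of "x - y" z] norm_triangle_ineq[of "x - y + z" w]
            norm_triangle_ineq[of "x - y + z + w" s] by linarith
        have "K6 * r\<^sup>2 / T (n + 2 + 2 * k) \<le> K6 * r\<^sup>2 / T n" using tT[of "2 + 2 * k"] by (simp only: add.assoc)
        then show ?thesis
          using e1 e2 tT[of 2] d1 d2 d3
            tri[of "g (u, v) - (g (0, 0) + Dx g (0, 0) * u + Dy g (0, 0) * v)"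
              "h (u, v) - (h (0, 0) + Dx h (0, 0) * u + Dy h (0, 0) * v)"
              "g (0, 0) - h (0, 0)" "(Dx g (0, 0) - Dx h (0, 0)) * u" "(Dy g (0, 0) - Dy h (0, 0)) * v"]
          unfolding split by linarith
      qed
      then show ?thesis by (simp add: C_def g_def h_def algebra_simps add_divide_distrib)
    qed
    moreover have "C \<ge> 0" using C1 C2 C3 K6 by (simp add: C_def)
    ultimately show ?thesis by blast
  qed
  have b1: "sml (\<lambda>n v. b1 (n + 2 + 2 * k) - b1 (n + 2))"
    by (intro sml_diff sml_shift'[OF sml_b1, of "1 + 2 * k"] sml_shift'[OF sml_b1, of 1]) (simp_all add: add_ac)
  have a2: "sml (\<lambda>n v. a2 (n + 2 + 2 * k) - a2 (n + 2))"
    by (intro sml_diff sml_shift'[OF sml_a2, of "2 + 2 * k"] sml_shift'[OF sml_a2, of 2]) (simp_all add: add_ac)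
  have a1: "sml (\<lambda>n v. a1 (n + 2 + 2 * k) - a1 (n + 2))" by (rule sml_shift'[OF sml_period_a1, of 2]) (simp add: add_ac)
  have b2: "sml (\<lambda>n v. b2 (n + 2 + 2 * k) - b2 (n + 2))" by (rule sml_shift'[OF sml_period_b2, of 2]) (simp add: add_ac)
  have c2: "sml (\<lambda>n v. c2 (n + 2 + 2 * k) - c2 (n + 2))" by (rule sml_shift'[OF sml_period_c2, of 1]) (simp add: add_ac)
  obtain C m where C: "C \<ge> 0" "\<forall>n\<ge>m. \<forall>r u v. 1 \<le> r \<longrightarrow> r \<le> T (n + 2) / (4 * K) \<longrightarrow> norm u \<le> r \<longrightarrow> norm v \<le> r \<longrightarrow>
     norm (f1 (n + 2 + 2 * k) (u, v) - f1 (n + 2) (u, v)) \<le> C * r\<^sup>2 / T n"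
    using key[of f1] sml_period_c1 a1 b1 unfolding c1_def a1_def b1_def by blast
  obtain C' m' where C': "C' \<ge> 0" "\<forall>n\<ge>m'. \<forall>r u v. 1 \<le> r \<longrightarrow> r \<le> T (n + 2) / (4 * K) \<longrightarrow> norm u \<le> r \<longrightarrow> norm v \<le> r \<longrightarrow>
     norm (f2 (n + 2 + 2 * k) (u, v) - f2 (n + 2) (u, v)) \<le> C' * r\<^sup>2 / T n"
    using key[of f2] c2 a2 b2 unfolding c2_def a2_def b2_def by blast
  have mono: "C * r\<^sup>2 / T n \<le> max C C' * r\<^sup>2 / T n" "C' * r\<^sup>2 / T n \<le> max C C' * r\<^sup>2 / T n" for r n
    by (intro divide_right_mono mult_right_mono; simp)+
  show ?thesis
    using C C' by (intro exI[of _ "max C C'"] conjI exI[of _ "max m m'"]) (auto intro: order_trans[OF _ mono(1)] order_trans[OF _ mono(2)])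
qed

section \<open>Coincidence of conjugates that are a period apart\<close>

lemma bdd_c1_Suc: "bdd (\<lambda>n v. c1 (Suc n))"
  by (rule bdd_of_sml_diff[OF sml_c1 bdd_c2])

lemma H_2k: "H (n + 2 * k) = H n" using per_2k by (simp add: H_def)

lemma Fn_W: "Fn (q + j) (W q j w) = W q j (Fn q w)"
  by (induction j) (simp_all add: Fn_H)

lemma Fn_W_2k: "Fn (q + 2 * k + j) (W q j w) = W q j (Fn (q + 2 * k) w)"
proof (induction j)
  case (Suc j)
  have h: "H (q + j) = H (q + 2 * k + j)" using H_2k[of "q + j"] by (simp add: add_ac)
  have "Fn (q + 2 * k + Suc j) (W q (Suc j) w) = Fn (Suc (q + 2 * k + j)) (H (q + 2 * k + j) (W q j w))"
    by (simp add: h)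
  also have "\<dots> = H (q + 2 * k + j) (W q j (Fn (q + 2 * k) w))" by (simp only: Fn_H Suc)
  finally show ?case by (simp add: h)
qed simp

text \<open>The images of the origin are bounded and the derivatives are at most
  \<open>2 * K ^ 2\<close>, so the image of the unit bidisc is bounded independently of
  \<open>n\<close>.\<close>

lemma N_Fn_bounded: "\<exists>Q\<ge>R. \<exists>m. \<forall>n\<ge>m. \<forall>w. cn w \<le> 1 \<longrightarrow> N (Fn n w) \<le> Q"
proof -
  obtain C1 m1 where C1: "C1 \<ge> 0" "\<And>n. n \<ge> m1 \<Longrightarrow> norm (c1 (Suc n)) \<le> C1"
    using that by (rule bdd_scalarE[OF bdd_c1_Suc])
  obtain C2 m2 where C2: "C2 \<ge> 0" "\<And>n. n \<ge> m2 \<Longrightarrow> norm (c2 n) \<le> C2"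
    using that by (rule bdd_scalarE[OF bdd_c2])
  obtain m3 where m3: "\<And>n. n \<ge> m3 \<Longrightarrow> n \<ge> n1 \<and> 1 \<le> T n / (4 * K)" using T_large by blast
  define Q where "Q = max R (C1 + C2 + 4 * K\<^sup>2)"
  have "N (Fn n w) \<le> Q" if n: "n \<ge> max (Suc m1) (max m2 m3)" and w: "cn w \<le> 1" for n w
  proof -
    obtain u v where uv: "w = (u, v)" by (cases w)
    have u: "norm u \<le> 1" "norm v \<le> 1" using w by (auto simp: cn_def uv)
    have n1: "n \<ge> n1" "1 \<le> T n / (4 * K)" using m3[of n] n by auto
    have b: "norm (f (u, v) - f (0, 0)) \<le> 4 * K\<^sup>2" if f: "f = f1 n \<or> f = f2 n" for f
    proof -
      have "norm (f (u, v) - f (0, 0)) \<le> 2 * K\<^sup>2 * (norm (u - 0) + norm (v - 0))"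
        using u by (intro bidisc_lipschitz[of _ 1] estimates(1,2)[OF n1(1) f _ _ n1(2)]) (use f poly_fun_f12 in auto)
      also have "\<dots> \<le> 2 * K\<^sup>2 * (1 + 1)" using u by (intro mult_left_mono add_mono) auto
      finally show ?thesis by simp
    qed
    obtain i where "n = Suc i" using n by (cases n) auto
    then have "norm (c1 n) \<le> C1" using C1(2)[of i] n by simp
    moreover have "norm (c2 n) \<le> C2" using C2(2)[of n] n by simp
    ultimately have "norm (f1 n w) \<le> C1 + 4 * K\<^sup>2" "norm (f2 n w) \<le> C2 + 4 * K\<^sup>2"
      using b[of "f1 n"] b[of "f2 n"] norm_triangle_sub[of "f1 n (u, v)" "f1 n (0, 0)"]
        norm_triangle_sub[of "f2 n (u, v)" "f2 n (0, 0)"] unfolding c1_def c2_def uv by auto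
    then show ?thesis unfolding N_eq Fn_eq fst_conv snd_conv Q_def using C1(1) C2(1) by linarith
  qed
  moreover have "Q \<ge> R" by (simp add: Q_def)
  ultimately show ?thesis by blast
qed

text \<open>Both conjugates map a given orbit to orbits of the same maps. After \<open>j\<close> steps these differ by at most a power
with exponent \<open>E q (q + j)\<close> of a quantity that is small for large \<open>q\<close>, while going back \<open>j\<close> steps costs only such a power
of a constant independent of \<open>q\<close>.\<close>

lemma Fn_period_eventually: "\<exists>m. \<forall>q\<ge>m. Fn (q + 2 * k) = Fn q"
proof -
  obtain Q m0 where Q: "Q \<ge> R" "\<And>n w. n \<ge> m0 \<Longrightarrow> cn w \<le> 1 \<Longrightarrow> N (Fn n w) \<le> Q"
    using N_Fn_bounded by blast
  obtain \<Lambda> where \<Lambda>: "\<Lambda> \<ge> 1" "\<And>n z w Y. N z \<le> Y \<Longrightarrow> N w \<le> Y \<Longrightarrow> cn (z - w) \<le> \<Lambda> * Y ^ d n * cn (H n z - H n w)"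
    using backward_lipschitz by blast
  obtain C m1 where C: "C \<ge> 0" "\<And>n r u v. \<lbrakk>n \<ge> m1; 1 \<le> r; r \<le> T (n + 2) / (4 * K); norm u \<le> r; norm v \<le> r\<rbrakk> \<Longrightarrow>
     norm (f1 (n + 2 + 2 * k) (u, v) - f1 (n + 2) (u, v)) \<le> C * r\<^sup>2 / T n \<and>
     norm (f2 (n + 2 + 2 * k) (u, v) - f2 (n + 2) (u, v)) \<le> C * r\<^sup>2 / T n"
    using period_close by blast
  obtain dm where dm: "dm \<ge> 2" "\<And>n. d n \<le> dm" using degree_bounded by blast
  define M where "M = B * Q"
  have M: "M \<ge> 1" using mult_mono[of 1 B 1 Q] Q(1) R2 B2 by (auto simp: M_def)
  \<comment> \<open>The first factor is the base of the loss in going back, the second that of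
    \<open>r ^ 2\<close> in \<open>period_close\<close>. The condition \<open>S \<ge> 2 * V\<close>
    then leaves a ratio of one half.\<close>
  define V where "V = (\<Lambda> * M)\<^sup>2 * M\<^sup>2"
  have LM: "\<Lambda> * M \<ge> 1" using mult_mono[of 1 \<Lambda> 1 M] \<Lambda>(1) M by auto
  have V: "V \<ge> 1" using mult_mono[of 1 "(\<Lambda> * M)\<^sup>2" 1 "M\<^sup>2"] one_le_power[OF LM, of 2] one_le_power[OF M, of 2] by (auto simp: V_def)
  obtain m2 where m2: "\<And>n. n \<ge> m2 \<Longrightarrow> T n \<ge> max (4 * K * M) ((2 * V) ^ (dm * dm))" using T_unbounded by blast
  have eq: "Fn (q + 2 * k) w = Fn q w" if q: "q \<ge> max m0 (max (m1 + 2) m2)" and w: "cn w \<le> 1" for q w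
  proof -
    define e where "e j = E q (q + j)" for j
    \<comment> \<open>\<open>period_close\<close> divides by \<open>T i\<close> two steps before
      time \<open>q + j\<close>. Two steps raise to at most the power \<open>dm * dm\<close>, so
      this root of \<open>T q\<close> still satisfies \<open>S ^ e j \<le> T i\<close>.\<close>
    define S where "S = root (dm * dm) (T q)"
    have dd: "dm * dm > 0" using dm(1) by simp
    have S: "S \<ge> 2 * V" "S > 0"
    proof -
      have "2 * V = root (dm * dm) ((2 * V) ^ (dm * dm))" using V dd by (intro real_root_power_cancel[symmetric]) auto
      also have "\<dots> \<le> S" unfolding S_def using m2[of q] q dd by (intro real_root_le_mono) auto
      finally show "S \<ge> 2 * V" .
      then show "S > 0" using V by simp
    qed
    have SdT: "S ^ (dm * dm) = T q" unfolding S_def using dd by simp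
    have Nw: "N w \<le> Q" using w Q(1) R2 by (auto simp: N_eq cn_def)
    define x y where "x = Fn q w" and "y = Fn (q + 2 * k) w"
    have Nx: "N x \<le> Q" "N y \<le> Q" using Q(2) q w by (auto simp: x_def y_def)
    define \<Delta> where "\<Delta> j = cn (W q j x - W q j y)" for j
    have NW: "N (W q j z) \<le> M ^ e j" if "N z \<le> Q" for z j
      using N_W_le[OF that] by (simp add: M_def e_def)
    \<comment> \<open>The steps back cost exponents \<open>e 1\<close> to \<open>e j\<close>; since
      \<open>e\<close> at least doubles, their sum is at most \<open>2 * e j\<close>.\<close>
    have step: "\<Delta> 0 \<le> (\<Lambda> * M) ^ (2 * e j) * \<Delta> j" for j
    proof (induction j)
      case 0
      have "1 * \<Delta> 0 \<le> (\<Lambda> * M) ^ (2 * e 0) * \<Delta> 0"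
        using LM by (intro mult_right_mono one_le_power) (auto simp: \<Delta>_def cn_nonneg)
      then show ?case by simp
    next
      case (Suc j)
      have \<Delta>0: "\<Delta> (Suc j) \<ge> 0" by (simp add: \<Delta>_def cn_nonneg)
      have "\<Delta> j \<le> \<Lambda> * (M ^ e j) ^ d (q + j) * \<Delta> (Suc j)"
        unfolding \<Delta>_def W.simps by (rule \<Lambda>(2)) (use NW Nx in auto)
      also have "(M ^ e j) ^ d (q + j) = M ^ e (Suc j)" unfolding e_def E_Suc by (simp add: power_mult)
      also have "\<Lambda> * M ^ e (Suc j) * \<Delta> (Suc j) \<le> (\<Lambda> * M) ^ e (Suc j) * \<Delta> (Suc j)"
        using \<Lambda>(1) M E_pos[of q "q + Suc j"] \<Delta>0 unfolding power_mult_distrib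
        by (intro mult_right_mono self_le_power) (auto simp: e_def)
      finally have "(\<Lambda> * M) ^ (2 * e j) * \<Delta> j \<le> (\<Lambda> * M) ^ (2 * e j) * ((\<Lambda> * M) ^ e (Suc j) * \<Delta> (Suc j))"
        using LM by (intro mult_left_mono) auto
      also have "\<dots> = (\<Lambda> * M) ^ (2 * e j + e (Suc j)) * \<Delta> (Suc j)" by (simp add: power_add)
      also have "\<dots> \<le> (\<Lambda> * M) ^ (2 * e (Suc j)) * \<Delta> (Suc j)"
        using LM E_Suc_ge[of q j] \<Delta>0 by (intro mult_right_mono power_increasing) (auto simp: e_def)
      finally show ?case using Suc by linarith
    qed
    have small: "\<Delta> j \<le> C * (M\<^sup>2 / S) ^ e j" for j
    proof -
      define r where "r = M ^ e j"
      have r1: "r \<ge> 1" using M by (simp add: r_def)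
      have cw: "cn (W q j w) \<le> r" using NW[OF Nw, of j] by (auto simp: r_def N_eq cn_def)
      have Tqj: "T (q + j) = T q ^ e j"
        unfolding T_def e_def using D_E[of q "q + j"] by (simp add: exp_of_nat_mult[symmetric] mult_ac flip: of_nat_mult)
      have "4 * K * M ^ e j \<le> (4 * K) ^ e j * M ^ e j"
        using K M E_pos[of q "q + j"] by (intro mult_right_mono self_le_power) (auto simp: e_def)
      also have "\<dots> \<le> T q ^ e j" unfolding power_mult_distrib[symmetric]
        using m2[of q] q K M by (intro power_mono) auto
      finally have "r \<le> T (q + j) / (4 * K)" unfolding Tqj r_def using K by (simp add: field_simps)
      moreover obtain i where i: "q + j = i + 2" "i \<ge> m1" using q by (intro that[of "q + j - 2"]) auto
      moreover obtain a b where ab: "W q j w = (a, b)" by (cases "W q j w")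
      ultimately have "norm (f1 (q + j + 2 * k) (a, b) - f1 (q + j) (a, b)) \<le> C * r\<^sup>2 / T i \<and>
         norm (f2 (q + j + 2 * k) (a, b) - f2 (q + j) (a, b)) \<le> C * r\<^sup>2 / T i"
        using C(2)[of i r a b] r1 cw by (simp add: cn_def)
      then have "cn (Fn (q + j + 2 * k) (W q j w) - Fn (q + j) (W q j w)) \<le> C * r\<^sup>2 / T i"
        by (simp add: cn_def Fn_eq ab)
      moreover have "Fn (q + j + 2 * k) (W q j w) = W q j y" using Fn_W_2k[of q j w] by (simp add: y_def add_ac)
      ultimately have "\<Delta> j \<le> C * r\<^sup>2 / T i"
        unfolding \<Delta>_def x_def Fn_W by (simp add: cn_def norm_minus_commute)
      also have "\<dots> \<le> C * r\<^sup>2 / S ^ e j"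
      proof (rule divide_left_mono)
        have "T (i + 2) = T i ^ (d i * d (Suc i))" by (simp add: T_Suc power_mult)
        also have "\<dots> \<le> T i ^ (dm * dm)"
          using T_ge1 dm(2) by (intro power_increasing mult_le_mono) auto
        finally have "(S ^ e j) ^ (dm * dm) \<le> T i ^ (dm * dm)"
          unfolding i(1)[symmetric] Tqj SdT[symmetric] by (simp add: power_mult[symmetric] mult.commute)
        then show "S ^ e j \<le> T i" using dd T_pos[of i] S(2) power_mono_iff[of "S ^ e j" "T i" "dm * dm"] by simp
      qed (use C(1) S(2) T_pos[of i] in auto)
      also have "\<dots> = C * (M\<^sup>2 / S) ^ e j" by (simp add: r_def power_divide power_mult[symmetric] mult.commute)
      finally show ?thesis .
    qed
    \<comment> \<open>The initial difference does not depend on \<open>j\<close>, so it vanishes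
      when \<open>j\<close> tends to infinity for fixed \<open>q\<close>.\<close>
    have "\<Delta> 0 \<le> C * (1 / 2) ^ j" for j
    proof -
      have "\<Delta> 0 \<le> (\<Lambda> * M) ^ (2 * e j) * (C * (M\<^sup>2 / S) ^ e j)"
        using LM by (intro order_trans[OF step[of j]] mult_left_mono small) auto
      also have "\<dots> = C * (V / S) ^ e j"
        by (simp add: V_def power_mult power_divide power_mult_distrib)
      also have "\<dots> \<le> C * (1 / 2) ^ e j"
        using S V C(1) by (intro mult_left_mono power_mono) (auto simp: field_simps)
      also have "\<dots> \<le> C * (1 / 2) ^ j"
        using C(1) E_ge[of j q] by (intro mult_left_mono power_decreasing) (auto simp: e_def)
      finally show ?thesis .
    qed
    then have "\<Delta> 0 \<le> 0"
      by (intro LIMSEQ_le_const[of "\<lambda>j. C * (1 / 2) ^ j"]) (real_asymp, blast)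
    then show ?thesis by (auto simp: \<Delta>_def cn_def x_def y_def prod_eq_iff max_def split: if_splits)
  qed
  have "Fn (q + 2 * k) = Fn q" if q: "q \<ge> max m0 (max (m1 + 2) m2)" for q
  proof
    fix z
    have "f1 (q + 2 * k) z - f1 q z = 0"
    proof (rule poly_fun_zero_on_bidisc[OF poly_fun_diff])
      show "f1 (q + 2 * k) (u, v) - f1 q (u, v) = 0" if "norm u \<le> 1" "norm v \<le> 1" for u v
        using eq[OF q, of "(u, v)"] that by (simp add: f1_def cn_def)
    qed (rule poly_fun_f12)+
    moreover have "f2 (q + 2 * k) z - f2 q z = 0"
    proof (rule poly_fun_zero_on_bidisc[OF poly_fun_diff])
      show "f2 (q + 2 * k) (u, v) - f2 q (u, v) = 0" if "norm u \<le> 1" "norm v \<le> 1" for u v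
        using eq[OF q, of "(u, v)"] that by (simp add: f2_def cn_def)
    qed (rule poly_fun_f12)+
    ultimately show "Fn (q + 2 * k) z = Fn q z" by (simp add: Fn_eq)
  qed
  then show ?thesis by blast
qed

text \<open>The relation with \<open>H\<close> can be read backwards: each conjugate is determined
  by the next one. At indices \<open>2 * k\<close> apart this uses the same maps, so equality
  descends to all times.\<close>

lemma Fn_period: "Fn (n + 2 * k) = Fn n"
proof -
  obtain m where m: "\<And>q. q \<ge> m \<Longrightarrow> Fn (q + 2 * k) = Fn q" using Fn_period_eventually by blast
  have pull: "Fn i w = Hi i (Fn (Suc i) (H i w))" for i w by (simp add: Fn_H)
  have hi: "Hi (i + 2 * k) = Hi i" for i using per_2k by (simp add: Hi_def)
  show ?thesis
  proof (cases "n \<ge> m")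
    case False
    then have "n \<le> m" by simp
    then show ?thesis
    proof (induction n rule: inc_induct)
      case (step i)
      have "Fn (i + 2 * k) w = Fn i w" for w
        using pull[of "i + 2 * k" w] pull[of i w] step.IH by (simp add: H_2k hi)
      then show ?case by blast
    qed (use m in simp)
  qed (use m in simp)
qed

lemma Fn_multiple: "Fn (2 * k * j) = Fn 0"
proof (induction j)
  case (Suc j)
  have "2 * k * Suc j = 2 * k * j + 2 * k" by simp
  then show ?case using Fn_period[of "2 * k * j"] Suc by metis
qed simp

text \<open>\<open>F\<close> equals its conjugates at all times \<open>2 * k * j\<close>, so
  \<open>estimates\<close> and \<open>sml_a2\<close> hold for \<open>F\<close> itself with
  \<open>T (2 * k * j)\<close> arbitrarily large. The remainder and \<open>a2\<close> must then
  vanish.\<close>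

lemma affine_triangular:
  "\<exists>a b d f g. a \<noteq> 0 \<and> d \<noteq> 0 \<and> (\<forall>x y. F (x, y) = (a * x + b * y + f, d * y + g))"
proof -
  have mult: "f1 (2 * k * j) = f1 0" "f2 (2 * k * j) = f2 0" for j
    by (simp_all add: f1_def[abs_def] f2_def[abs_def] Fn_multiple)
  have le: "j \<le> 2 * k * j" for j using k by (cases k) auto
  have a2: "a2 0 = 0"
  proof (rule ccontr)
    assume "a2 0 \<noteq> 0"
    then have "norm (a2 0) > 0" by simp
    from sml_arbitrarily_small[OF sml_a2 this] obtain m where "\<And>n. n \<ge> m \<Longrightarrow> norm (a2 n) < norm (a2 0)" by blast
    from this[OF le[of m]] show False by (simp add: a2_def mult)
  qed
  have aff: "f (x, y) = f (0, 0) + Dx f (0, 0) * x + Dy f (0, 0) * y" if f: "f = f1 0 \<or> f = f2 0" for f x y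
  proof -
    define r where "r = max (norm x) (norm y)"
    obtain m where m: "\<And>n. n \<ge> m \<Longrightarrow> n \<ge> n1 \<and> r \<le> T n / (4 * K)" using T_large by blast
    have le': "norm (f (x, y) - (f (0, 0) + Dx f (0, 0) * x + Dy f (0, 0) * y)) \<le> K6 * r\<^sup>2 / T (2 * k * j)" if "j \<ge> m" for j
      using m[of "2 * k * j"] order_trans[OF that le[of j]] f mult
      by (intro estimates(5)) (auto simp: r_def)
    have "norm (f (x, y) - (f (0, 0) + Dx f (0, 0) * x + Dy f (0, 0) * y)) \<le> 0 + \<epsilon>" if \<epsilon>: "\<epsilon> > 0" for \<epsilon>
    proof -
      obtain m' where m': "\<And>n. n \<ge> m' \<Longrightarrow> T n \<ge> K6 * r\<^sup>2 / \<epsilon>" using T_unbounded by blast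
      have "T (2 * k * max m m') \<ge> K6 * r\<^sup>2 / \<epsilon>" using le[of "max m m'"] by (intro m') linarith
      then have "K6 * r\<^sup>2 / T (2 * k * max m m') \<le> \<epsilon>" using \<epsilon> by (simp add: field_simps)
      then show ?thesis using le'[of "max m m'"] by simp
    qed
    then have "norm (f (x, y) - (f (0, 0) + Dx f (0, 0) * x + Dy f (0, 0) * y)) \<le> 0" by (rule field_le_epsilon)
    then show ?thesis by simp
  qed
  have "a1 0 * b2 0 \<noteq> 0" using jac_Fn[of 0] jac_F(1) a2 by simp
  then have nz: "a1 0 \<noteq> 0" "b2 0 \<noteq> 0" by auto
  have "F (x, y) = (a1 0 * x + b1 0 * y + c1 0, b2 0 * y + c2 0)" for x y
  proof -
    have "F (x, y) = (f1 0 (x, y), f2 0 (x, y))" by (simp add: f1_def f2_def Fn_def)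
    then show ?thesis using aff[of "f1 0" x y] aff[of "f2 0" x y] a2
      by (simp add: a1_def b1_def a2_def b2_def c1_def c2_def)
  qed
  then show ?thesis using nz by blast
qed

end

section \<open>Conclusion\<close>

context henon_periodic begin

lemma preserving_automorphism_triangular:
  assumes F: "poly_map F" and G: "poly_map G" and GF: "\<And>z. G (F z) = z" and FG: "\<And>z. F (G z) = z"
    and FL: "\<And>z. z \<in> L \<Longrightarrow> F z \<in> L" and GL: "\<And>z. z \<in> L \<Longrightarrow> G z \<in> L"
  shows "\<exists>a b d f g. a \<noteq> 0 \<and> d \<noteq> 0 \<and> (\<forall>x y. F (x, y) = (a * x + b * y + f, d * y + g))"
proof -
  obtain C where C: "C \<ge> 1" "\<And>z. z \<in> L \<Longrightarrow> mx (F z) \<le> C * mx z"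
    using linear_growth[OF F G GF FG FL GL] by blast
  \<comment> \<open>With exponent 1 the degree condition of \<open>conj_bound\<close> holds with
    equality for \<open>n = Suc m\<close>, so source and target are taken at the same time.\<close>
  have gr: "mx (F z) \<le> C * mx z powr 1" if "z \<in> L" for z
    using C(2)[OF that] order_trans[OF zero_le_one mx_ge1[of z]] by simp
  from conj_bound[OF F FL C(1) zero_le_one gr]
  obtain K where K: "K \<ge> 1 \<and> (\<forall>n m. Suc m \<le> n \<longrightarrow> 1 * real (D n) * D n \<le> D (Suc m) * D (Suc m) \<longrightarrow> T n \<ge> K \<longrightarrow>
    (\<forall>u v. norm u \<le> T n / K \<longrightarrow> norm v \<le> T n / K \<longrightarrow> cn (\<Phi> (Suc m) (F (\<Psi> n (u, v)))) \<le> K * T (Suc m)))"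
    by (rule exE)
  obtain m where m: "\<And>n. n \<ge> m \<Longrightarrow> T n \<ge> K" using T_unbounded by blast
  have bound: "cn (\<Phi> n (F (\<Psi> n (u, v)))) \<le> K * T n" if n: "n \<ge> Suc m" and u: "norm u \<le> T n / K" "norm v \<le> T n / K" for n u v
  proof -
    obtain i where i: "n = Suc i" using n by (cases n) auto
    have "T n \<ge> K" using n by (intro m) simp
    then show ?thesis using K[THEN conjunct2, rule_format, of i n u v] u i by simp
  qed
  interpret henon_aut p \<delta> A c k F G K "Suc m"
    by unfold_locales (use F G GF K[THEN conjunct1] bound in auto)
  show ?thesis by (rule affine_triangular)
qed

end

text \<open>The requirements of \<open>henon_seq\<close> on a single factor, arranged to persist
  when \<open>C\<close> grows, so that the maximum over all factors serves as
  \<open>A\<close>.\<close>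

definition henon_bounds :: "complex poly \<Rightarrow> complex \<Rightarrow> real \<Rightarrow> bool" where
  "henon_bounds q e C \<longleftrightarrow> C \<ge> 1 \<and> norm e \<le> C \<and> 1 / C \<le> norm e \<and>
     (\<forall>y. norm (poly q y) \<le> C * max 1 (norm y) ^ degree q) \<and>
     (\<forall>y. norm y \<ge> C \<longrightarrow> norm y ^ degree q / C \<le> norm (poly q y))"

lemma henon_bounds_mono:
  assumes "henon_bounds q e C" "C \<le> C'" shows "henon_bounds q e C'"
proof -
  have C: "C \<ge> 1" "norm e \<le> C" "1 / C \<le> norm e" and le: "\<And>y. norm (poly q y) \<le> C * max 1 (norm y) ^ degree q"
    and ge: "\<And>y. norm y \<ge> C \<Longrightarrow> norm y ^ degree q / C \<le> norm (poly q y)"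
    using assms(1) by (auto simp: henon_bounds_def)
  have "1 / C' \<le> 1 / C" using C assms(2) by (intro divide_left_mono) auto
  moreover have "norm (poly q y) \<le> C' * max 1 (norm y) ^ degree q" for y
    using le[of y] mult_right_mono[OF assms(2), of "max 1 (norm y) ^ degree q"] by (simp add: order_trans)
  moreover have "norm y ^ degree q / C' \<le> norm (poly q y)" if "norm y \<ge> C'" for y
  proof -
    have "norm y ^ degree q / C' \<le> norm y ^ degree q / C" using C assms(2) by (intro divide_left_mono) auto
    then show ?thesis using ge[of y] that assms(2) by linarith
  qed
  ultimately show ?thesis using C assms(2) by (auto simp: henon_bounds_def)
qed

lemma henon_bounds_exist:
  assumes "degree q > 0" "e \<noteq> 0" shows "\<exists>C. henon_bounds q e C"
proof -
  obtain C1 where C1: "\<And>y. norm (poly q y) \<le> C1 * max 1 (norm y) ^ degree q" using poly_growth_le by blast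
  obtain C2 where C2: "C2 \<ge> 1" "\<And>y. norm y \<ge> C2 \<Longrightarrow> norm y ^ degree q / C2 \<le> norm (poly q y)"
    using poly_growth_ge[OF assms(1)] by blast
  define C where "C = Max {C1, C2, norm e, 1 / norm e}"
  have C: "C \<ge> C1" "C \<ge> C2" "C \<ge> norm e" "C \<ge> 1 / norm e" by (auto simp: C_def)
  have C0: "C \<ge> 1" using C C2 by linarith
  have "1 / C \<le> norm e" using C(4) C0 assms(2) by (simp add: field_simps)
  moreover have "norm (poly q y) \<le> C * max 1 (norm y) ^ degree q" for y
    using C1[of y] mult_right_mono[OF C(1), of "max 1 (norm y) ^ degree q"] by (simp add: order_trans)
  moreover have "norm y ^ degree q / C \<le> norm (poly q y)" if "norm y \<ge> C" for y
  proof -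
    have "norm y ^ degree q / C \<le> norm y ^ degree q / C2" using C C2 by (intro divide_left_mono) auto
    then show ?thesis using C2(2)[of y] that C by linarith
  qed
  ultimately show ?thesis using C C0 by (auto simp: henon_bounds_def)
qed

theorem theorem1p3:
  fixes hs :: "(complex poly \<times> complex) list"
    and F :: "complex \<times> complex \<Rightarrow> complex \<times> complex"
    and c :: real
  assumes "henon_data hs"
    and "polynomial_automorphism F"
    and "c > 0"
    and "F ` green_level hs c = green_level hs c"
  shows "\<exists>a b d f g. a \<noteq> 0 \<and> d \<noteq> 0 \<and>
           (\<forall>x y. F (x, y) = (a * x + b * y + f, d * y + g))"
proof -
  define k where "k = length hs"
  define p where "p n = fst (hs ! (n mod k))" for n
  define \<delta> where "\<delta> n = snd (hs ! (n mod k))" for n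
  have k: "k > 0" using assms(1) by (simp add: k_def henon_data_def)
  have data: "degree (p n) \<ge> 2" "\<delta> n \<noteq> 0" for n
  proof -
    have "hs ! (n mod k) \<in> set hs" using k by (simp add: k_def)
    then show "degree (p n) \<ge> 2" "\<delta> n \<noteq> 0" using assms(1) by (auto simp: henon_data_def p_def \<delta>_def)
  qed
  have "\<exists>C. henon_bounds (p n) (\<delta> n) C" for n
    using data[of n] by (intro henon_bounds_exist) auto
  then obtain Cf where Cf: "\<And>n. henon_bounds (p n) (\<delta> n) (Cf n)" by metis
  define A where "A = Max (Cf ` {..<k})"
  have hb: "henon_bounds (p n) (\<delta> n) A" for n
  proof -
    have "Cf (n mod k) \<le> A" unfolding A_def using k by (intro Max_ge) auto
    then have "henon_bounds (p (n mod k)) (\<delta> (n mod k)) A" by (rule henon_bounds_mono[OF Cf])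
    then show ?thesis by (simp add: p_def \<delta>_def)
  qed
  interpret henon_periodic p \<delta> A c k
  proof unfold_locales
    show "p (n + k) = p n" "\<delta> (n + k) = \<delta> n" for n by (simp_all add: p_def \<delta>_def)
  qed (use hb assms(3) data k in \<open>auto simp: henon_bounds_def\<close>)
  \<comment> \<open>For \<open>j \<le> k\<close> the reduction of indices modulo \<open>k\<close>
    has no effect before time \<open>j\<close>, so the periodic sequence runs once through the
    list.\<close>
  have "\<Phi> j z = fold elementary_henon (take j hs) z" if "j \<le> k" for j z
    using that
  proof (induction j)
    case (Suc j)
    then have "H j = elementary_henon (hs ! j)"
      by (simp add: H_def elementary_henon_def p_def \<delta>_def case_prod_unfold fun_eq_iff)
    then show ?case using Suc by (simp add: take_Suc_conv_app_nth k_def \<Phi>.simps(2))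
  qed simp
  from this[of k] have \<Phi>k: "\<Phi> k = henon_map hs" by (auto simp: henon_map_def k_def)
  have Dk: "D k = henon_degree hs"
  proof -
    have "prod_list xs = (\<Prod>i<length xs. xs ! i)" for xs :: "nat list"
      by (induction xs rule: rev_induct) (auto simp: nth_append intro!: prod.cong)
    from this[of "map (\<lambda>(p, \<delta>). degree p) hs"] show ?thesis
      by (simp add: D_def d_def henon_degree_def k_def p_def case_prod_unfold)
  qed
  have L: "green_level hs c = L"
    unfolding green_level_def L_def green_plus_def \<Phi>k[symmetric] Dk[symmetric] green_eq_lim ..
  have bij: "bij F" and pm: "poly_map F" "poly_map (inv F)"
    using assms(2) by (auto simp: polynomial_automorphism_def polynomial_map_def poly_map_def poly_fun_def fun_eq_iff)
  show ?thesis
  proof (rule preserving_automorphism_triangular[OF pm])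
    show "inv F (F z) = z" "F (inv F z) = z" for z using bij by (auto simp: bij_is_inj bij_is_surj surj_f_inv_f)
    show "F z \<in> L" if "z \<in> L" for z using assms(4) that L by auto
    show "inv F z \<in> L" if "z \<in> L" for z
      using assms(4) that bij unfolding L by (metis bij_inv_eq_iff image_iff)
  qed
qed

end
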